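(* Let $k \ge 6$ and $N \ge 5k+3$ be integers, and let $G := K_N$ be the complete graph on $N$ vertices with a red-blue coloring of its edges such that $G$ contains no red copy of the cycle $C_{2k+1}$ and no blue copy of the wheel $W_{2k+1}$. Then there is a partition $\{U_0, U_1, U_2, U_3\}$ of $V(G)$ such that $|U_0| \le 2$, $|U_i| \le 2k$ for $1 \le i \le 3$, and in $G - U_0$ every edge with both endpoints in the same class among $U_1, U_2, U_3$ is red, while every edge joining two different classes among $U_1, U_2, U_3$ is blue.
   Context: $C_n$ denotes the cycle on $n$ vertices. The wheel $W_n := C_n \ast K_1$ is the graph obtained from the cycle $C_n$ (the rim) by adding one new vertex (the hub) adjacent to all vertices of the cycle; it has $n+1$ vertices. A red (blue) copy of a graph $F$ is a subgraph isomorphic to $F$ all of whose edges are red (blue). *)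

theory Defs
  imports Main "HOL-Library.Disjoint_Sets"
begin

datatype 'a graph = Graph (verts: "'a set") (edges: "'a set set")

definition simple_graph :: "'a graph \<Rightarrow> bool" where
  "simple_graph G \<longleftrightarrow> (\<forall>e\<in>edges G. e \<subseteq> verts G \<and> card e = 2)"

definition subgraph :: "'a graph \<Rightarrow> 'a graph \<Rightarrow> bool" where
  "subgraph H G \<longleftrightarrow> simple_graph H \<and> verts H \<subseteq> verts G \<and> edges H \<subseteq> edges G"

(* Adequate for simple graphs: an edge is determined by its two endpoints. *)
definition isomorphic :: "'a graph \<Rightarrow> 'b graph \<Rightarrow> bool" where
  "isomorphic G H \<longleftrightarrow>
     (\<exists>f. bij_betw f (verts G) (verts H) \<and>
          (\<forall>u\<in>verts G. \<forall>v\<in>verts G. {u, v} \<in> edges G \<longleftrightarrow> {f u, f v} \<in> edges H))"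

definition complete_graph :: "'a set \<Rightarrow> 'a graph" where
  "complete_graph V = Graph V {e. e \<subseteq> V \<and> card e = 2}"

(* A cycle, and a simple graph, only for n \<ge> 3. *)
definition cycle_graph :: "nat \<Rightarrow> nat graph" where
  "cycle_graph n = Graph {..<n} {{i, Suc i mod n} | i. i < n}"

definition graph_join :: "'a graph \<Rightarrow> 'b graph \<Rightarrow> ('a + 'b) graph" where
  "graph_join G H = Graph (verts G <+> verts H)
     ((`) Inl ` edges G \<union> (`) Inr ` edges H \<union>
      {{Inl u, Inr v} | u v. u \<in> verts G \<and> v \<in> verts H})"

definition wheel_graph :: "nat \<Rightarrow> (nat + unit) graph" where
  "wheel_graph n = graph_join (cycle_graph n) (complete_graph {()})"

definition delete_verts :: "'a graph \<Rightarrow> 'a set \<Rightarrow> 'a graph" where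
  "delete_verts G U = Graph (verts G - U) {e \<in> edges G. e \<inter> U = {}}"

datatype colour = Red | Blue

(* Edge colourings are total on sets of vertices; only the values on edges of G matter. *)
definition has_mono_copy :: "'a graph \<Rightarrow> ('a set \<Rightarrow> colour) \<Rightarrow> colour \<Rightarrow> 'b graph \<Rightarrow> bool" where
  "has_mono_copy G col c F \<longleftrightarrow>
     (\<exists>H. subgraph H G \<and> isomorphic F H \<and> (\<forall>e\<in>edges H. col e = c))"

end

theory Submission
  imports Defs
begin

text \<open>
  Write \<open>E\<close> for the red relation and \<open>opp E\<close> for the blue one.
  If every vertex had at most \<open>3k\<close> blue neighbours, the red minimum degree would be large enough to
  lengthen a red triangle in steps of two up to \<open>C\<^bsub>2k+1\<^esub>\<close>. Hence some vertex \<open>v\<close> has at least \<open>3k + 1\<close>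
  blue neighbours, and its blue neighbourhood \<open>X\<close> contains no monochromatic \<open>C\<^bsub>2k+1\<^esub>\<close>.

  In any such \<open>X\<close> a longest monochromatic cycle has at least \<open>2k + 1\<close> vertices, and a monochromatic
  cycle of minimal length \<open>n > 2k + 1\<close> has \<open>n\<close> even, its two parity classes being cliques of the other
  colour. These two cliques absorb the rest of \<open>X\<close>. Blue cliques would cover at most \<open>5k + 2\<close> vertices
  of the graph, so they are red: \<open>X = P \<union> Q\<close>, each part attached to a red clique.

  Two disjoint red paths between \<open>P\<close> and \<open>Q\<close> could be closed to a red \<open>C\<^bsub>2k+1\<^esub>\<close>, as the lengths inside
  \<open>P\<close> and \<open>Q\<close> are flexible. Therefore removing one vertex \<open>s\<close> leaves two sides with only blue edges
  between them. The smaller side is a red clique by Dirac's theorem in the larger one, so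
  the larger side \<open>S\<close> still has at least \<open>3k + 2\<close> vertices and lies in a blue neighbourhood; splitting it
  in the same way, with a second exceptional vertex, yields the other two classes.
\<close>

text \<open>The length \<open>2k+1\<close> must be hit exactly, so a longer monochromatic cycle
  excludes nothing by itself; its minimality does, since the absence of cycles one shorter dictates
  the colours of many chords. That some cycle of length at least \<open>2k+1\<close> exists rests on
  Jackson's theorem for bipartite graphs: a longest monochromatic cycle with at most
  \<open>2k\<close> vertices leaves more than \<open>k\<close> vertices of \<open>X\<close> outside,
  each joined to at least half of the cycle in the other colour, and this produces a longer cycle of
  that colour. \<open>k >= 6\<close> makes \<open>3k+1 >= 19\<close>, the size at which a first
  monochromatic cycle of length at least 5 is available. \<open>5k+3\<close> is tight twice: it
  gives red degrees \<open>d\<close> with \<open>3d >= N+k+3\<close>, the price of lengthening an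
  odd cycle by two, and it exceeds by one the bound \<open>(k+1) + 2k + (2k+1)\<close> on two blue
  cliques with their attachments. Red cycles are forbidden everywhere, blue ones only inside blue
  neighbourhoods. There the colours are interchangeable, so most lemmas speak of an arbitrary
  relation; excluding blue cliques has to count vertices outside \<open>X\<close>.\<close>

section \<open>Relations, cycles and their cyclic enumerations\<close>

definition simple :: "('a \<Rightarrow> 'a \<Rightarrow> bool) \<Rightarrow> bool" where
  "simple E \<longleftrightarrow> (\<forall>x y. E x y \<longrightarrow> E y x) \<and> (\<forall>x. \<not> E x x)"

definition opp :: "('a \<Rightarrow> 'a \<Rightarrow> bool) \<Rightarrow> 'a \<Rightarrow> 'a \<Rightarrow> bool" where
  "opp E x y \<longleftrightarrow> x \<noteq> y \<and> \<not> E x y"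

definition cyc :: "('a \<Rightarrow> 'a \<Rightarrow> bool) \<Rightarrow> 'a set \<Rightarrow> nat \<Rightarrow> bool" where
  "cyc E X n \<longleftrightarrow> (\<exists>xs. length xs = n \<and> 3 \<le> n \<and> set xs \<subseteq> X \<and> distinct xs \<and>
     successively E xs \<and> E (last xs) (hd xs))"

text \<open>Cyclic enumeration of an \<open>n\<close>-cycle, as an \<open>n\<close>-periodic function on the integers.\<close>

definition cycmap :: "('a \<Rightarrow> 'a \<Rightarrow> bool) \<Rightarrow> nat \<Rightarrow> (int \<Rightarrow> 'a) \<Rightarrow> bool" where
  "cycmap E n f \<longleftrightarrow> 3 \<le> n \<and> (\<forall>i j. f i = f j \<longleftrightarrow> i mod int n = j mod int n) \<and> (\<forall>i. E (f i) (f (i + 1)))"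

lemma simple_sym: "simple E \<Longrightarrow> E x y \<longleftrightarrow> E y x"
  by (auto simp: simple_def)

lemma simple_irr: "simple E \<Longrightarrow> \<not> E x x"
  by (auto simp: simple_def)

lemma simple_neq: "simple E \<Longrightarrow> E x y \<Longrightarrow> x \<noteq> y"
  by (auto simp: simple_def)

lemma simple_opp: "simple E \<Longrightarrow> simple (opp E)"
  by (auto simp: simple_def opp_def)

lemma opp_opp: "simple E \<Longrightarrow> opp (opp E) = E"
  by (auto simp: simple_def opp_def fun_eq_iff)

lemma succ_rev: "simple E \<Longrightarrow> successively E (rev xs) \<longleftrightarrow> successively E xs"
proof -
  assume "simple E"
  then have "(\<lambda>x y. E y x) = E" by (auto simp: simple_def fun_eq_iff)
  then show ?thesis by (simp only: successively_rev)
qed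

lemma cyc_mono: "cyc E X n \<Longrightarrow> X \<subseteq> Y \<Longrightarrow> cyc E Y n"
  unfolding cyc_def by blast

lemma cycI:
  assumes "length xs = n" "3 \<le> n" "set xs \<subseteq> X" "distinct xs" "successively E xs" "E (last xs) (hd xs)"
  shows "cyc E X n"
  using assms unfolding cyc_def by blast

lemma cyc_card: "cyc E X n \<Longrightarrow> finite X \<Longrightarrow> n \<le> card X"
  unfolding cyc_def by (metis card_mono distinct_card)

text \<open>Integer indices modulo \<open>n\<close> let arcs wrap around and be run in either
  direction without splitting the list.\<close>

lemma cyc_cycmap:
  assumes "cyc E X n"
  obtains f where "cycmap E n f" "range f \<subseteq> X" "card (range f) = n" "range f = f ` {0..<int n}"
proof -
  obtain xs where xs: "length xs = n" "3 \<le> n" "set xs \<subseteq> X" "distinct xs" "successively E xs" "E (last xs) (hd xs)"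
    using assms unfolding cyc_def by blast
  define f where "f i = xs ! nat (i mod int n)" for i
  have n0: "int n > 0" using xs by simp
  have lt: "nat (i mod int n) < n" for i
    using n0 by (simp add: nat_less_iff)
  have eq: "f i = f j \<longleftrightarrow> i mod int n = j mod int n" for i j
    unfolding f_def using xs(1,4) lt[of i] lt[of j] n0
    by (metis nat_eq_iff2 nth_eq_iff_index_eq pos_mod_sign)
  have step: "E (f i) (f (i + 1))" for i
  proof (cases "nat (i mod int n) + 1 < n")
    case True
    have "0 \<le> i mod int n" using n0 by simp
    then have "i mod int n + 1 < int n" using True by linarith
    then have "(i + 1) mod int n = i mod int n + 1"
      using n0 \<open>0 \<le> i mod int n\<close> by (metis mod_add_left_eq mod_pos_pos_trivial add_increasing2 zero_le_one)
    then have "nat ((i + 1) mod int n) = Suc (nat (i mod int n))"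
      using \<open>0 \<le> i mod int n\<close> by simp
    then show ?thesis unfolding f_def
      using xs(1,5) True by (simp add: successively_conv_nth)
  next
    case False
    have "0 \<le> i mod int n" "i mod int n < int n" using n0 by simp_all
    then have m: "i mod int n = int n - 1" using False by linarith
    then have "(i + 1) mod int n = 0"
      by (metis diff_add_cancel mod_add_left_eq mod_self)
    moreover have "nat (i mod int n) = n - 1" using m by simp
    ultimately show ?thesis unfolding f_def
      using xs(1,2,6) by (simp add: hd_conv_nth last_conv_nth flip: length_greater_0_conv)
  qed
  have c: "cycmap E n f" unfolding cycmap_def using xs(2) eq step by blast
  have inj: "inj_on f {0..<int n}" by (auto intro!: inj_onI simp: eq)
  have rg: "range f = f ` {0..<int n}"
  proof
    show "range f \<subseteq> f ` {0..<int n}"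
    proof
      fix x assume "x \<in> range f"
      then obtain i where "x = f i" by blast
      also have "f i = f (i mod int n)" by (simp add: eq)
      finally show "x \<in> f ` {0..<int n}" using n0 by simp
    qed
  qed auto
  have "range f \<subseteq> X" unfolding f_def using xs(1,3) lt by (auto intro: nth_mem)
  moreover have "card (range f) = n" using inj by (simp add: rg card_image)
  ultimately show ?thesis using that c rg by blast
qed

lemma cycmap_eq: "cycmap E n f \<Longrightarrow> f i = f j \<longleftrightarrow> i mod int n = j mod int n"
  by (simp add: cycmap_def)

lemma cycmap_E: "cycmap E n f \<Longrightarrow> E (f i) (f (i + 1))"
  by (simp add: cycmap_def)

lemma cycmap_per: "cycmap E n f \<Longrightarrow> f (i + int n) = f i"
  by (simp add: cycmap_def)

lemma cycmap_per': "cycmap E n f \<Longrightarrow> f (i - int n) = f i"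
  by (simp add: cycmap_def)

lemma cycmap_neq: "cycmap E n f \<Longrightarrow> i < j \<Longrightarrow> j < i + int n \<Longrightarrow> f i \<noteq> f j"
proof -
  assume c: "cycmap E n f" and a: "i < j" "j < i + int n"
  show "f i \<noteq> f j"
  proof
    assume "f i = f j"
    then have "i mod int n = j mod int n" using c by (simp add: cycmap_eq)
    then have "int n dvd j - i" by (metis mod_eq_dvd_iff)
    then show False using a zdvd_imp_le[of "int n" "j - i"] by simp
  qed
qed

lemma cycmap_inj: "cycmap E n f \<Longrightarrow> b - a < int n \<Longrightarrow> inj_on f {a..b}"
  by (rule linorder_inj_onI) (use cycmap_neq[of E n f] in auto)

lemma cycmap_shift: "cycmap E n f \<Longrightarrow> cycmap E n (\<lambda>i. f (a + i))"
  unfolding cycmap_def by (simp add: mod_eq_dvd_iff flip: add.assoc)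

lemma arc_succ: "(\<And>i. a \<le> i \<Longrightarrow> i < b \<Longrightarrow> E (f i) (f (i + 1))) \<Longrightarrow> successively E (map f [a..b])"
  unfolding successively_conv_nth
proof (intro allI impI)
  fix i assume *: "\<And>i. a \<le> i \<Longrightarrow> i < b \<Longrightarrow> E (f i) (f (i + 1))" and i: "Suc i < length (map f [a..b])"
  then have "a + int i < b" by simp
  then show "E (map f [a..b] ! i) (map f [a..b] ! Suc i)"
    using *[of "a + int i"] by (simp add: ac_simps)
qed

lemma cycmap_arc: "cycmap E n f \<Longrightarrow> successively E (map f [a..b])"
  by (rule arc_succ) (simp add: cycmap_E)

lemma cycmap_arc_rev: "cycmap E n f \<Longrightarrow> simple E \<Longrightarrow> successively E (rev (map f [a..b]))"
  by (simp only: succ_rev cycmap_arc)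

lemma arc_hd: "a \<le> b \<Longrightarrow> hd (map f [a..b]) = f a"
  by (simp add: hd_map upto_rec1)

lemma arc_last: "a \<le> b \<Longrightarrow> last (map f [a..b]) = f b"
  by (simp add: last_map upto_rec2)

lemma arc_rhd: "a \<le> b \<Longrightarrow> hd (rev (map f [a..b])) = f b"
  by (simp only: hd_rev arc_last)

lemma arc_rlast: "a \<le> b \<Longrightarrow> last (rev (map f [a..b])) = f a"
  by (simp only: last_rev arc_hd)

lemma arc_distinct: "cycmap E n f \<Longrightarrow> b - a < int n \<Longrightarrow> distinct (map f [a..b])"
  by (simp add: distinct_map cycmap_inj)

lemma arc_ne: "a \<le> b \<Longrightarrow> map f [a..b] \<noteq> []"
  by simp

lemma arc_disj: "cycmap E n f \<Longrightarrow> b < c \<Longrightarrow> d - a < int n \<Longrightarrow> f ` {a..b} \<inter> f ` {c..d} = {}"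
  using cycmap_neq[of E n f] by fastforce

lemma cyc_skip:
  assumes c: "cycmap E n f" "simple E" and n: "4 \<le> n" and e: "E (f i) (f (i + 2))"
  shows "cyc E (range f) (n - 1)"
proof (rule cycI)
  let ?l = "map f [i + 2..i + int n]"
  have le: "i + 2 \<le> i + int n" using n by simp
  show "length ?l = n - 1" using n by simp
  show "3 \<le> n - 1" using n by simp
  show "set ?l \<subseteq> range f" by auto
  show "distinct ?l" by (rule arc_distinct[OF c(1)]) simp
  show "successively E ?l" by (rule cycmap_arc[OF c(1)])
  show "E (last ?l) (hd ?l)" using e by (simp only: arc_hd[OF le] arc_last[OF le] cycmap_per[OF c(1)])
qed

text \<open>Running the arc from \<open>j\<close> back to \<open>i + 1\<close> and going on at
  \<open>j + 2\<close> leaves out \<open>f (j + 1)\<close> alone. When cycles of length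
  \<open>n - 1\<close> are excluded, one of the two chords in \<open>E\<close> therefore puts the
  other into \<open>opp E\<close>.\<close>

lemma cyc_cross:
  assumes c: "cycmap E n f" "simple E" and n: "4 \<le> n"
    and ij: "i + 1 \<le> j" "j + 2 \<le> i + int n"
    and e: "E (f i) (f j)" "E (f (i + 1)) (f (j + 2))"
  shows "cyc E (range f) (n - 1)"
proof (rule cycI)
  let ?a = "rev (map f [i + 1..j])" and ?b = "map f [j + 2..i + int n]"
  have le: "j + 2 \<le> i + int n" "i + 1 \<le> j" using ij by auto
  show "length (?a @ ?b) = n - 1" using ij by simp
  show "3 \<le> n - 1" using n by simp
  show "set (?a @ ?b) \<subseteq> range f" by auto
  show "distinct (?a @ ?b)"
    using arc_distinct[OF c(1), of "i + int n" "j + 2"] arc_distinct[OF c(1), of j "i + 1"]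
      arc_disj[OF c(1), of j "j + 2" "i + int n" "i + 1"] ij
    by (simp add: image_Int)
  show "successively E (?a @ ?b)"
    using cycmap_arc[OF c(1)] cycmap_arc_rev[OF c] e(2)
    by (simp only: successively_append_iff arc_rlast[OF le(2)] arc_hd[OF le(1)]) simp
  show "E (last (?a @ ?b)) (hd (?a @ ?b))"
    using e(1) arc_ne[OF le(1), of f] arc_ne[OF le(2), of f]
    by (simp only: last_append hd_append arc_rhd[OF le(2)] arc_last[OF le(1)] cycmap_per[OF c(1)] rev_is_Nil_conv) simp
qed

section \<open>Alternating paths and odd cycles in complete bipartite pieces\<close>

fun interleave :: "'a list \<Rightarrow> 'a list \<Rightarrow> 'a list" where
  "interleave (a # as) (b # bs) = a # b # interleave as bs"
| "interleave _ _ = []"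

lemma interleave_props:
  assumes "length as = length bs" "simple E" "\<forall>a\<in>set as. \<forall>b\<in>set bs. E a b" "distinct as" "distinct bs"
  shows "length (interleave as bs) = 2 * length as \<and> set (interleave as bs) = set as \<union> set bs \<and>
    distinct (interleave as bs) \<and> successively E (interleave as bs) \<and>
    (as \<noteq> [] \<longrightarrow> hd (interleave as bs) = hd as \<and> last (interleave as bs) = last bs)"
  using assms
proof (induction as bs rule: list_induct2)
  case Nil then show ?case by simp
next
  case (Cons a as b bs)
  then have IH: "length (interleave as bs) = 2 * length as" "set (interleave as bs) = set as \<union> set bs"
    "distinct (interleave as bs)" "successively E (interleave as bs)"
    "as \<noteq> [] \<longrightarrow> hd (interleave as bs) = hd as \<and> last (interleave as bs) = last bs"
    by auto
  have ab: "a \<noteq> b" "a \<notin> set bs" "b \<notin> set as" using Cons.prems by (auto simp: simple_irr)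
  have "E a b" using Cons.prems by auto
  moreover have "E b (hd as)" if "as \<noteq> []" using Cons.prems that by (auto simp: simple_sym[of E b])
  moreover have "interleave as bs = [] \<longleftrightarrow> as = []" using IH(1) by auto
  moreover have "bs = [] \<longleftrightarrow> as = []" using Cons.hyps by auto
  ultimately show ?case using IH ab Cons.prems
    by (auto simp: successively_Cons)
qed

lemma list_hd:
  assumes "finite A" "a \<in> A" "1 \<le> m" "m \<le> card A"
  obtains xs where "distinct xs" "length xs = m" "set xs \<subseteq> A" "hd xs = a" "xs \<noteq> []"
proof -
  have "m - 1 \<le> card (A - {a})" using assms by simp
  then obtain T where T: "T \<subseteq> A - {a}" "card T = m - 1" "finite T"
    using assms(1) obtain_subset_with_card_n by (metis finite_Diff rev_finite_subset)
  obtain ys where ys: "set ys = T" "distinct ys" using finite_distinct_list[OF T(3)] by blast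
  have "length ys = m - 1" using ys T distinct_card by fastforce
  then show ?thesis using ys T assms by (intro that[of "a # ys"]) auto
qed

lemma list_last:
  assumes "finite A" "a \<in> A" "1 \<le> m" "m \<le> card A"
  obtains xs where "distinct xs" "length xs = m" "set xs \<subseteq> A" "last xs = a" "xs \<noteq> []"
proof -
  obtain xs where "distinct xs" "length xs = m" "set xs \<subseteq> A" "hd xs = a" "xs \<noteq> []"
    by (rule list_hd[OF assms])
  then show ?thesis by (intro that[of "rev xs"]) (auto simp: last_rev)
qed

definition joined :: "('a \<Rightarrow> 'a \<Rightarrow> bool) \<Rightarrow> 'a set \<Rightarrow> 'a set \<Rightarrow> bool" where
  "joined E A B \<longleftrightarrow> (\<forall>a\<in>A. \<forall>b\<in>B. E a b)"

lemma joined_disj: "simple E \<Longrightarrow> joined E A B \<Longrightarrow> A \<inter> B = {}"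
  unfolding joined_def using simple_irr[of E] by blast

lemma joined_sym: "simple E \<Longrightarrow> joined E A B \<longleftrightarrow> joined E B A"
  by (auto simp: joined_def simple_def)

lemma joined_mono: "joined E A B \<Longrightarrow> A' \<subseteq> A \<Longrightarrow> B' \<subseteq> B \<Longrightarrow> joined E A' B'"
  by (auto simp: joined_def)

lemma bip_path:
  assumes E: "simple E" "joined E A B" "finite A" "finite B" "a \<in> A" "b \<in> B"
    and m: "1 \<le> m" "m \<le> card A" "m \<le> card B"
  obtains xs where "distinct xs" "successively E xs" "length xs = 2 * m" "set xs \<subseteq> A \<union> B"
    "hd xs = a" "last xs = b" "xs \<noteq> []"
proof -
  obtain as where as: "distinct as" "length as = m" "set as \<subseteq> A" "hd as = a" "as \<noteq> []"
    by (rule list_hd[OF E(3,5) m(1,2)])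
  obtain bs where bs: "distinct bs" "length bs = m" "set bs \<subseteq> B" "last bs = b" "bs \<noteq> []"
    by (rule list_last[OF E(4,6) m(1,3)])
  have "length as = length bs" "\<forall>a\<in>set as. \<forall>b\<in>set bs. E a b"
    using as bs E(2) by (auto simp: joined_def)
  note p = interleave_props[OF this(1) E(1) this(2) as(1) bs(1)]
  show ?thesis
    by (rule that[of "interleave as bs"]) (use p as bs m in \<open>auto simp flip: length_greater_0_conv\<close>)
qed

text \<open>One edge \<open>x x'\<close> inside \<open>B\<close> repairs the parity: an alternating
  path on \<open>2m\<close> vertices that starts in \<open>A\<close>, avoids \<open>x\<close> and
  ends in \<open>x'\<close> is closed through \<open>x\<close>. Many of the cycles of exact length
  \<open>2k+1\<close> below arise this way.\<close>

lemma bip_odd_cycle: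
  assumes E: "simple E" "joined E A B" "finite A" "finite B" "x \<in> B" "x' \<in> B" "E x x'"
    and m: "1 \<le> m" "m \<le> card A" "m + 1 \<le> card B"
  shows "cyc E (A \<union> B) (2 * m + 1)"
proof -
  have nx: "x \<noteq> x'" by (rule simple_neq[OF E(1,7)])
  obtain a where a: "a \<in> A" using m by (metis all_not_in_conv card.empty le_zero_eq not_one_le_zero)
  have c: "joined E A (B - {x})" "finite (B - {x})" "x' \<in> B - {x}" "m \<le> card (B - {x})"
    using E m nx by (auto simp: joined_def)
  obtain xs where xs: "distinct xs" "successively E xs" "length xs = 2 * m" "set xs \<subseteq> A \<union> (B - {x})"
    "hd xs = a" "last xs = x'" "xs \<noteq> []"
    by (rule bip_path[OF E(1) c(1) E(3) c(2) a c(3) m(1,2) c(4)])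
  have xA: "x \<notin> A" using joined_disj[OF E(1,2)] E(5) by blast
  have "E x a" using a E(1,2,5) by (auto simp: joined_def simple_sym[of E x])
  then show ?thesis
    by (intro cycI[of "x # xs"]) (use xs xA E m in \<open>auto simp: successively_Cons simple_sym[of E x]\<close>)
qed

section \<open>Longest paths: an end of low degree, and Dirac's theorem\<close>

lemma longest_path:
  assumes "finite S" "S \<noteq> {}"
  obtains xs where "distinct xs" "successively E xs" "set xs \<subseteq> S" "xs \<noteq> []"
    "\<forall>ys. distinct ys \<longrightarrow> successively E ys \<longrightarrow> set ys \<subseteq> S \<longrightarrow> length ys \<le> length xs"
proof -
  let ?P = "\<lambda>xs. distinct xs \<and> successively E xs \<and> set xs \<subseteq> S \<and> xs \<noteq> []"
  obtain s where "s \<in> S" using assms by blast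
  then have ex: "?P [s]" by simp
  have bd: "\<forall>xs. ?P xs \<longrightarrow> length xs < card S + 1"
    using assms(1) by (metis card_mono distinct_card le_imp_less_Suc Suc_eq_plus1)
  obtain xs where xs: "?P xs" "\<forall>ys. ?P ys \<longrightarrow> length ys \<le> length xs"
    using ex_has_greatest_nat[of ?P "[s]" length, OF ex bd] by blast
  have "length ys \<le> length xs" if "distinct ys" "successively E ys" "set ys \<subseteq> S" for ys
    using xs(2) that by (cases "ys = []") auto
  then show ?thesis using that xs by blast
qed

text \<open>The first vertex of a longest path has all its neighbours on the path, and one at
  position \<open>m\<close> or later would close a cycle on more than \<open>m\<close> vertices; the
  positions \<open>1\<close> to \<open>m - 1\<close> remain.\<close>

lemma low_degree_end:
  assumes "simple E" "finite S" "S \<noteq> {}" "2 \<le> m" "\<And>n. m < n \<Longrightarrow> \<not> cyc E S n"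
  obtains x where "x \<in> S" "card {y \<in> S. E x y} < m"
proof -
  obtain xs where xs: "distinct xs" "successively E xs" "set xs \<subseteq> S" "xs \<noteq> []"
    and mx0: "\<forall>ys. distinct ys \<longrightarrow> successively E ys \<longrightarrow> set ys \<subseteq> S \<longrightarrow> length ys \<le> length xs"
    by (rule longest_path[OF assms(2,3), of E])
  note mx = mx0[rule_format]
  let ?x = "hd xs"
  have xS: "?x \<in> S" using xs by auto
  have nb: "y \<in> set xs" if "y \<in> S" "E ?x y" for y
  proof (rule ccontr)
    assume "y \<notin> set xs"
    then have "length (y # xs) \<le> length xs"
      by (intro mx) (use that xs assms(1) in \<open>auto simp: successively_Cons simple_sym[of E y]\<close>)
    then show False by simp
  qed
  have "{y \<in> S. E ?x y} \<subseteq> (\<lambda>i. xs ! i) ` {1..<m}"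
  proof
    fix y assume y: "y \<in> {y \<in> S. E ?x y}"
    then obtain i where i: "i < length xs" "xs ! i = y" using nb by (auto simp: in_set_conv_nth)
    have "i \<noteq> 0" using y i xs assms(1) by (cases "i = 0") (auto simp: hd_conv_nth simple_irr)
    moreover have "i < m"
    proof (rule ccontr)
      assume "\<not> i < m"
      have "cyc E S (i + 1)"
      proof (rule cycI)
        let ?l = "take (i + 1) xs"
        show "length ?l = i + 1" using i by simp
        show "3 \<le> i + 1" using \<open>\<not> i < m\<close> assms by simp
        show "set ?l \<subseteq> S" using xs by (meson set_take_subset subset_trans)
        show "distinct ?l" using xs by simp
        show "successively E ?l" using xs
          by (metis append_take_drop_id successively_append_iff)
        have "last ?l = y" "hd ?l = ?x" using i xs by (auto simp: last_conv_nth hd_conv_nth)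
        then show "E (last ?l) (hd ?l)" using y assms(1) by (auto simp: simple_sym[of E y])
      qed
      then show False using assms(5) \<open>\<not> i < m\<close> by auto
    qed
    ultimately show "y \<in> (\<lambda>i. xs ! i) ` {1..<m}" using i by auto
  qed
  then have "card {y \<in> S. E ?x y} \<le> card {1..<m}"
    by (meson card_image_le card_mono finite_atLeastLessThan finite_imageI le_trans)
  then show ?thesis using that[OF xS] assms(4) by simp
qed

text \<open>A position \<open>i\<close> with the first vertex of a longest path adjacent to entry
  \<open>i + 1\<close> and the last vertex adjacent to entry \<open>i\<close> turns the path into a
  cycle on the same vertices. A vertex missed by this cycle would be adjacent to it and yield a
  longer path.\<close>

lemma dirac:
  assumes E: "simple E" "finite S" "3 \<le> card S" and deg: "\<And>x. x \<in> S \<Longrightarrow> card S \<le> 2 * card {y \<in> S. E x y}"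
  shows "cyc E S (card S)"
proof -
  have "S \<noteq> {}" using E by auto
  obtain xs where xs: "distinct xs" "successively E xs" "set xs \<subseteq> S" "xs \<noteq> []"
    and mx0: "\<forall>ys. distinct ys \<longrightarrow> successively E ys \<longrightarrow> set ys \<subseteq> S \<longrightarrow> length ys \<le> length xs"
    by (rule longest_path[OF E(2) \<open>S \<noteq> {}\<close>, of E])
  note mx = mx0[rule_format]
  define m where "m = length xs"
  have m0: "0 < m" using xs by (simp add: m_def)
  let ?x = "xs ! 0" and ?z = "xs ! (m - 1)"
  have xz: "?x = hd xs" "?z = last xs" "?x \<in> S" "?z \<in> S"
    using xs m0 by (auto simp: hd_conv_nth last_conv_nth m_def)
  have nbx: "y \<in> set xs" if "y \<in> S" "E ?x y" for y
  proof (rule ccontr)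
    assume "y \<notin> set xs"
    then have "length (y # xs) \<le> length xs"
      by (intro mx) (use that xs E(1) xz in \<open>auto simp: successively_Cons simple_sym[of E y]\<close>)
    then show False by simp
  qed
  have nbz: "y \<in> set xs" if "y \<in> S" "E ?z y" for y
  proof (rule ccontr)
    assume "y \<notin> set xs"
    then have "length (xs @ [y]) \<le> length xs"
      by (intro mx) (use that xs E(1) xz in \<open>auto simp: successively_append_iff\<close>)
    then show False by simp
  qed
  define I1 where "I1 = {i. i < m - 1 \<and> E ?x (xs ! (i + 1))}"
  define I2 where "I2 = {i. i < m - 1 \<and> E ?z (xs ! i)}"
  have "{y \<in> S. E ?x y} \<subseteq> (\<lambda>i. xs ! (i + 1)) ` I1"
  proof
    fix y assume y: "y \<in> {y \<in> S. E ?x y}"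
    then obtain i where i: "i < m" "xs ! i = y" using nbx by (auto simp: in_set_conv_nth m_def)
    have "i \<noteq> 0" using y i E(1) by (cases "i = 0") (auto simp: simple_irr)
    then show "y \<in> (\<lambda>i. xs ! (i + 1)) ` I1" unfolding I1_def using y i
      by (intro image_eqI[of _ _ "i - 1"]) auto
  qed
  moreover have fin: "finite I1" "finite I2" unfolding I1_def I2_def by auto
  ultimately have c1: "card {y \<in> S. E ?x y} \<le> card I1"
    by (meson card_image_le card_mono finite_imageI le_trans)
  have "{y \<in> S. E ?z y} \<subseteq> (\<lambda>i. xs ! i) ` I2"
  proof
    fix y assume y: "y \<in> {y \<in> S. E ?z y}"
    then obtain i where i: "i < m" "xs ! i = y" using nbz by (auto simp: in_set_conv_nth m_def)
    have "i \<noteq> m - 1" using y i E(1) by (cases "i = m - 1") (auto simp: simple_irr)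
    then show "y \<in> (\<lambda>i. xs ! i) ` I2" unfolding I2_def using y i by auto
  qed
  then have c2: "card {y \<in> S. E ?z y} \<le> card I2"
    using fin by (meson card_image_le card_mono finite_imageI le_trans)
  have mS: "m \<le> card S" using xs E(2) by (metis card_mono distinct_card m_def)
  have sub: "I1 \<union> I2 \<subseteq> {..<m - 1}" unfolding I1_def I2_def by auto
  \<comment> \<open>Both index sets have at least \<open>card S / 2\<close> members, but there are
    only \<open>m - 1 < card S\<close> positions.\<close>
  have "I1 \<inter> I2 \<noteq> {}"
  proof
    assume "I1 \<inter> I2 = {}"
    then have "card I1 + card I2 = card (I1 \<union> I2)" using fin by (simp add: card_Un_disjoint)
    also have "\<dots> \<le> m - 1" using sub by (metis card_lessThan card_mono finite_lessThan)
    finally show False using c1 c2 deg[OF xz(3)] deg[OF xz(4)] mS m0 by linarith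
  qed
  then obtain i where i: "i < m - 1" "E ?x (xs ! (i + 1))" "E ?z (xs ! i)" unfolding I1_def I2_def by blast
  \<comment> \<open>The path covers more than half of \<open>S\<close>, so a missed vertex has too
    few other missed vertices to have all its neighbours among them.\<close>
  have "card I1 \<le> m - 1" using sub by (metis card_lessThan card_mono finite_lessThan le_supE)
  then have m_big: "card S \<le> 2 * (m - 1)" using c1 deg[OF xz(3)] by linarith
  have cy: "cyc E (set xs) m"
  proof (rule cycI)
    let ?a = "take (i + 1) xs" and ?b = "drop (i + 1) xs"
    have ne: "?a \<noteq> []" "?b \<noteq> []" using i xs by (auto simp: m_def)
    have ends: "last ?a = xs ! i" "hd ?b = xs ! (i + 1)" "last ?b = ?z"
      using i xs xz(2) by (auto simp: m_def hd_drop_conv_nth take_Suc_conv_app_nth)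
    moreover have "hd ?a = ?x" using xs(4) by (cases xs) auto
    ultimately have ends: "last ?a = xs ! i" "hd ?a = ?x" "hd ?b = xs ! (i + 1)" "last ?b = ?z"
      by auto
    have ab: "?a @ ?b = xs" by simp
    have su: "successively E ?a" "successively E ?b"
      using xs(2) ab by (metis successively_append_iff)+
    show "length (?a @ rev ?b) = m" using i by (simp add: m_def)
    show "3 \<le> m" using m_big E(3) by linarith
    show "set (?a @ rev ?b) \<subseteq> set xs" using set_take_subset set_drop_subset by fastforce
    show "distinct (?a @ rev ?b)" using xs(1) ab by (metis distinct_append distinct_rev set_rev)
    have "successively E (rev ?b)" using su(2) E(1) by (simp only: succ_rev)
    then show "successively E (?a @ rev ?b)"
      using su(1) i(3) ends E(1) ne
      by (simp add: successively_append_iff hd_rev simple_sym[of E "xs ! i"] del: successively_rev)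
    show "E (last (?a @ rev ?b)) (hd (?a @ rev ?b))"
      using ends ne i(2) E(1) by (simp add: last_rev simple_sym[of E "xs ! Suc i"])
  qed
  have "m = card S"
  proof (rule ccontr)
    assume "m \<noteq> card S"
    then have "card (set xs) < card S" using mS xs by (simp add: distinct_card m_def)
    then obtain u where u: "u \<in> S" "u \<notin> set xs" using E(2) xs(3)
      by (metis List.finite_set card_mono not_le subsetI)
    have "\<exists>y\<in>set xs. E u y"
    proof (rule ccontr)
      assume "\<not> ?thesis"
      then have "{y \<in> S. E u y} \<subseteq> S - set xs - {u}" using E(1) by (auto simp: simple_irr)
      then have "card {y \<in> S. E u y} \<le> card (S - set xs - {u})"
        using E(2) by (meson card_mono finite_Diff)
      also have "\<dots> = card S - m - 1" using u E(2) xs(1,3)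
        by (simp add: card_Diff_subset distinct_card m_def)
      finally show False using deg[OF u(1)] m_big E(3) by linarith
    qed
    then obtain y where y: "y \<in> set xs" "E u y" by blast
    obtain f where f: "cycmap E m f" "range f \<subseteq> set xs" "card (range f) = m" "range f = f ` {0..<int m}"
      by (rule cyc_cycmap[OF cy])
    have "range f = set xs" using f xs(1) by (metis List.finite_set card_subset_eq distinct_card m_def)
    then obtain j where j: "y = f j" using y by auto
    have "length (u # map f [j..j + int m - 1]) \<le> length xs"
    proof (rule mx)
      show "distinct (u # map f [j..j + int m - 1])"
        using arc_distinct[OF f(1), of "j + int m - 1" j] u f(2) by auto
      show "successively E (u # map f [j..j + int m - 1])"
        using cycmap_arc[OF f(1), of j "j + int m - 1"] y j m0
        by (auto simp: successively_Cons arc_hd)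
      show "set (u # map f [j..j + int m - 1]) \<subseteq> S" using u f(2) xs(3) by auto
    qed
    then show False using m_def by simp
  qed
  then show ?thesis using cyc_mono[OF cy xs(3)] by simp
qed

section \<open>Long cycles in bipartite graphs\<close>

definition bip :: "('a \<Rightarrow> 'a \<Rightarrow> bool) \<Rightarrow> 'a set \<Rightarrow> 'a set \<Rightarrow> 'a \<Rightarrow> 'a \<Rightarrow> bool" where
  "bip E A Y u v \<longleftrightarrow> E u v \<and> (u \<in> A \<and> v \<in> Y \<or> u \<in> Y \<and> v \<in> A)"

lemma simple_bip: "simple E \<Longrightarrow> simple (bip E A Y)"
  by (auto simp: simple_def bip_def)

lemma bip_cyc: "cyc (bip E A Y) X n \<Longrightarrow> cyc E X n"
proof -
  assume "cyc (bip E A Y) X n"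
  then obtain xs where "length xs = n" "3 \<le> n" "set xs \<subseteq> X" "distinct xs"
    "successively (bip E A Y) xs" "bip E A Y (last xs) (hd xs)"
    unfolding cyc_def by blast
  then show ?thesis
    by (intro cycI[of xs]) (auto simp: bip_def elim: successively_mono)
qed

lemma bip_alternate:
  assumes "cycmap (bip E A Y) n f" "A \<inter> Y = {}" "f 0 \<in> A"
  shows "f (2 * i) \<in> A" "f (2 * i + 1) \<in> Y"
proof -
  have s: "f j \<in> A \<longleftrightarrow> f (j + 2) \<in> A" for j
    using cycmap_E[OF assms(1), of j] cycmap_E[OF assms(1), of "j + 1"] assms(2)
    by (auto simp: bip_def add.assoc)
  show a: "f (2 * i) \<in> A"
  proof (induction i rule: int_induct[of _ 0])
    case base then show ?case using assms by simp
  next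
    case (step1 i)
    have "2 * (i + 1) = 2 * i + 2" by simp
    then show ?case using s[of "2 * i"] step1 by simp
  next
    case (step2 i)
    have "2 * i = 2 * (i - 1) + 2" by simp
    then show ?case using s[of "2 * (i - 1)"] step2 by simp
  qed
  show "f (2 * i + 1) \<in> Y" using cycmap_E[OF assms(1), of "2 * i"] a assms(2) by (auto simp: bip_def)
qed

lemma bip_cycE:
  assumes "cyc (bip E A Y) X (2 * z)" "A \<inter> Y = {}"
  obtains f where "cycmap (bip E A Y) (2 * z) f" "range f \<subseteq> X" "\<And>i. f (2 * i) \<in> A" "\<And>i. f (2 * i + 1) \<in> Y"
proof -
  obtain f where f: "cycmap (bip E A Y) (2 * z) f" "range f \<subseteq> X"
    by (rule cyc_cycmap[OF assms(1)])
  show ?thesis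
  proof (cases "f 0 \<in> A")
    case True
    then show ?thesis using that[OF f] bip_alternate[OF f(1) assms(2)] by blast
  next
    case False
    let ?g = "\<lambda>i. f (1 + i)"
    have g: "cycmap (bip E A Y) (2 * z) ?g" by (rule cycmap_shift[OF f(1)])
    moreover have "?g 0 \<in> A" using False cycmap_E[OF f(1), of 0] by (auto simp: bip_def)
    ultimately show ?thesis using that[of ?g] f(2) bip_alternate[OF g assms(2)] by blast
  qed
qed

text \<open>Even and odd indices enumerate the two sides, so a \<open>2z\<close>-cycle meets each
  side in exactly \<open>z\<close> vertices.\<close>

lemma bip_cyc_inter:
  assumes f: "cycmap E (2 * z) f" and AY: "A \<inter> Y = {}" "\<And>i. f (2 * i) \<in> A" "\<And>i. f (2 * i + 1) \<in> Y"
  shows "range f \<inter> A = (\<lambda>i. f (2 * i)) ` {0..<int z}" "range f \<inter> Y = (\<lambda>i. f (2 * i + 1)) ` {0..<int z}"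
    "inj_on (\<lambda>i. f (2 * i)) {0..<int z}" "inj_on (\<lambda>i. f (2 * i + 1)) {0..<int z}"
proof -
  have z: "0 < int z" using f by (auto simp: cycmap_def)
  have red: "f (2 * i) = f (2 * (i mod int z))" "f (2 * i + 1) = f (2 * (i mod int z) + 1)" for i
  proof -
    have "2 * i mod int (2 * z) = 2 * (i mod int z)" using mult_mod_right[of 2 i "int z"] by simp
    then show "f (2 * i) = f (2 * (i mod int z))" by (simp add: cycmap_eq[OF f])
    then have "2 * i mod int (2 * z) = 2 * (i mod int z) mod int (2 * z)" by (simp add: cycmap_eq[OF f])
    then have "(2 * i + 1) mod int (2 * z) = (2 * (i mod int z) + 1) mod int (2 * z)"
      by (metis mod_add_cong)
    then show "f (2 * i + 1) = f (2 * (i mod int z) + 1)" by (simp add: cycmap_eq[OF f])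
  qed
  have par: "\<exists>i. x = f (2 * i) \<or> x = f (2 * i + 1)" if "x \<in> range f" for x
  proof -
    from that obtain j where j: "x = f j" by blast
    obtain i where "j = 2 * i \<or> j = 2 * i + 1" by (metis evenE oddE)
    then show ?thesis using j by (intro exI[of _ i]) auto
  qed
  have inr: "i mod int z \<in> {0..<int z}" for i using z by simp
  show "range f \<inter> A = (\<lambda>i. f (2 * i)) ` {0..<int z}"
  proof (intro equalityI subsetI)
    fix x assume x: "x \<in> range f \<inter> A"
    then obtain i where i: "x = f (2 * i) \<or> x = f (2 * i + 1)" using par[of x] by auto
    then have "x = f (2 * i)" using x AY(1) AY(3)[of i] by auto
    then show "x \<in> (\<lambda>i. f (2 * i)) ` {0..<int z}" using red(1)[of i] inr[of i] by (intro image_eqI[of _ _ "i mod int z"]) simp_all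
  qed (use AY in auto)
  show "range f \<inter> Y = (\<lambda>i. f (2 * i + 1)) ` {0..<int z}"
  proof (intro equalityI subsetI)
    fix x assume x: "x \<in> range f \<inter> Y"
    then obtain i where i: "x = f (2 * i) \<or> x = f (2 * i + 1)" using par[of x] by auto
    then have "x = f (2 * i + 1)" using x AY(1) AY(2)[of i] by auto
    then show "x \<in> (\<lambda>i. f (2 * i + 1)) ` {0..<int z}" using red(2)[of i] inr[of i] by (intro image_eqI[of _ _ "i mod int z"]) simp_all
  qed (use AY in auto)
  show "inj_on (\<lambda>i. f (2 * i)) {0..<int z}" "inj_on (\<lambda>i. f (2 * i + 1)) {0..<int z}"
    by (rule linorder_inj_onI; use cycmap_neq[OF f] in auto)+
qed

text \<open>The neighbourhoods outside the cycle of a missed vertex \<open>a\<close> and of the successors of its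
  neighbours on the cycle are pairwise disjoint unless the cycle can be prolonged through \<open>a\<close>.\<close>

lemma jackson_step:
  assumes E: "simple E" and fin: "finite A" "finite Y" and AY: "A \<inter> Y = {}"
    and d: "card A \<le> d" "card Y + 2 \<le> 2 * d" "\<And>a. a \<in> A \<Longrightarrow> d \<le> card {y \<in> Y. E a y}"
    and z: "z < card A" and cy: "cyc (bip E A Y) (A \<union> Y) (2 * z)"
  shows "cyc (bip E A Y) (A \<union> Y) (2 * (z + 1))"
proof -
  let ?B = "bip E A Y"
  have sB: "simple ?B" by (rule simple_bip[OF E])
  obtain f where f: "cycmap ?B (2 * z) f" "range f \<subseteq> A \<union> Y"
    and fA: "\<And>i. f (2 * i) \<in> A" and fY: "\<And>i. f (2 * i + 1) \<in> Y"
    using bip_cycE[OF cy AY] by blast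
  have z0: "2 \<le> z" using f(1) by (simp add: cycmap_def)
  note int = bip_cyc_inter[OF f(1) AY fA fY]
  have cA: "card (range f \<inter> A) = z" using int by (simp add: card_image)
  have cY: "card (range f \<inter> Y) = z" using int by (simp add: card_image)
  obtain a where a: "a \<in> A" "a \<notin> range f"
  proof -
    have "\<not> A \<subseteq> range f" using cA z by (metis inf.absorb2 less_irrefl)
    then show ?thesis using that by blast
  qed
  define out where "out = Y - range f"
  define No where "No u = {x \<in> out. E u x}" for u
  have cout: "card out = card Y - z" "z \<le> card Y" "finite out"
    using cY fin card_Diff_subset_Int[of Y "range f"] card_mono[of Y "range f \<inter> Y"]
    by (simp_all add: out_def Int_commute)
  have finNo: "finite (No u)" for u using cout by (simp add: No_def)
  have arcs: "successively ?B (map f [i..j])" "successively ?B (rev (map f [i..j]))" for i j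
    using cycmap_arc[OF f(1)] cycmap_arc_rev[OF f(1) sB] by auto
  have per: "f (i + 2 * int z) = f i" "f (i - 2 * int z) = f i" for i
    using cycmap_per[OF f(1)] cycmap_per'[OF f(1)] by auto
  have Nob: "?B a x" if "x \<in> No a" for x using that a by (auto simp: No_def out_def bip_def)
  have Now: "?B (f (2 * i)) x" if "x \<in> No (f (2 * i))" for i x
    using that fA by (auto simp: No_def out_def bip_def)
  have a_f: "f i \<noteq> a" for i using a by auto
  have card_w: "d \<le> card (No (f (2 * i))) + z" for i
  proof -
    have "{y \<in> Y. E (f (2 * i)) y} \<subseteq> No (f (2 * i)) \<union> (range f \<inter> Y)" by (auto simp: No_def out_def)
    then have "card {y \<in> Y. E (f (2 * i)) y} \<le> card (No (f (2 * i)) \<union> (range f \<inter> Y))"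
      using finNo fin by (intro card_mono) auto
    also have "\<dots> \<le> card (No (f (2 * i))) + z" using card_Un_le cY by metis
    finally show ?thesis using d(3)[OF fA, of i] by simp
  qed
  define I where "I = {i \<in> {0..<int z}. E a (f (2 * i + 1))}"
  have finI: "finite I" unfolding I_def by (rule finite_subset[of _ "{0..<int z}"]) auto
  have card_a: "d \<le> card (No a) + card I"
  proof -
    have "{y \<in> Y. E a y} \<subseteq> No a \<union> (\<lambda>i. f (2 * i + 1)) ` I"
    proof
      fix y assume y: "y \<in> {y \<in> Y. E a y}"
      show "y \<in> No a \<union> (\<lambda>i. f (2 * i + 1)) ` I"
      proof (cases "y \<in> range f")
        case True
        then have "y \<in> (\<lambda>i. f (2 * i + 1)) ` {0..<int z}" using int(2) y by blast
        then show ?thesis using y by (auto simp: I_def)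
      qed (use y in \<open>auto simp: No_def out_def\<close>)
    qed
    then have "card {y \<in> Y. E a y} \<le> card (No a \<union> (\<lambda>i. f (2 * i + 1)) ` I)"
      using finNo finI by (intro card_mono) auto
    also have "\<dots> \<le> card (No a) + card ((\<lambda>i. f (2 * i + 1)) ` I)" by (rule card_Un_le)
    also have "\<dots> \<le> card (No a) + card I" using card_image_le[OF finI] by simp
    finally show ?thesis using d(3)[OF a(1)] by simp
  qed
  have outf: "x \<in> Y" "\<And>i. f i \<noteq> x" "x \<noteq> a" if "x \<in> No u" for x u
    using that a AY by (auto simp: No_def out_def)
  show ?thesis
  proof (cases "I = {}")
    case True
    \<comment> \<open>As \<open>a\<close> has no neighbour on the cycle, \<open>No a\<close> has at
      least \<open>d\<close> members and \<open>No (f (2 * i))\<close> at least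
      \<open>d - z\<close>, while \<open>out\<close> has at most \<open>2d - 2 - z\<close>. The path
      \<open>p, a, q\<close> will replace the vertex between \<open>f 0\<close> and
      \<open>f 2\<close>.\<close>
    have "2 \<le> card (No a \<inter> No (f (2 * i)))" for i
    proof -
      have "card (No a) + card (No (f (2 * i))) = card (No a \<union> No (f (2 * i))) + card (No a \<inter> No (f (2 * i)))"
        by (rule card_Un_Int[OF finNo finNo])
      moreover have "card (No a \<union> No (f (2 * i))) \<le> card out"
        using cout by (intro card_mono) (auto simp: No_def)
      ultimately show ?thesis using card_w[of i] card_a True cout d by simp
    qed
    note two = this
    have "No a \<inter> No (f (2 * 0)) \<noteq> {}" using two[of 0] by (intro notI) simp
    then obtain p where p: "p \<in> No a" "p \<in> No (f (2 * 0))" by blast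
    have "card ((No a \<inter> No (f (2 * 1))) - {p}) \<noteq> 0" using two[of 1] by (simp add: card_Diff_singleton_if)
    then have "(No a \<inter> No (f (2 * 1))) - {p} \<noteq> {}" by (metis card.empty)
    then obtain q where q: "q \<in> No a" "q \<in> No (f (2 * 1))" "q \<noteq> p" by blast
    show ?thesis
    proof (rule cycI)
      let ?l = "a # q # map f [2..2 * int z] @ [p]"
      have le: "2 \<le> 2 * int z" using z0 by simp
      show "length ?l = 2 * (z + 1)" using z0 by simp
      show "3 \<le> 2 * (z + 1)" using z0 by simp
      show "set ?l \<subseteq> A \<union> Y" using f(2) a p q outf(1) by auto
      have "p \<noteq> a" "q \<noteq> a" "p \<notin> range f" "q \<notin> range f" using outf(2,3) p q by blast+
      then have "p \<notin> f ` {2..2 * int z}" "q \<notin> f ` {2..2 * int z}" "a \<notin> f ` {2..2 * int z}"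
        using a by blast+
      then show "distinct ?l" using arc_distinct[OF f(1), of "2 * int z" 2] \<open>p \<noteq> a\<close> \<open>q \<noteq> a\<close> q(3)
        by simp
      show "successively ?B ?l"
        using arcs(1)[of 2 "2 * int z"] Nob[OF q(1)] Now[OF q(2)] Now[OF p(2)] sB per(1)[of 0] z0
        by (auto simp: successively_Cons successively_append_iff arc_hd arc_last hd_append
            simple_sym[of ?B q])
      show "?B (last ?l) (hd ?l)" using Nob[OF p(1)] sB by (simp add: simple_sym[of ?B p])
    qed
  next
    case False
    show ?thesis
    proof (rule ccontr)
      assume no: "\<not> ?thesis"
      \<comment> \<open>Otherwise \<open>a\<close> and \<open>x\<close> fit between
        \<open>f (2 * i + 1)\<close> and \<open>f (2 * (i + 1))\<close>.\<close>
      have da: "No a \<inter> No (f (2 * (i + 1))) = {}" if i: "i \<in> I" for i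
      proof (rule ccontr)
        assume "\<not> ?thesis"
        then obtain x where x: "x \<in> No a" "x \<in> No (f (2 * (i + 1)))" by blast
        let ?l = "a # x # map f [2 * (i + 1)..2 * i + 1 + 2 * int z]"
        have le: "2 * (i + 1) \<le> 2 * i + 1 + 2 * int z" using z0 by simp
        have "cyc ?B (A \<union> Y) (2 * (z + 1))"
        proof (rule cycI)
          show "length ?l = 2 * (z + 1)" using z0 by simp
          show "3 \<le> 2 * (z + 1)" using z0 by simp
          show "set ?l \<subseteq> A \<union> Y" using f(2) a x outf(1) by auto
          have xa: "x \<noteq> a" "x \<notin> range f" using outf(2,3) x by blast+
          then have "x \<notin> f ` {2 * (i + 1)..2 * i + 1 + 2 * int z}" "a \<notin> f ` {2 * (i + 1)..2 * i + 1 + 2 * int z}"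
            using a by blast+
          then show "distinct ?l"
            using arc_distinct[OF f(1), of "2 * i + 1 + 2 * int z" "2 * (i + 1)"] xa(1)
            by simp
          show "successively ?B ?l"
            using arcs(1)[of "2 * (i + 1)" "2 * i + 1 + 2 * int z"] Nob[OF x(1)] Now[OF x(2)] sB arc_hd[OF le, of f]
            by (simp add: successively_Cons simple_sym[of ?B x])
          have "last ?l = f (2 * i + 1)" using arc_last[OF le, of f] arc_ne[OF le, of f] per(1) by simp
          then show "?B (last ?l) (hd ?l)" using i a fY[of i] E by (auto simp: I_def bip_def simple_sym[of E _ a])
        qed
        then show False using no by blast
      qed
      \<comment> \<open>Here \<open>a\<close> links \<open>f (2 * i + 1)\<close> with
        \<open>f (2 * j + 1)\<close> and \<open>x\<close> links their successors; reversing one of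
        the two arcs gives a cycle through all old vertices and these two.\<close>
      have dd: "No (f (2 * (i + 1))) \<inter> No (f (2 * (j + 1))) = {}" if ij: "i \<in> I" "j \<in> I" "i < j" for i j
      proof (rule ccontr)
        assume "\<not> ?thesis"
        then obtain x where x: "x \<in> No (f (2 * (i + 1)))" "x \<in> No (f (2 * (j + 1)))" by blast
        have jz: "j < i + int z" using ij by (auto simp: I_def)
        let ?p = "rev (map f [2 * (j + 1) - 2 * int z..2 * i + 1])"
        let ?q = "map f [2 * (i + 1)..2 * j + 1]"
        let ?l = "a # ?p @ x # ?q"
        have le: "2 * (j + 1) - 2 * int z \<le> 2 * i + 1" "2 * (i + 1) \<le> 2 * j + 1" using ij jz by auto
        have ends: "hd ?p = f (2 * i + 1)" "last ?p = f (2 * (j + 1))" "hd ?q = f (2 * (i + 1))"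
          "last ?q = f (2 * j + 1)" "?p \<noteq> []" "?q \<noteq> []"
          using arc_rhd[OF le(1), of f] arc_rlast[OF le(1), of f] arc_hd[OF le(2), of f] arc_last[OF le(2), of f]
            per(2) arc_ne[OF le(1), of f] arc_ne[OF le(2), of f] by simp_all
        have aI: "?B a (f (2 * i + 1))" "?B (f (2 * j + 1)) a"
          using ij a fY E by (auto simp: I_def bip_def simple_sym[of E _ a])
        have "cyc ?B (A \<union> Y) (2 * (z + 1))"
        proof (rule cycI)
          show "length ?l = 2 * (z + 1)" using z0 ij jz by simp
          show "3 \<le> 2 * (z + 1)" using z0 by simp
          show "set ?l \<subseteq> A \<union> Y" using f(2) a x outf(1) by auto
          have xa: "x \<noteq> a" "x \<notin> range f" using outf(2,3) x by blast+
          then have ni: "x \<notin> set ?p" "a \<notin> set ?p" "x \<notin> set ?q" "a \<notin> set ?q" using a by auto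
          have "distinct ?p" unfolding distinct_rev by (rule arc_distinct[OF f(1)]) (use ij in simp)
          moreover have "distinct ?q" by (rule arc_distinct[OF f(1)]) (use jz in simp)
          moreover have "set ?p \<inter> set ?q = {}" unfolding set_rev set_map set_upto
            by (rule arc_disj[OF f(1)]) (use jz in simp_all)
          ultimately have "distinct ?p" "distinct ?q" "set ?p \<inter> set ?q = {}" by auto
          then show "distinct ?l" using ni xa(1)
            by (simp only: distinct.simps distinct_append set_append list.set) blast
          show "successively ?B ?l"
            using arcs(2)[of "2 * (j + 1) - 2 * int z" "2 * i + 1"] arcs(1)[of "2 * (i + 1)" "2 * j + 1"]
              ends Now[OF x(1)] Now[OF x(2)] sB aI(1)
            by (simp only: successively_append_iff successively_Cons hd_append2 simple_sym[of ?B x]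
                list.sel list.distinct simp_thms append_is_Nil_conv append_Cons append_Nil)
          have "last ?l = f (2 * j + 1)" using ends by (simp del: last_map hd_map)
          then show "?B (last ?l) (hd ?l)" using aI by simp
        qed
        then show False using no by blast
      qed
      let ?U = "\<Union>i\<in>I. No (f (2 * (i + 1)))"
      have "card ?U = (\<Sum>i\<in>I. card (No (f (2 * (i + 1)))))"

      proof (intro card_UN_disjoint finI ballI finNo impI)
        fix i j assume "i \<in> I" "j \<in> I" "i \<noteq> j"
        then show "No (f (2 * (i + 1))) \<inter> No (f (2 * (j + 1))) = {}"
          using dd[of i j] dd[of j i] by (cases "i < j") auto
      qed
      moreover have "(\<Sum>i\<in>I. card (No (f (2 * (i + 1))))) \<ge> (\<Sum>i\<in>I. d - z)"

      proof (rule sum_mono)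
        fix i show "d - z \<le> card (No (f (2 * (i + 1))))" using card_w[of "i + 1"] by linarith
      qed
      ultimately have "card I * (d - z) \<le> card ?U" by simp
      moreover have "card (No a \<union> ?U) = card (No a) + card ?U"
        using da finNo finI by (intro card_Un_disjoint) auto
      moreover have "card (No a \<union> ?U) \<le> card out" using cout by (intro card_mono) (auto simp: No_def)
      ultimately have le: "d - card I + card I * (d - z) \<le> card Y - z" using card_a cout by linarith
      have I1: "1 \<le> card I" using False finI by (simp add: card_gt_0_iff Suc_le_eq)
      \<comment> \<open>With \<open>e = d - z\<close> the count reads
        \<open>card I * (e - 1) <= e - 2\<close>, which is impossible for \<open>card I >= 1\<close>
        and \<open>e >= 1\<close>.\<close>
      define e where "e = d - z"
      have e: "d = z + e" "1 \<le> e" using z d(1) by (auto simp: e_def)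
      have "card I * (e - 1) + card I = card I * e" using e(2) by (cases e) simp_all
      moreover have "e - 1 \<le> card I * (e - 1)" using I1 by simp
      moreover have "d - card I + card I * e \<le> 2 * d - 2 - z" using le d(2) by (simp add: e_def)
      ultimately show False using e I1 by linarith
    qed
  qed
qed

text \<open>A special case of Jackson's theorem on cycles in bipartite graphs.\<close>

lemma jackson:
  assumes E: "simple E" and fin: "finite A" "finite Y" and AY: "A \<inter> Y = {}"
    and d: "card A \<le> d" "card Y + 2 \<le> 2 * d" "\<And>a. a \<in> A \<Longrightarrow> d \<le> card {y \<in> Y. E a y}"
    and A: "2 \<le> card A"
  shows "cyc (bip E A Y) (A \<union> Y) (2 * card A)"
proof -
  have "cyc (bip E A Y) (A \<union> Y) (2 * z)" if "2 \<le> z" "z \<le> card A" for z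
    using that
  proof (induction z rule: nat_induct_at_least)
    \<comment> \<open>Two neighbourhoods of size at least \<open>d\<close> inside \<open>Y\<close>
      share two vertices, which gives the 4-cycle.\<close>
    case base
    obtain a b where ab: "a \<in> A" "b \<in> A" "a \<noteq> b"
      using A card_le_Suc0_iff_eq[OF fin(1)] by fastforce
    let ?N = "\<lambda>a. {y \<in> Y. E a y}"
    have "card (?N a) + card (?N b) = card (?N a \<union> ?N b) + card (?N a \<inter> ?N b)"
      by (rule card_Un_Int) (use fin in auto)
    moreover have "card (?N a \<union> ?N b) \<le> card Y" by (rule card_mono) (use fin in auto)
    ultimately have c: "2 \<le> card (?N a \<inter> ?N b)" using d(2) d(3)[OF ab(1)] d(3)[OF ab(2)] by linarith
    then have "?N a \<inter> ?N b \<noteq> {}" by (intro notI) simp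
    then obtain p where p: "p \<in> ?N a \<inter> ?N b" by blast
    have "card ((?N a \<inter> ?N b) - {p}) \<noteq> 0" using c by (simp add: card_Diff_singleton_if)
    then have "(?N a \<inter> ?N b) - {p} \<noteq> {}" by (metis card.empty)
    then obtain q where q: "q \<in> (?N a \<inter> ?N b)" "q \<noteq> p" by blast
    have "E a p" "E b q" "E p b" "E q a" using p q E by (auto simp: simple_def)
    moreover have "a \<noteq> p" "a \<noteq> q" "b \<noteq> p" "b \<noteq> q" using ab p q AY by auto
    ultimately show ?case
      by (intro cycI[of "[a, p, b, q]"]) (use ab p q in \<open>auto simp: bip_def\<close>)
  next
    case (Suc z)
    then show ?case using jackson_step[OF E fin AY d, of z] by simp
  qed
  then show ?thesis using A by blast
qed

section \<open>A monochromatic cycle of length at least five on 19 vertices\<close>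

lemma deg_opp:
  assumes "finite X" "x \<in> X" "simple E"
  shows "card {y \<in> X. E x y} + card {y \<in> X. opp E x y} = card X - 1"
proof -
  have "{y \<in> X. E x y} \<union> {y \<in> X. opp E x y} = X - {x}" "{y \<in> X. E x y} \<inter> {y \<in> X. opp E x y} = {}"
    using assms(3) by (auto simp: opp_def simple_irr)
  then show ?thesis using assms card_Un_disjoint[of "{y \<in> X. E x y}" "{y \<in> X. opp E x y}"] by simp
qed

text \<open>An \<open>E\<close>-edge \<open>a b\<close> inside \<open>N\<close> gives the cycle
  \<open>y, a, b, z, c\<close>. If there is none, four vertices of \<open>N\<close> form a clique of
  \<open>opp E\<close>, and \<open>x\<close> completes it to a 5-cycle.\<close>

lemma mono5_aux:
  assumes E: "simple E" and N: "finite N" "5 \<le> card N" "N \<subseteq> S" "\<forall>u\<in>N. E z u" "z \<in> S"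
    and S: "\<forall>u\<in>S. E y u \<and> opp E x u"
  shows "cyc E (insert y S) 5 \<or> cyc (opp E) (insert x S) 5"
proof (cases "\<exists>a\<in>N. \<exists>b\<in>N. E a b")
  case True
  then obtain a b where ab: "a \<in> N" "b \<in> N" "E a b" by blast
  have "a \<noteq> b" using simple_neq[OF E ab(3)] .
  have "card (N - {a, b}) \<noteq> 0" using N(1,2) ab \<open>a \<noteq> b\<close> by (simp add: card_Diff_subset)
  then have "N - {a, b} \<noteq> {}" by (intro notI) simp
  then obtain c where c: "c \<in> N" "c \<noteq> a" "c \<noteq> b" by blast
  have z: "z \<noteq> a" "z \<noteq> b" "z \<noteq> c" using N ab c simple_irr[OF E] by auto
  have y: "y \<noteq> a" "y \<noteq> b" "y \<noteq> c" "y \<noteq> z" using S N ab c simple_irr[OF E] by auto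
  have "E y a" "E b z" "E z c" "E c y" using S N ab c E by (auto simp: simple_def)
  then have "cyc E (insert y S) 5"
    by (intro cycI[of "[y, a, b, z, c]"]) (use y z ab c N \<open>a \<noteq> b\<close> in auto)
  then show ?thesis by blast
next
  case False
  obtain a where a: "a \<in> N" using N by fastforce
  obtain xs where xs: "distinct xs" "length xs = 4" "set xs \<subseteq> N"
    by (rule list_hd[OF N(1) a, of 4]) (use N(2) in auto)
  then obtain p q r s where l: "xs = [p, q, r, s]"
    by (auto simp: numeral_eq_Suc length_Suc_conv)
  have F: "opp E u v" if "u \<in> N" "v \<in> N" "u \<noteq> v" for u v using False that by (auto simp: opp_def)
  have x: "opp E x u" "opp E u x" "x \<noteq> u" if "u \<in> N" for u
    using S N that simple_sym[OF simple_opp[OF E]] by (auto simp: opp_def)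
  have "cyc (opp E) (insert x S) 5"
    by (intro cycI[of "[x, p, q, r, s]"]) (use x F xs l N in auto)
  then show ?thesis by blast
qed

text \<open>Without cycles longer than 4, ends of longest paths have degree at most 3. So some
  \<open>x\<close> has 15 of the other 18 vertices as \<open>opp E\<close>-neighbours, some
  \<open>y\<close> among these has 11 of them as \<open>E\<close>-neighbours, and any
  \<open>z\<close> among the 11 has five neighbours of one colour among the remaining ten.\<close>

lemma mono5:
  assumes E: "simple E" and X: "finite X" "19 \<le> card X"
  shows "\<exists>n\<ge>5. cyc E X n \<or> cyc (opp E) X n"
proof (rule ccontr)
  assume no: "\<not> ?thesis"
  have F: "simple (opp E)" by (rule simple_opp[OF E])
  have noE: "\<not> cyc E S n" "\<not> cyc (opp E) S n" if "S \<subseteq> X" "4 < n" for S n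
  proof -
    have "5 \<le> n" using that by simp
    then show "\<not> cyc E S n" "\<not> cyc (opp E) S n" using no that cyc_mono by blast+
  qed
  have "X \<noteq> {}" using X by auto
  then obtain x where x: "x \<in> X" "card {y \<in> X. E x y} < 4"
    using low_degree_end[OF E X(1), of 4] noE(1)[OF subset_refl] by auto
  define S1 where "S1 = {y \<in> X. opp E x y}"
  have S1: "S1 \<subseteq> X" "finite S1" "15 \<le> card S1"
    using deg_opp[OF X(1) x(1) E] x X by (auto simp: S1_def)
  then have "S1 \<noteq> {}" by auto
  then obtain y where y: "y \<in> S1" "card {z \<in> S1. opp E y z} < 4"
    using low_degree_end[OF F S1(2), of 4] noE(2)[OF S1(1)] by auto
  define S2 where "S2 = {z \<in> S1. E y z}"
  have S2: "S2 \<subseteq> S1" "finite S2" "11 \<le> card S2"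
    using deg_opp[OF S1(2) y(1) E] y S1 by (auto simp: S2_def)
  then have "S2 \<noteq> {}" by auto
  then obtain z where z: "z \<in> S2" by blast
  have adj: "\<forall>u\<in>S2. E y u \<and> opp E x u" by (auto simp: S2_def S1_def)
  have sub: "insert y S2 \<subseteq> X" "insert x S2 \<subseteq> X" using S1 S2 x y by auto
  have "card {u \<in> S2. E z u} + card {u \<in> S2. opp E z u} \<ge> 10"
    using deg_opp[OF S2(2) z E] S2 by simp
  then consider "5 \<le> card {u \<in> S2. E z u}" | "5 \<le> card {u \<in> S2. opp E z u}" by linarith
  then show False
  proof cases
    case 1
    have "cyc E (insert y S2) 5 \<or> cyc (opp E) (insert x S2) 5"
      by (rule mono5_aux[OF E _ 1]) (use S2 z adj in auto)
    then show False using noE(1)[OF sub(1), of 5] noE(2)[OF sub(2), of 5] by auto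
  next
    case 2
    have "cyc (opp E) (insert x S2) 5 \<or> cyc (opp (opp E)) (insert y S2) 5"
      by (rule mono5_aux[OF F _ 2]) (use S2 z adj opp_opp[OF E] in auto)
    then show False using noE(1)[OF sub(1), of 5] noE(2)[OF sub(2), of 5] opp_opp[OF E] by auto
  qed
qed

section \<open>A longest monochromatic cycle has more than \<open>2k\<close> vertices\<close>

lemma cyc_successor:
  assumes f: "cycmap E n f"
  obtains s where "\<And>i. s (f i) = f (i + 1)" "inj_on s (range f)" "s ` range f = range f"
proof -
  define s where "s y = f ((SOME i. f i = y) + 1)" for y
  have s: "s (f i) = f (i + 1)" for i
  proof -
    have "f (SOME j. f j = f i) = f i" by (rule someI[of _ i]) simp
    then have "(SOME j. f j = f i) mod int n = i mod int n" by (simp add: cycmap_eq[OF f])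
    then have "((SOME j. f j = f i) + 1) mod int n = (i + 1) mod int n" by (rule mod_add_cong) simp
    then show ?thesis unfolding s_def by (simp add: cycmap_eq[OF f])
  qed
  have "inj_on s (range f)"
  proof (rule inj_onI)
    fix x y assume "x \<in> range f" "y \<in> range f" "s x = s y"
    then obtain i j where ij: "x = f i" "y = f j" "f (i + 1) = f (j + 1)" using s by auto
    then have "int n dvd (i + 1) - (j + 1)" by (simp add: cycmap_eq[OF f] mod_eq_dvd_iff)
    then show "x = y" using ij by (simp add: cycmap_eq[OF f] mod_eq_dvd_iff)
  qed
  moreover have "s ` range f = range f"
  proof (intro equalityI subsetI)
    fix y assume "y \<in> range f"
    then obtain i where "y = f i" by blast
    then have "y = s (f (i - 1))" using s[of "i - 1"] by simp
    then show "y \<in> s ` range f" by blast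
  qed (use s in auto)
  ultimately show ?thesis using that s by blast
qed

lemma range_pair:
  assumes f: "cycmap E n f" and "x \<in> range f" "y \<in> range f" "x \<noteq> y"
  obtains i j where "x = f i" "y = f j" "i < j" "j < i + int n"
proof -
  have n: "0 < int n" using f by (simp add: cycmap_def)
  obtain i j where ij: "x = f i" "y = f j" using assms by blast
  define j' where "j' = i + (j - i) mod int n"
  have "f j' = f j" unfolding j'_def by (simp add: cycmap_eq[OF f] mod_add_right_eq)
  moreover have "i \<noteq> j'" using ij calculation assms(4) by auto
  moreover have "i \<le> j'" "j' < i + int n" using n by (auto simp: j'_def)
  ultimately show ?thesis using that[of i j'] ij by auto
qed

text \<open>The successor on the cycle is a map \<open>s\<close> on vertices rather than on indices,
  so that counting successors of neighbours becomes counting images under an injection.\<close>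

locale longest_cycle =
  fixes E :: "'a \<Rightarrow> 'a \<Rightarrow> bool" and X :: "'a set" and c :: nat and f :: "int \<Rightarrow> 'a" and s :: "'a \<Rightarrow> 'a"
  assumes E: "simple E" and finX: "finite X" and f: "cycmap E c f" and fX: "range f \<subseteq> X" and cC: "card (range f) = c"
    and s: "\<And>i. s (f i) = f (i + 1)" and s_inj: "inj_on s (range f)" and s_im: "s ` range f = range f"
    and max: "\<And>n. c < n \<Longrightarrow> \<not> cyc E X n"
begin

abbreviation "C \<equiv> range f"
definition "W = X - C"
definition "S w = {y \<in> C. E w y}"

lemma finC: "finite C" using fX finX finite_subset by blast
lemma finS: "finite (S w)" using finC by (simp add: S_def)
lemma SC: "S w \<subseteq> C" by (auto simp: S_def)
lemma sC: "y \<in> C \<Longrightarrow> s y \<in> C" using s_im by blast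
lemma card_s: "U \<subseteq> C \<Longrightarrow> card (s ` U) = card U"
  using s_inj inj_on_subset card_image by blast
lemma s_eq: "x \<in> C \<Longrightarrow> y \<in> C \<Longrightarrow> s x = s y \<longleftrightarrow> x = y"
  using s_inj by (auto simp: inj_on_def)
lemma c3: "3 \<le> c" using f by (simp add: cycmap_def)
lemma WX: "w \<in> W \<Longrightarrow> w \<in> X" "w \<in> W \<Longrightarrow> f i \<noteq> w" by (auto simp: W_def)

lemma arcs: "successively E (map f [i..j])" "successively E (rev (map f [i..j]))"
  using cycmap_arc[OF f] cycmap_arc_rev[OF f E] by auto

lemma per: "f (i + int c) = f i" by (rule cycmap_per[OF f])

text \<open>Otherwise \<open>w\<close> could be inserted between \<open>y\<close> and
  \<open>s y\<close>.\<close>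

lemma no_insert:
  assumes w: "w \<in> W" and y: "y \<in> S w"
  shows "s y \<notin> S w"
proof
  assume sy: "s y \<in> S w"
  obtain i where i: "y = f i" using y by (auto simp: S_def)
  let ?l = "w # map f [i + 1..i + int c]"
  have le: "i + 1 \<le> i + int c" using c3 by simp
  have "cyc E X (c + 1)"
  proof (rule cycI)
    show "length ?l = c + 1" by simp
    show "3 \<le> c + 1" using c3 by simp
    show "set ?l \<subseteq> X" using WX(1)[OF w] fX by auto
    show "distinct ?l" using arc_distinct[OF f, of "i + int c" "i + 1"] w by (auto simp: W_def)
    show "successively E ?l" using arcs(1)[of "i + 1" "i + int c"] arc_hd[OF le, of f] sy
      by (simp add: successively_Cons S_def s i)
    have "last ?l = f i" using arc_last[OF le, of f] arc_ne[OF le, of f] per by simp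
    then show "E (last ?l) (hd ?l)" using y E by (auto simp: S_def i simple_def)
  qed
  then show False using max[of "c + 1"] by simp
qed

lemma card_S: "w \<in> W \<Longrightarrow> 2 * card (S w) \<le> c"
proof -
  assume w: "w \<in> W"
  have "S w \<inter> s ` S w = {}" using no_insert[OF w] by blast
  then have "card (S w) + card (s ` S w) = card (S w \<union> s ` S w)"
    using finS by (intro card_Un_disjoint[symmetric]) auto
  also have "\<dots> \<le> card C" using finC SC sC by (intro card_mono Un_least image_subsetI) (auto simp: S_def)
  finally show ?thesis using card_s[OF SC] cC by simp
qed

text \<open>The exchange \<open>x, s p, ..., q, w, p, ..., s q\<close>, with the second arc run
  backwards, would pass through all of \<open>C\<close> and both outside vertices.\<close>

lemma no_pair:
  assumes w: "w \<in> W" and x: "x \<in> W" and wx: "w \<noteq> x"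
    and pq: "p \<in> S w" "q \<in> S w" "p \<noteq> q" and sx: "s p \<in> S x" "s q \<in> S x"
  shows False
proof -
  obtain i j where ij: "p = f i" "q = f j" "i < j" "j < i + int c"
    by (rule range_pair[OF f subsetD[OF SC pq(1)] subsetD[OF SC pq(2)] pq(3)])
  let ?a = "map f [i + 1..j]" and ?b = "rev (map f [j + 1 - int c..i])"
  let ?l = "x # ?a @ w # ?b"
  have le: "i + 1 \<le> j" "j + 1 - int c \<le> i" using ij by auto
  have ends: "hd ?a = s p" "last ?a = q" "hd ?b = p" "last ?b = s q" "?a \<noteq> []" "?b \<noteq> []"
    using arc_hd[OF le(1), of f] arc_last[OF le(1), of f] arc_rhd[OF le(2), of f] arc_rlast[OF le(2), of f]
      arc_ne[OF le(1), of f] arc_ne[OF le(2), of f] ij s cycmap_per'[OF f, of "j + 1"] by simp_all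
  have ad: "E x (s p)" "E w p" "E q w" "E (s q) x" using pq sx E by (auto simp: S_def simple_def)
  have "cyc E X (c + 2)"
  proof (rule cycI)
    show "length ?l = c + 2" using ij by simp
    show "3 \<le> c + 2" using c3 by simp
    show "set ?l \<subseteq> X" using WX(1)[OF w] WX(1)[OF x] fX by auto
    have "distinct ?a" by (rule arc_distinct[OF f]) (use ij in simp)
    moreover have "distinct ?b" unfolding distinct_rev by (rule arc_distinct[OF f]) (use ij in simp)
    moreover have "set ?b \<inter> set ?a = {}" unfolding set_rev set_map set_upto
      by (rule arc_disj[OF f]) (use ij in simp_all)
    moreover have "set ?a \<subseteq> C" "set ?b \<subseteq> C" by auto
    ultimately show "distinct ?l" using w x wx unfolding W_def
      by (simp only: distinct.simps distinct_append set_append list.set) blast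
    show "successively E ?l"
      using arcs(1)[of "i + 1" j] arcs(2)[of "j + 1 - int c" i] ends ad
      by (simp only: successively_append_iff successively_Cons hd_append2 list.sel list.distinct simp_thms
          append_is_Nil_conv append_Cons append_Nil)
    have "last ?l = s q" using ends by (simp del: last_map hd_map last_rev)
    then show "E (last ?l) (hd ?l)" using ad by simp
  qed
  then show False using max[of "c + 2"] by simp
qed

lemma card_S_inter:
  assumes w: "w \<in> W" and x: "x \<in> W" and wx: "w \<noteq> x"
  shows "card (S x \<inter> s ` S w) \<le> 1"
proof -
  have "u = v" if uv: "u \<in> S x \<inter> s ` S w" "v \<in> S x \<inter> s ` S w" for u v
  proof -
    obtain p q where "p \<in> S w" "q \<in> S w" "u = s p" "v = s q" using uv by blast
    then show ?thesis using no_pair[OF w x wx, of p q] uv by blast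
  qed
  then show ?thesis using card_le_Suc0_iff_eq[of "S x \<inter> s ` S w"] finS by auto
qed

text \<open>An edge between the successors would allow the longer cycle
  \<open>w, q, ..., s p, s q, ..., p\<close>.\<close>

lemma succ_opp:
  assumes w: "w \<in> W" and pq: "p \<in> S w" "q \<in> S w" "p \<noteq> q"
  shows "opp E (s p) (s q)"
proof -
  have ne: "s p \<noteq> s q" using pq(3) s_eq[OF subsetD[OF SC pq(1)] subsetD[OF SC pq(2)]] by simp
  have False if e: "E (s p) (s q)"
  proof -
    obtain i j where ij: "p = f i" "q = f j" "i < j" "j < i + int c"
      by (rule range_pair[OF f subsetD[OF SC pq(1)] subsetD[OF SC pq(2)] pq(3)])
    let ?a = "rev (map f [i + 1..j])" and ?b = "map f [j + 1..i + int c]"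
    let ?l = "w # ?a @ ?b"
    have le: "i + 1 \<le> j" "j + 1 \<le> i + int c" using ij by auto
    have ends: "hd ?a = q" "last ?a = s p" "hd ?b = s q" "last ?b = p" "?a \<noteq> []" "?b \<noteq> []"
      using arc_rhd[OF le(1), of f] arc_rlast[OF le(1), of f] arc_hd[OF le(2), of f] arc_last[OF le(2), of f]
        arc_ne[OF le(1), of f] arc_ne[OF le(2), of f] ij s per by simp_all
    have ad: "E w q" "E p w" using pq E by (auto simp: S_def simple_def)
    have "cyc E X (c + 1)"
    proof (rule cycI)
      show "length ?l = c + 1" using ij by simp
      show "3 \<le> c + 1" using c3 by simp
      show "set ?l \<subseteq> X" using WX(1)[OF w] fX by auto
      have "distinct ?b" by (rule arc_distinct[OF f]) (use ij in simp)
      moreover have "distinct ?a" unfolding distinct_rev by (rule arc_distinct[OF f]) (use ij in simp)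
      moreover have "set ?a \<inter> set ?b = {}" unfolding set_rev set_map set_upto
        by (rule arc_disj[OF f]) (use ij in simp_all)
      moreover have "set ?a \<subseteq> C" "set ?b \<subseteq> C" by auto
      ultimately show "distinct ?l" using w unfolding W_def
        by (simp only: distinct.simps distinct_append set_append list.set) blast
      show "successively E ?l"
        using arcs(2)[of "i + 1" j] arcs(1)[of "j + 1" "i + int c"] ends ad e
        by (simp only: successively_append_iff successively_Cons hd_append2 list.sel list.distinct simp_thms
            append_is_Nil_conv append_Cons append_Nil)
      have "last ?l = p" using ends by (simp del: last_map hd_map last_rev)
      then show "E (last ?l) (hd ?l)" using ad by simp
    qed
    then show False using max[of "c + 1"] by simp
  qed
  then show ?thesis using ne by (auto simp: opp_def)
qed

text \<open>A detour from \<open>y\<close> through \<open>w\<close> and \<open>x\<close> to one of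
  these vertices would gain two vertices and lose at most one.\<close>

lemma adjacent_outside:
  assumes w: "w \<in> W" and x: "x \<in> W" and wx: "E w x" and y: "y \<in> S w"
  shows "s y \<notin> S x" "s (s y) \<notin> S x"
proof -
  obtain i where i: "y = f i" using y by (auto simp: S_def)
  have ne: "w \<noteq> x" by (rule simple_neq[OF E wx])
  have yw: "E y w" using y E by (auto simp: S_def simple_def)
  have "f (i + int d) \<notin> S x" if d: "d = 1 \<or> d = 2" for d :: nat
  proof
    assume sx: "f (i + int d) \<in> S x"
    let ?l = "w # x # map f [i + int d..i + int c]"
    have le: "i + int d \<le> i + int c" using c3 d by auto
    have "cyc E X (c + 3 - d)"
    proof (rule cycI)
      show "length ?l = c + 3 - d" using c3 d by auto
      show "3 \<le> c + 3 - d" using c3 d by auto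
      show "set ?l \<subseteq> X" using WX(1)[OF w] WX(1)[OF x] fX by auto
      have "distinct (map f [i + int d..i + int c])" by (rule arc_distinct[OF f]) (use d in auto)
      then show "distinct ?l" using w x ne by (auto simp: W_def)
      show "successively E ?l" using arcs(1)[of "i + int d" "i + int c"] arc_hd[OF le, of f] sx wx
        by (simp add: successively_Cons S_def)
      have "last ?l = f i" using arc_last[OF le, of f] arc_ne[OF le, of f] per by simp
      then show "E (last ?l) (hd ?l)" using yw i by simp
    qed
    then show False using max[of "c + 3 - d"] d by auto
  qed
  from this[of 1] this[of 2] show "s y \<notin> S x" "s (s y) \<notin> S x" by (simp_all add: i s add.assoc)
qed

lemma card_opp_C: "w \<in> W \<Longrightarrow> card {y \<in> C. opp E w y} = c - card (S w)"
proof -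
  assume w: "w \<in> W"
  have "{y \<in> C. opp E w y} = C - S w" using w by (auto simp: W_def S_def opp_def)
  then show ?thesis using card_Diff_subset[OF finS SC] cC by simp
qed

lemma card_W: "card W = card X - c"
  unfolding W_def using card_Diff_subset[OF finC fX] cC by simp

lemma finW: "finite W" using finX by (simp add: W_def)

end

lemma jackson_cyc:
  assumes "simple E" "finite A" "finite Y" "A \<inter> Y = {}" "card A \<le> d" "card Y + 2 \<le> 2 * d"
    "\<And>a. a \<in> A \<Longrightarrow> d \<le> card {y \<in> Y. E a y}" "2 \<le> card A"
  shows "cyc E (A \<union> Y) (2 * card A)"
  by (rule bip_cyc[OF jackson[OF assms]])

text \<open>These assumptions are to be refuted: \<open>E\<close> is the colour of a longest
  monochromatic cycle, which has at most \<open>2k\<close> vertices. By \<open>card_S\<close> an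
  outside vertex has at most \<open>t = c div 2\<close> neighbours of colour \<open>E\<close> on the
  cycle; the refutation depends on whether some vertex attains \<open>t\<close>.\<close>

locale longest_mono_cycle = longest_cycle +
  fixes k :: nat
  assumes maxF: "\<And>n. c < n \<Longrightarrow> \<not> cyc (opp E) X n"
    and c5: "5 \<le> c" and c2k: "c \<le> 2 * k" and X3k: "3 * k + 1 \<le> card X"
begin

abbreviation "F \<equiv> opp E"

lemma F: "simple F" by (rule simple_opp[OF E])

definition "t = c div 2"

lemma t2: "2 \<le> t" using c5 by (simp add: t_def)

lemma no_F: "c < n \<Longrightarrow> Z \<subseteq> X \<Longrightarrow> \<not> cyc F Z n"
  using maxF cyc_mono by blast

lemma sSC: "s ` S w \<subseteq> C"
  by (auto simp: S_def s)

text \<open>Jackson's theorem in \<open>F\<close>, applied between \<open>t + 1\<close> outside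
  vertices and \<open>C\<close>, gives a cycle on \<open>2t + 2 > c\<close> vertices.\<close>

lemma all_small:
  assumes sm: "\<And>w. w \<in> W \<Longrightarrow> card (S w) \<le> t - 1"
  shows False
proof -
  have "t + 1 \<le> card W" using card_W c2k X3k unfolding t_def by linarith
  then obtain A where A: "A \<subseteq> W" "card A = t + 1" "finite A"
    using finW obtain_subset_with_card_n by (metis rev_finite_subset)
  have "cyc F (A \<union> C) (2 * card A)"
  proof (rule jackson_cyc[OF F A(3) finC, where d = "c - (t - 1)"])
    show "A \<inter> C = {}" using A by (auto simp: W_def)
    show "card A \<le> c - (t - 1)" "card C + 2 \<le> 2 * (c - (t - 1))" using A(2) t2 cC unfolding t_def by linarith+
    show "2 \<le> card A" using A(2) t2 by simp
    fix a assume "a \<in> A"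
    then have a: "a \<in> W" using A by blast
    show "c - (t - 1) \<le> card {y \<in> C. F a y}" using card_opp_C[OF a] sm[OF a] by linarith
  qed
  moreover have "A \<union> C \<subseteq> X" using A fX by (auto simp: W_def)
  moreover have "c < 2 * card A" using A(2) by (simp add: t_def)
  ultimately show False using no_F by blast
qed

text \<open>Adding \<open>w\<close> to \<open>C\<close> compensates for the missing degree. A vertex
  that is \<open>F\<close>-adjacent to \<open>w\<close> gains a neighbour, and one that is
  \<open>E\<close>-adjacent to \<open>w\<close> has at most one \<open>E\<close>-neighbour on
  \<open>C\<close>; both reach the degree \<open>t + 2\<close> that Jackson's theorem asks for with
  the \<open>2t + 2\<close> vertices of \<open>insert w C\<close>.\<close>

lemma odd_case:
  assumes w: "w \<in> W" "card (S w) = t" and odd: "odd c"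
  shows False
proof -
  have ct: "c = 2 * t + 1" using odd by (simp add: t_def)
  have "t + 2 \<le> card W" using card_W c2k X3k ct by linarith
  then have "t + 1 \<le> card (W - {w})" using w finW by simp
  then obtain A where A: "A \<subseteq> W - {w}" "card A = t + 1" "finite A"
    using finW obtain_subset_with_card_n by (metis finite_Diff rev_finite_subset)
  \<comment> \<open>\<open>S x\<close> avoids the successors \<open>?a\<close>, the predecessors
    \<open>?p\<close> and the second successors \<open>?b\<close> of \<open>S w\<close>. Shifting by
    \<open>s\<close> shows that \<open>?a\<close> and \<open>?p\<close> share as many vertices as
    \<open>?b\<close> and \<open>S w\<close>, so \<open>?a\<close>, \<open>?p\<close> and
    \<open>?b \<inter> S w\<close> together cover exactly \<open>2t\<close> of the
    \<open>2t + 1\<close> vertices.\<close>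
  have Sx: "card (S x) \<le> 1" if x: "x \<in> W" "E w x" for x
  proof -
    let ?a = "s ` S w" and ?b = "s ` s ` S w"
    let ?p = "{y \<in> C. s y \<in> S w}"
    have sub: "?a \<subseteq> C" "?b \<subseteq> C" "?p \<subseteq> C" using SC sC by blast+
    have "s ` ?p = S w"
    proof (intro equalityI subsetI)
      fix y assume "y \<in> S w"
      then have "y \<in> s ` C" using SC s_im by blast
      then show "y \<in> s ` ?p" using \<open>y \<in> S w\<close> by blast
    qed auto
    then have cp: "card ?p = t" using card_s[OF sub(3)] w by simp
    have ca: "card ?a = t" "card ?b = t" using card_s[OF SC] card_s[OF sub(1)] w by simp_all
    have fin: "finite ?a" "finite ?b" "finite ?p"
      by (rule finite_subset[OF sub(1) finC], rule finite_subset[OF sub(2) finC], rule finite_subset[OF sub(3) finC])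
    have d1: "S w \<inter> (?a \<union> ?p) = {}" using no_insert[OF w(1)] by blast
    have xw: "E x w" using x(2) E by (auto simp: simple_def)
    have d2: "S x \<inter> (?a \<union> ?p \<union> ?b) = {}"
      using adjacent_outside[OF w(1) x] adjacent_outside(1)[OF x(1) w(1) xw] by blast
    have "s ` (?a \<inter> ?p) = ?b \<inter> S w"
    proof (intro equalityI subsetI)
      fix y assume y: "y \<in> ?b \<inter> S w"
      then obtain z where "z \<in> S w" "y = s (s z)" by blast
      then show "y \<in> s ` (?a \<inter> ?p)" using y sub(1) by blast
    qed auto
    moreover have "?a \<inter> ?p \<subseteq> C" using sub by blast
    ultimately have "card (?b \<inter> S w) = card (?a \<inter> ?p)" using card_s by metis
    moreover have "card ?a + card ?p = card (?a \<union> ?p) + card (?a \<inter> ?p)" by (rule card_Un_Int[OF fin(1,3)])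
    moreover have "card ((?a \<union> ?p) \<union> (?b \<inter> S w)) = card (?a \<union> ?p) + card (?b \<inter> S w)"
      by (rule card_Un_disjoint) (use fin d1 in auto)
    ultimately have "2 * t = card ((?a \<union> ?p) \<union> (?b \<inter> S w))" using ca cp by simp
    moreover have "card (S x) + card ((?a \<union> ?p) \<union> (?b \<inter> S w)) = card (S x \<union> ((?a \<union> ?p) \<union> (?b \<inter> S w)))"
      by (rule card_Un_disjoint[symmetric]) (use fin finS d2 in auto)
    moreover have "card (S x \<union> ((?a \<union> ?p) \<union> (?b \<inter> S w))) \<le> card C"
      by (rule card_mono[OF finC]) (use SC[of x] SC[of w] sub in blast)
    ultimately show ?thesis using cC ct by linarith
  qed
  have "cyc F (A \<union> insert w C) (2 * card A)"
  proof (rule jackson_cyc[OF F A(3), where d = "t + 2"])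
    show "finite (insert w C)" using finC by simp
    show "A \<inter> insert w C = {}" using A by (auto simp: W_def)
    show "card A \<le> t + 2" "2 \<le> card A" using A(2) t2 by simp_all
    show "card (insert w C) + 2 \<le> 2 * (t + 2)" using w finC cC ct by (simp add: W_def)
    fix a assume "a \<in> A"
    then have a: "a \<in> W" "a \<noteq> w" using A by blast+
    have le: "card {y \<in> C. F a y} \<le> card {y \<in> insert w C. F a y}" using finC by (intro card_mono) auto
    show "t + 2 \<le> card {y \<in> insert w C. F a y}"
    proof (cases "E w a")
      case True
      then show ?thesis using Sx[OF a(1)] card_opp_C[OF a(1)] le ct t2 by linarith
    next
      case False
      then have "F a w" using a(2) E by (auto simp: opp_def simple_def)
      then have "{y \<in> insert w C. F a y} = insert w {y \<in> C. F a y}" by auto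
      then have "card {y \<in> insert w C. F a y} = card {y \<in> C. F a y} + 1"
        using w finC by (simp add: W_def)
      then show ?thesis using card_S[OF a(1)] card_opp_C[OF a(1)] ct by linarith
    qed
  qed
  moreover have "A \<union> insert w C \<subseteq> X" using A fX w by (auto simp: W_def)
  moreover have "c < 2 * card A" using A(2) ct by simp
  ultimately show False using no_F by blast
qed

text \<open>\<open>S w\<close> and its successors \<open>U\<close> alternate on \<open>C\<close>,
  and \<open>w\<close> with \<open>U\<close> forms an \<open>F\<close>-clique \<open>Y\<close> of
  order \<open>t + 1\<close>. Jackson's theorem gives an \<open>F\<close>-cycle through
  \<open>t\<close> outside vertices \<open>A\<close> and all of \<open>Y\<close> except one vertex
  \<open>y\<close>. In every case this leads to an \<open>F\<close>-cycle on
  \<open>2t + 1 > c\<close> vertices.\<close>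

lemma even_case:
  assumes w: "w \<in> W" "card (S w) = t" and even: "even c"
  shows False
proof -
  have ct: "c = 2 * t" using even by (simp add: t_def)
  have t3: "3 \<le> t" using ct c5 by simp
  have "t + 1 \<le> card W" using card_W c2k X3k ct by linarith
  then have "t \<le> card (W - {w})" using w finW by simp
  then obtain A where A: "A \<subseteq> W - {w}" "card A = t" "finite A"
    using finW obtain_subset_with_card_n by (metis finite_Diff rev_finite_subset)
  define U where "U = s ` S w"
  have UC: "U \<subseteq> C" unfolding U_def by (rule sSC)
  have cU: "card U = t" unfolding U_def using card_s[OF SC] w(2) by simp
  have dU: "S w \<inter> U = {}" unfolding U_def using no_insert[OF w(1)] by auto
  have finU: "finite U" by (rule finite_subset[OF UC finC])
  have CU: "C = S w \<union> U"
  proof (rule card_subset_eq[OF finC, symmetric])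
    show "S w \<union> U \<subseteq> C" using SC UC by blast
    show "card (S w \<union> U) = card C" using card_Un_disjoint[OF finS finU dU] w cU cC ct by simp
  qed
  have sU: "s ` U = S w"
  proof -
    have "s ` C = s ` (S w \<union> U)" using CU by simp
    then have "C = U \<union> s ` U" using s_im by (simp only: image_Un U_def[symmetric])
    moreover have "U \<inter> s ` U = {}"
    proof -
      have "s ` (S w \<inter> U) = U \<inter> s ` U" unfolding U_def
        by (rule inj_on_image_Int[OF s_inj SC]) (use UC in \<open>simp add: U_def\<close>)
      then show ?thesis using dU by simp
    qed
    ultimately have "s ` U = C - U" by (metis Un_Diff_cancel2 Un_Diff Diff_cancel Diff_triv Un_empty_left inf_commute)
    moreover have "S w = C - U" using CU dU by (metis Un_Diff Diff_cancel Diff_triv Un_empty_right)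
    ultimately show ?thesis by simp
  qed
  have wU: "w \<notin> U" "w \<notin> C" using w UC by (auto simp: W_def)
  have Sx: "S x = {}" if x: "x \<in> W" "E w x" for x
  proof -
    have "S x \<inter> U = {}" using adjacent_outside(1)[OF w(1) x] by (auto simp: U_def)
    moreover have "S x \<inter> s ` (s ` S w) = {}" using adjacent_outside(2)[OF w(1) x] by auto
    moreover have "s ` (s ` S w) = S w" using sU by (simp add: U_def)
    moreover have "S x \<subseteq> S w \<union> U" using SC[of x] CU by simp
    ultimately show ?thesis by auto
  qed
  define Y where "Y = insert w U"
  have finY: "finite Y" and cY: "card Y = t + 1" using finU wU cU by (auto simp: Y_def)
  have YF: "F u v" if "u \<in> Y" "v \<in> Y" "u \<noteq> v" for u v
  proof -
    have a: "F p q" if "p \<in> U" "q \<in> U" "p \<noteq> q" for p q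
      using that succ_opp[OF w(1)] by (auto simp: U_def)
    have b: "F w p" if "p \<in> U" for p
      using that UC dU wU by (auto simp: opp_def S_def)
    show ?thesis using that a b simple_sym[OF F] by (auto simp: Y_def)
  qed
  have AW: "x \<in> W" "x \<noteq> w" "x \<notin> C" "x \<notin> Y" if "x \<in> A" for x
    using that A UC by (auto simp: W_def Y_def)
  have AY: "A \<inter> Y = {}" using AW by blast
  have AFE: "F x y \<longleftrightarrow> y \<notin> S x" if "x \<in> A" "y \<in> C" for x y
    using that AW(3) by (auto simp: opp_def S_def)
  have cJ: "cyc (bip F A Y) (A \<union> Y) (2 * card A)"
  proof (rule jackson[OF F A(3) finY AY, where d = t])
    show "card A \<le> t" "card Y + 2 \<le> 2 * t" "2 \<le> card A" using A(2) cY t3 by simp_all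
    fix x assume x: "x \<in> A"
    show "t \<le> card {y \<in> Y. F x y}"
    proof (cases "E w x")
      case True
      then have "U \<subseteq> {y \<in> Y. F x y}" using Sx AW(1)[OF x] AFE[OF x] UC by (auto simp: Y_def)
      then show ?thesis using card_mono[of "{y \<in> Y. F x y}" U] finY cU by simp
    next
      case False
      then have "F x w" using AW(2)[OF x] simple_sym[OF E] by (auto simp: opp_def)
      then have "insert w (U - S x \<inter> U) \<subseteq> {y \<in> Y. F x y}" using AFE[OF x] UC by (auto simp: Y_def)
      then have "card (insert w (U - S x \<inter> U)) \<le> card {y \<in> Y. F x y}" using finY by (intro card_mono) auto
      moreover have "card (insert w (U - S x \<inter> U)) = card (U - S x \<inter> U) + 1" using finU wU by simp
      moreover have "card (U - S x \<inter> U) = card U - card (S x \<inter> U)"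
        using finU by (intro card_Diff_subset) auto
      moreover have "card (S x \<inter> U) \<le> 1" using card_S_inter[OF w(1) AW(1)[OF x]] AW(2)[OF x] by (auto simp: U_def)
      ultimately show ?thesis using cU by linarith
    qed
  qed
  obtain g where g: "cycmap (bip F A Y) (2 * t) g" "range g \<subseteq> A \<union> Y"
    and gA: "\<And>i. g (2 * i) \<in> A" and gY: "\<And>i. g (2 * i + 1) \<in> Y"
    using bip_cycE[OF cJ AY] A(2) by auto
  note int = bip_cyc_inter[OF g(1) AY gA gY]
  have cA: "card (range g \<inter> A) = t" "card (range g \<inter> Y) = t" using int by (simp_all add: card_image)
  have Ag: "A = range g \<inter> A" using cA(1) A by (metis Int_lower2 card_subset_eq)
  obtain y where y: "y \<in> Y" "y \<notin> range g"
  proof -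
    have "\<not> Y \<subseteq> range g" using cA(2) cY by (metis inf.absorb2 n_not_Suc_n Suc_eq_plus1)
    then show ?thesis using that by blast
  qed
  have no_long: False if "cyc F Z (2 * t + 1)" "Z \<subseteq> X" for Z
    using no_F[OF _ that(2), of "2 * t + 1"] that(1) ct by simp
  have AX: "A \<subseteq> X" "Y \<subseteq> X" "C \<subseteq> X" using A w UC fX by (auto simp: W_def Y_def)
  \<comment> \<open>If \<open>y\<close> has an \<open>F\<close>-neighbour in \<open>A\<close>, it
    can be inserted after that neighbour, because the next vertex of the cycle lies in the clique
    \<open>Y\<close>. Otherwise \<open>y\<close> is \<open>E\<close>-adjacent to all of
    \<open>A\<close>.\<close>
  show False
  proof (cases "\<exists>x\<in>A. F x y")
    case True
    then obtain x where x: "x \<in> A" "F x y" by blast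
    then obtain i where i: "x = g (2 * i)" using Ag int(1) by blast
    let ?l = "y # map g [2 * i + 1..2 * i + 2 * int t]"
    have le: "2 * i + 1 \<le> 2 * i + 2 * int t" using t3 by simp
    have "cyc F (A \<union> Y) (2 * t + 1)"
    proof (rule cycI)
      show "length ?l = 2 * t + 1" by simp
      show "3 \<le> 2 * t + 1" using t3 by simp
      show "set ?l \<subseteq> A \<union> Y" using y g by auto
      show "distinct ?l" using arc_distinct[OF g(1), of "2 * i + 2 * int t" "2 * i + 1"] y by auto
      have "successively (bip F A Y) (map g [2 * i + 1..2 * i + 2 * int t])" by (rule cycmap_arc[OF g(1)])
      then have "successively F (map g [2 * i + 1..2 * i + 2 * int t])"
        by (rule successively_mono) (auto simp: bip_def)
      moreover have "F y (g (2 * i + 1))" using y gY[of i] YF by auto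
      ultimately show "successively F ?l" using arc_hd[OF le, of g] by (simp add: successively_Cons)
      have "last ?l = g (2 * i)" using arc_last[OF le, of g] arc_ne[OF le, of g] cycmap_per[OF g(1), of "2 * i"] by simp
      then show "F (last ?l) (hd ?l)" using x i by simp
    qed
    then show False using no_long[of "A \<union> Y"] AX by blast
  next
    case False
    have Exy: "E x y" if "x \<in> A" for x using False that AW(4)[OF that] y(1) by (auto simp: opp_def)
    show False
    proof (cases "y = w")
      case True
      \<comment> \<open>Every vertex of \<open>A\<close> is \<open>E\<close>-adjacent to
        \<open>w\<close> and so has no \<open>E\<close>-neighbour on \<open>C\<close>.\<close>
      have "joined F A C" unfolding joined_def
      proof (intro ballI)
        fix x z assume "x \<in> A" "z \<in> C"
        moreover have "S x = {}" using Exy[OF \<open>x \<in> A\<close>] Sx[OF AW(1)[OF \<open>x \<in> A\<close>]] True simple_sym[OF E] by blast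
        ultimately show "F x z" using AFE by blast
      qed
      obtain u where u: "u \<in> U" using cU t3 by fastforce
      have "card (U - {u}) \<noteq> 0" using cU t3 u finU by simp
      then have "U - {u} \<noteq> {}" by (intro notI) simp
      then obtain v where v: "v \<in> U" "u \<noteq> v" by blast
      have "F u v" using YF u v by (auto simp: Y_def)
      then have "cyc F (A \<union> C) (2 * t + 1)"
        using bip_odd_cycle[OF F \<open>joined F A C\<close> A(3) finC, of u v t] u v UC A(2) cC ct t3 by auto
      then show False using no_long[of "A \<union> C"] AX by blast
    next
      case False
      then have yU: "y \<in> U" using y by (simp add: Y_def)
      \<comment> \<open>\<open>y\<close> is exchanged for its successor. For each \<open>x\<close>
        in \<open>A\<close>, \<open>y \<in> S x\<close> excludes \<open>E w x\<close>, keeps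
        \<open>s y\<close> out of \<open>S x\<close> and makes \<open>y\<close> the only member of
        \<open>S x\<close> in \<open>U\<close>. So \<open>A\<close> is completely
        \<open>F\<close>-joined to \<open>B\<close>, which contains an
        \<open>F\<close>-edge.\<close>
      define B where "B = insert (s y) (insert w (U - {y}))"
      have sy: "s y \<in> S w" using sU yU by blast
      have syn: "s y \<notin> U" "s y \<noteq> w" using sy dU wU SC by auto
      have syC: "s y \<in> C" using sy SC by blast
      have "joined F A B" unfolding joined_def
      proof (intro ballI)
        fix x z assume x: "x \<in> A" and z: "z \<in> B"
        have ySx: "y \<in> S x" using Exy[OF x] yU UC by (auto simp: S_def)
        have "\<not> E w x" using Sx[OF AW(1)[OF x]] ySx by blast
        then have "F x w" using AW(2)[OF x] simple_sym[OF E] by (auto simp: opp_def)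
        moreover have "F x (s y)" using no_insert[OF AW(1)[OF x] ySx] AFE[OF x syC] by blast
        moreover have "F x u" if "u \<in> U" "u \<noteq> y" for u
        proof -
          have "card (S x \<inter> U) \<le> Suc 0" using card_S_inter[OF w(1) AW(1)[OF x]] AW(2)[OF x] by (auto simp: U_def)
          then have "u \<notin> S x" using card_le_Suc0_iff_eq[of "S x \<inter> U"] finU that yU ySx by auto
          then show ?thesis using AFE[OF x] that UC by blast
        qed
        ultimately show "F x z" using z by (auto simp: B_def)
      qed
      have finB: "finite B" using finU by (simp add: B_def)
      have cB: "card B = t + 1" unfolding B_def using finU syn wU yU cU t3 by simp
      have "card (U - {y}) \<noteq> 0" using cU t3 yU finU by simp
      then have "U - {y} \<noteq> {}" by (intro notI) simp
      then obtain u where u: "u \<in> U" "u \<noteq> y" by blast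
      have "F u w" using YF u wU by (auto simp: Y_def)
      then have "cyc F (A \<union> B) (2 * t + 1)"
        using bip_odd_cycle[OF F \<open>joined F A B\<close> A(3) finB, of u w t] u A(2) cB t3 by (auto simp: B_def)
      moreover have "B \<subseteq> X" using AX syC by (auto simp: B_def Y_def)
      ultimately show False using no_long[of "A \<union> B"] AX by blast
    qed
  qed
qed

lemma contradiction: False
proof (cases "\<exists>w\<in>W. card (S w) = t")
  case True
  then show ?thesis using odd_case even_case by blast
next
  case False
  have "card (S w) \<le> t - 1" if "w \<in> W" for w
  proof -
    have "card (S w) \<noteq> t" "2 * card (S w) \<le> c" using False that card_S by auto
    then show ?thesis unfolding t_def by linarith
  qed
  then show ?thesis by (rule all_small)
qed

end

lemma long_mono_cycle:
  assumes E: "simple E" and X: "finite X" "3 * k + 1 \<le> card X" "6 \<le> k"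
  shows "\<exists>n\<ge>2 * k + 1. cyc E X n \<or> cyc (opp E) X n"
proof (rule ccontr)
  assume no: "\<not> ?thesis"
  let ?P = "\<lambda>n. cyc E X n \<or> cyc (opp E) X n"
  obtain n0 where n0: "5 \<le> n0" "?P n0" using mono5[OF E X(1)] X by auto
  have bd: "\<forall>n. ?P n \<longrightarrow> n \<le> card X" using cyc_card[OF _ X(1)] by blast
  \<comment> \<open>The maximum is taken over both colours, so the locale applies to whichever
    colour attains it.\<close>
  define c where "c = Greatest ?P"
  have Pc: "?P c" unfolding c_def by (rule GreatestI_nat[of ?P n0 "card X"]) (use n0 bd in auto)
  have mx: "\<And>n. ?P n \<Longrightarrow> n \<le> c" unfolding c_def by (rule Greatest_le_nat[of ?P _ "card X"]) (use bd in auto)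
  have c: "5 \<le> c" "c \<le> 2 * k"
  proof -
    show "5 \<le> c" using mx[OF n0(2)] n0 by simp
    have "\<not> 2 * k + 1 \<le> c" using no Pc by blast
    then show "c \<le> 2 * k" by simp
  qed
  have False if cy: "cyc D X c" and D: "simple D" "\<And>n. c < n \<Longrightarrow> \<not> cyc D X n" "\<And>n. c < n \<Longrightarrow> \<not> cyc (opp D) X n" for D
  proof -
    obtain f where f: "cycmap D c f" "range f \<subseteq> X" "card (range f) = c" by (rule cyc_cycmap[OF cy])
    obtain s where s: "\<And>i. s (f i) = f (i + 1)" "inj_on s (range f)" "s ` range f = range f"
      using cyc_successor[OF f(1)] by blast
    interpret longest_mono_cycle D X c f s k
      by unfold_locales (use D X f s c in auto)
    show False by (rule contradiction)
  qed
  then show False using Pc E simple_opp[OF E] opp_opp[OF E] mx by (metis not_le)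
qed

section \<open>Two cliques from a minimal cycle, and the sides attached to them\<close>

definition clique :: "('a \<Rightarrow> 'a \<Rightarrow> bool) \<Rightarrow> 'a set \<Rightarrow> bool" where
  "clique E A \<longleftrightarrow> (\<forall>x\<in>A. \<forall>y\<in>A. x \<noteq> y \<longrightarrow> E x y)"

lemma cycmap_opp2:
  assumes E: "simple E" and f: "cycmap E n f" and n: "4 \<le> n" and no: "\<not> cyc E (range f) (n - 1)"
  shows "opp E (f i) (f (i + 2))"
proof -
  have "f i \<noteq> f (i + 2)" by (rule cycmap_neq[OF f]) (use n in auto)
  then show ?thesis using cyc_skip[OF f E n, of i] no by (auto simp: opp_def)
qed

text \<open>A chord of \<open>E\<close> inside one parity class would, as there is no \<open>E\<close>-cycle of length \<open>2m - 1\<close>, force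
  two chords of \<open>opp E\<close> between the parity classes; together with the chords of length 2 they form an
  \<open>opp E\<close>-cycle through all vertices but one.\<close>

lemma even_parity_opp:
  assumes E: "simple E" and f: "cycmap E (2 * m) f" and m: "4 \<le> m"
    and no: "\<not> cyc E (range f) (2 * m - 1)" "\<not> cyc (opp E) (range f) (2 * m - 1)"
    and pq: "p < q" "q < p + 2 * int m" "even (q - p)"
  shows "opp E (f p) (f q)"
proof (rule ccontr)
  assume "\<not> ?thesis"
  moreover have "f p \<noteq> f q" by (rule cycmap_neq[OF f]) (use pq in auto)
  ultimately have Epq: "E (f p) (f q)" by (auto simp: opp_def)
  note F = simple_opp[OF E]
  have n4: "4 \<le> 2 * m" using m by simp
  have F2: "opp E (f i) (f (i + 2))" for i by (rule cycmap_opp2[OF E f n4 no(1)])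
  have per: "f (i + 2 * int m) = f i" for i using cycmap_per[OF f, of i] by simp
  have "q \<noteq> p + 2" using F2[of p] Epq by (auto simp: opp_def)
  moreover have "q \<noteq> p + 2 * int m - 2"
  proof
    assume "q = p + 2 * int m - 2"
    then have "f (q + 2) = f p" using per[of p] by simp
    then show False using F2[of q] Epq E by (auto simp: opp_def simple_def)
  qed
  moreover obtain r where r: "q - p = 2 * r" using pq(3) by (rule evenE)
  ultimately have "r \<noteq> 1" "r \<noteq> int m - 1" by auto
  then have q: "p + 4 \<le> q" "q \<le> p + 2 * int m - 4" using pq r by linarith+
  have "\<not> E (f (p + 1)) (f (q + 2))"
    using cyc_cross[OF f E n4 _ _ Epq] no(1) q by auto
  moreover have "f (p + 1) \<noteq> f (q + 2)" by (rule cycmap_neq[OF f]) (use q in auto)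
  ultimately have e1: "opp E (f (p + 1)) (f (q + 2))" by (simp add: opp_def)
  have "\<not> E (f (p - 1)) (f (q - 2))"
    using cyc_cross[OF f E n4, of "p - 1" "q - 2"] Epq no(1) q by auto
  moreover have "f (p - 1) \<noteq> f (q - 2)" by (rule cycmap_neq[OF f]) (use q in auto)
  ultimately have e2: "opp E (f (p - 1)) (f (q - 2))" by (simp add: opp_def)
  \<comment> \<open>\<open>?a\<close> goes in steps of 2 through the whole parity class of
    \<open>p + 1\<close>, from \<open>p + 1\<close> round to \<open>p - 1\<close>; \<open>?b\<close>
    goes backwards through the class of \<open>q\<close>, from \<open>q - 2\<close> to
    \<open>q + 2\<close>, and omits \<open>q\<close> alone. The two new chords close them to a cycle
    of length \<open>m + (m - 1)\<close>.\<close>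
  let ?a = "map (\<lambda>s. f (p + 1 + 2 * s)) [0..int m - 1]"
  let ?b = "map (\<lambda>s. f (q - 2 - 2 * s)) [0..int m - 2]"
  have le: "0 \<le> int m - 1" "0 \<le> int m - 2" using m by auto
  have ab: "?a \<noteq> []" "?b \<noteq> []" using m by auto
  have "f (p + 1 + 2 * (int m - 1)) = f (p - 1)" using per[of "p - 1"] by (simp add: algebra_simps)
  then have ends: "hd ?a = f (p + 1)" "last ?a = f (p - 1)" "hd ?b = f (q - 2)"
    using arc_hd[OF le(1), of "\<lambda>s. f (p + 1 + 2 * s)"] arc_last[OF le(1), of "\<lambda>s. f (p + 1 + 2 * s)"]
      arc_hd[OF le(2), of "\<lambda>s. f (q - 2 - 2 * s)"] by simp_all
  have "f (q - 2 - 2 * (int m - 2)) = f (q + 2)" using per[of "q + 2 - 2 * int m"] by (simp add: algebra_simps)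
  then have endb: "last ?b = f (q + 2)"
    using arc_last[OF le(2), of "\<lambda>s. f (q - 2 - 2 * s)"] by simp
  have "cyc (opp E) (range f) (2 * m - 1)"
  proof (rule cycI)
    show "length (?a @ ?b) = 2 * m - 1" using m by simp
    show "3 \<le> 2 * m - 1" using m by simp
    show "set (?a @ ?b) \<subseteq> range f" by auto
    have "inj_on (\<lambda>s. f (p + 1 + 2 * s)) {0..int m - 1}"
      by (rule linorder_inj_onI) (use cycmap_neq[OF f] in auto)
    then have "distinct ?a" by (simp add: distinct_map)
    moreover have "inj_on (\<lambda>s. f (q - 2 - 2 * s)) {0..int m - 2}"
    proof (rule linorder_inj_onI)
      fix x y assume "x < y" "x \<in> {0..int m - 2}" "y \<in> {0..int m - 2}"
      then have "f (q - 2 - 2 * y) \<noteq> f (q - 2 - 2 * x)" by (intro cycmap_neq[OF f]) auto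
      then show "f (q - 2 - 2 * x) \<noteq> f (q - 2 - 2 * y)" by simp
    qed auto
    then have "distinct ?b" by (simp add: distinct_map)
    moreover have "f (p + 1 + 2 * s) \<noteq> f (q - 2 - 2 * s')" for s s'
    proof
      assume "f (p + 1 + 2 * s) = f (q - 2 - 2 * s')"
      then have "int (2 * m) dvd (p + 1 + 2 * s) - (q - 2 - 2 * s')"
        by (simp add: cycmap_eq[OF f] mod_eq_dvd_iff)
      moreover have "2 dvd int (2 * m)" by simp
      ultimately have "2 dvd (p + 1 + 2 * s) - (q - 2 - 2 * s')" by (rule dvd_trans[rotated])
      moreover have "(p + 1 + 2 * s) - (q - 2 - 2 * s') = 2 * (s + s' - r + 1) + 1" using r by simp
      ultimately show False by presburger
    qed
    then have "set ?a \<inter> set ?b = {}" by auto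
    ultimately show "distinct (?a @ ?b)" by simp
    have "successively (opp E) ?a"
    proof (rule arc_succ)
      fix i :: int
      have "p + 1 + 2 * (i + 1) = p + 1 + 2 * i + 2" by simp
      then show "opp E (f (p + 1 + 2 * i)) (f (p + 1 + 2 * (i + 1)))" using F2[of "p + 1 + 2 * i"] by simp
    qed
    moreover have "successively (opp E) ?b"
    proof (rule arc_succ)
      fix i :: int
      have "q - 2 - 2 * (i + 1) + 2 = q - 2 - 2 * i" by simp
      then have "opp E (f (q - 2 - 2 * (i + 1))) (f (q - 2 - 2 * i))" using F2[of "q - 2 - 2 * (i + 1)"] by (simp only:)
      then show "opp E (f (q - 2 - 2 * i)) (f (q - 2 - 2 * (i + 1)))" using F by (simp only: simple_def)
    qed
    ultimately show "successively (opp E) (?a @ ?b)"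
      using ends e2 ab by (simp only: successively_append_iff) blast
    show "opp E (last (?a @ ?b)) (hd (?a @ ?b))"
      using ends endb ab e1 simple_sym[OF F] by (simp only: last_append hd_append) simp
  qed
  then show False using no(2) by blast
qed

text \<open>For odd length, doubling the index permutes the vertices, so the 2-chords form a cycle
  \<open>g\<close> of \<open>opp E\<close> through all of them. As the 2-chords of \<open>f\<close>
  lie in \<open>opp E\<close>, so the 2-chords of \<open>g\<close>, which are the 4-chords of
  \<open>f\<close>, lie in \<open>E\<close>. Crossing with these puts the 3- and 5-chords into
  \<open>opp E\<close>, and two of them shorten \<open>g\<close>.\<close>

lemma odd_contradiction:
  assumes E: "simple E" and f: "cycmap E (2 * m + 1) f" and m: "4 \<le> m"
    and no: "\<not> cyc E (range f) (2 * m)" "\<not> cyc (opp E) (range f) (2 * m)"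
  shows False
proof -
  let ?n = "2 * m + 1"
  note F = simple_opp[OF E]
  have n4: "4 \<le> ?n" using m by simp
  have F2: "opp E (f i) (f (i + 2))" for i by (rule cycmap_opp2[OF E f n4]) (use no in simp)
  define g where "g i = f (2 * i)" for i
  have g: "cycmap (opp E) ?n g" unfolding cycmap_def
  proof (intro conjI allI)
    fix i j
    have cop: "coprime (int ?n) 2" by simp
    have "g i = g j \<longleftrightarrow> int ?n dvd 2 * (i - j)"
      by (simp add: g_def cycmap_eq[OF f] mod_eq_dvd_iff right_diff_distrib)
    also have "\<dots> \<longleftrightarrow> int ?n dvd i - j" by (rule coprime_dvd_mult_right_iff[OF cop])
    finally show "g i = g j \<longleftrightarrow> i mod int ?n = j mod int ?n" by (simp add: mod_eq_dvd_iff)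
    show "opp E (g i) (g (i + 1))" using F2[of "2 * i"] by (simp add: g_def algebra_simps)
  qed (use m in simp)
  have gf: "range g \<subseteq> range f" by (auto simp: g_def)
  have nog: "\<not> cyc (opp E) (range g) (?n - 1)" using no(2) cyc_mono[OF _ gf] by auto
  \<comment> \<open>\<open>m + 1\<close> is the inverse of 2 modulo \<open>2m + 1\<close>.\<close>
  have fg: "f i = g (i * (int m + 1))" for i
  proof -
    have "int ?n dvd i - 2 * (i * (int m + 1))"
      by (rule dvdI[of _ _ "- i"]) (simp add: algebra_simps)
    then show ?thesis by (simp add: g_def cycmap_eq[OF f] mod_eq_dvd_iff)
  qed
  have E4: "E (f i) (f (i + 4))" for i
  proof (rule ccontr)
    assume "\<not> ?thesis"
    moreover have "f i \<noteq> f (i + 4)" by (rule cycmap_neq[OF f]) (use m in auto)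
    ultimately have "opp E (f i) (f (i + 4))" by (simp add: opp_def)
    moreover have "f (i + 4) = g (i * (int m + 1) + 2)"
    proof -
      have "int ?n dvd (i + 4) - 2 * (i * (int m + 1) + 2)"
        by (rule dvdI[of _ _ "- i"]) (simp add: algebra_simps)
      then show ?thesis by (simp add: g_def cycmap_eq[OF f] mod_eq_dvd_iff)
    qed
    ultimately have "opp E (g (i * (int m + 1))) (g (i * (int m + 1) + 2))" using fg[of i] by simp
    then show False using cyc_skip[OF g F n4] nog by blast
  qed
  have "\<not> E (f 5) (f (int ?n + 2))"
    using cyc_cross[OF f E n4, of 4 "int ?n"] E4[of 0] cycmap_per[OF f, of 0] no(1) m simple_sym[OF E] by auto
  moreover have "f (int ?n + 2) = f 2" using cycmap_per[OF f, of 2] by (simp add: add.commute)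
  ultimately have n25: "\<not> E (f 5) (f 2)" by simp
  have shift: "opp E (f i) (f (i + 3))" "opp E (f i) (f (i + 5))" for i
  proof -
    have "\<not> E (f (i + 3)) (f (int ?n + i))"
      using cyc_cross[OF f E n4, of "i + 2" "int ?n + i - 2"] E4[of "i - 2"] cycmap_per[OF f, of "i - 2"] no(1) m simple_sym[OF E]
      by (auto simp: algebra_simps)
    then have "\<not> E (f i) (f (i + 3))" using cycmap_per[OF f, of i] simple_sym[OF E] by (simp add: algebra_simps)
    moreover have "f i \<noteq> f (i + 3)" by (rule cycmap_neq[OF f]) (use m in auto)
    ultimately show "opp E (f i) (f (i + 3))" by (simp add: opp_def)
    have "\<not> E (f i) (f (i + 5))"
      using cyc_cross[OF f E n4, of "i - 1" "i + 3"] E4[of "i - 1"] no(1) m by (auto simp: algebra_simps)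
    moreover have "f i \<noteq> f (i + 5)" by (rule cycmap_neq[OF f]) (use m in auto)
    ultimately show "opp E (f i) (f (i + 5))" by (simp add: opp_def)
  qed
  have g1: "g 0 = f 0" "g 1 = f 2" by (simp_all add: g_def)
  \<comment> \<open>Doubling \<open>m + 2\<close> and \<open>m + 4\<close> gives 3 and 7 modulo
    \<open>2m + 1\<close>, so the crossing chords of \<open>g\<close> are \<open>f 0, f 3\<close>
    and \<open>f 2, f 7\<close>.\<close>
  have g2: "g (int m + 2) = f 3" "g (int m + 2 + 2) = f 7"
    using cycmap_per[OF f, of 3] cycmap_per[OF f, of 7] by (simp_all add: g_def algebra_simps)
  have "cyc (opp E) (range g) (?n - 1)"
  proof (rule cyc_cross[OF g F n4, of 0 "int m + 2"])
    show "opp E (g 0) (g (int m + 2))" using shift(1)[of 0] g1 g2 by simp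
    show "opp E (g (0 + 1)) (g (int m + 2 + 2))" using shift(2)[of 2] g1 g2 by simp
  qed (use m in auto)
  then show False using nog by blast
qed

lemma two_cliques:
  assumes E: "simple E" and X: "finite X" "3 * k + 1 \<le> card X" "6 \<le> k"
    and no: "\<not> cyc E X (2 * k + 1)" "\<not> cyc (opp E) X (2 * k + 1)"
  shows "\<exists>K A B. (K = E \<or> K = opp E) \<and> A \<subseteq> X \<and> B \<subseteq> X \<and> A \<inter> B = {} \<and> k + 1 \<le> card A \<and> k + 1 \<le> card B
    \<and> clique K A \<and> clique K B"
proof -
  let ?P = "\<lambda>n. 2 * k + 1 \<le> n \<and> (cyc E X n \<or> cyc (opp E) X n)"
  define n where "n = (LEAST n. ?P n)"
  have "\<exists>n. ?P n" using long_mono_cycle[OF E X] by blast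
  then have Pn: "?P n" unfolding n_def by (rule LeastI_ex)
  have least: "\<And>j. ?P j \<Longrightarrow> n \<le> j" unfolding n_def by (rule Least_le)
  \<comment> \<open>Excluding \<open>2k + 1\<close> itself is what gives each parity class
    \<open>k + 1\<close> vertices, and it makes \<open>n - 1\<close> an excluded length by
    minimality.\<close>
  have n2: "2 * k + 2 \<le> n" using Pn no by (cases "n = 2 * k + 1") auto
  then have no1: "\<not> cyc E X (n - 1)" "\<not> cyc (opp E) X (n - 1)"
  proof -
    have "2 * k + 1 \<le> n - 1" "\<not> n \<le> n - 1" using n2 by linarith+
    then show "\<not> cyc E X (n - 1)" "\<not> cyc (opp E) X (n - 1)" using least[of "n - 1"] by blast+
  qed
  have main: "\<exists>A B. A \<subseteq> X \<and> B \<subseteq> X \<and> A \<inter> B = {} \<and> k + 1 \<le> card A \<and> k + 1 \<le> card B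
      \<and> clique (opp D) A \<and> clique (opp D) B"
    if D: "simple D" "cyc D X n" "\<not> cyc D X (n - 1)" "\<not> cyc (opp D) X (n - 1)" for D
  proof -
    obtain f where f: "cycmap D n f" "range f \<subseteq> X" by (rule cyc_cycmap[OF D(2)])
    have nr: "\<not> cyc D (range f) (n - 1)" "\<not> cyc (opp D) (range f) (n - 1)"
      using D(3,4) cyc_mono[OF _ f(2)] by blast+
    show ?thesis
    proof (cases "even n")
      case True
      then obtain m where m: "n = 2 * m" by (rule evenE)
      have m4: "4 \<le> m" "k + 1 \<le> m" using n2 m X by auto
      let ?h = "\<lambda>c s. f (c + 2 * s)"
      have inj: "inj_on (?h c) {0..<int m}" for c
        by (rule linorder_inj_onI) (use cycmap_neq[OF f(1)] m in auto)
      have clqh: "clique (opp D) (?h c ` {0..<int m})" for c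
      proof -
        have lt: "opp D (?h c i) (?h c j)" if "i < j" "i \<in> {0..<int m}" "j \<in> {0..<int m}" for i j
          by (rule even_parity_opp[OF D(1) f(1)[unfolded m] m4(1) nr[unfolded m]]) (use that in auto)
        show ?thesis unfolding clique_def
        proof (clarify)
          fix i j assume ij: "i \<in> {0..<int m}" "j \<in> {0..<int m}" "?h c i \<noteq> ?h c j"
          then have "i \<noteq> j" by auto
          then show "opp D (?h c i) (?h c j)" using lt[of i j] lt[of j i] ij simple_sym[OF simple_opp[OF D(1)]]
            by (cases "i < j") auto
        qed
      qed
      have disj: "?h 0 ` {0..<int m} \<inter> ?h 1 ` {0..<int m} = {}"
      proof -
        have "f (0 + 2 * i) \<noteq> f (1 + 2 * j)" for i j
        proof
          assume "f (0 + 2 * i) = f (1 + 2 * j)"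
          then have "int n dvd 0 + 2 * i - (1 + 2 * j)" by (simp only: cycmap_eq[OF f(1)] mod_eq_dvd_iff)
          moreover have "2 dvd int n" using m by simp
          ultimately have "2 dvd 0 + 2 * i - (1 + 2 * j)" by (rule dvd_trans[rotated])
          then show False by presburger
        qed
        then show ?thesis by auto
      qed
      show ?thesis
        by (intro exI[of _ "?h 0 ` {0..<int m}"] exI[of _ "?h 1 ` {0..<int m}"] conjI clqh disj)
          (use f(2) m4 inj[of 0] inj[of 1] in \<open>auto simp: card_image\<close>)
    next
      case False
      then obtain m where m: "n = 2 * m + 1" by (rule oddE)
      have "4 \<le> m" using n2 m X by auto
      then show ?thesis using odd_contradiction[OF D(1) f(1)[unfolded m]] nr m by simp
    qed
  qed
  from Pn consider "cyc E X n" | "cyc (opp E) X n" by blast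
  then show ?thesis
  proof cases
    case 1 then show ?thesis using main[OF E _ no1] by blast
  next
    case 2 then show ?thesis using main[OF simple_opp[OF E] _ no1(2)] opp_opp[OF E] no1(1) by auto
  qed
qed

text \<open>Any two vertices of \<open>P\<close> are joined by paths inside \<open>P\<close> of every order from 3 to \<open>m\<close>, see
  \<open>linked_path\<close>; the members of \<open>P\<close> outside the core \<open>A\<close> may be arbitrarily related.\<close>

definition linked :: "('a \<Rightarrow> 'a \<Rightarrow> bool) \<Rightarrow> nat \<Rightarrow> 'a set \<Rightarrow> 'a set \<Rightarrow> bool" where
  "linked K m P A \<longleftrightarrow> finite P \<and> A \<subseteq> P \<and> m \<le> card A \<and> (\<forall>x\<in>P. \<forall>a\<in>A. x \<noteq> a \<longrightarrow> K x a)"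

lemma linked_clique: "finite A \<Longrightarrow> clique K A \<Longrightarrow> m \<le> card A \<Longrightarrow> linked K m A A"
  by (auto simp: linked_def clique_def)

lemma linked_less: "linked K m P A \<Longrightarrow> m' \<le> m \<Longrightarrow> linked K m' P A"
  by (auto simp: linked_def)

lemma clique_succ: "clique K A \<Longrightarrow> set xs \<subseteq> A \<Longrightarrow> distinct xs \<Longrightarrow> successively K xs"
  by (induction xs rule: induct_list012) (auto simp: clique_def)

text \<open>The inner vertices are taken from the core, which has at least \<open>m - 2\<close>
  members besides the two ends.\<close>

lemma linked_path:
  assumes K: "simple K" and l: "linked K m P A" and xy: "x \<in> P" "y \<in> P" "x \<noteq> y" and n: "3 \<le> n" "n \<le> m"
  obtains xs where "distinct xs" "successively K xs" "length xs = n" "set xs \<subseteq> P" "hd xs = x" "last xs = y" "xs \<noteq> []"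
proof -
  have finA: "finite A" using l finite_subset by (auto simp: linked_def)
  have "n - 2 \<le> card (A - {x, y})"
  proof -
    have "card A - card {x, y} \<le> card (A - {x, y})" by (rule diff_card_le_card_Diff) simp
    moreover have "card {x, y} = 2" using xy by simp
    moreover have "m \<le> card A" using l by (simp add: linked_def)
    ultimately show ?thesis using n by linarith
  qed
  then obtain T where T: "T \<subseteq> A - {x, y}" "card T = n - 2" "finite T"
    using finA obtain_subset_with_card_n by (metis finite_Diff rev_finite_subset)
  obtain ys where ys: "set ys = T" "distinct ys" using finite_distinct_list[OF T(3)] by blast
  have len: "length ys = n - 2" using ys T distinct_card by fastforce
  have ne: "ys \<noteq> []" using len n by auto
  have "clique K A" using l by (auto simp: linked_def clique_def)
  then have "successively K ys" using clique_succ ys T by blast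
  moreover have "K x (hd ys)" "K (last ys) y"
  proof -
    have "hd ys \<in> A - {x, y}" "last ys \<in> A - {x, y}" using ne ys T by auto
    then show "K x (hd ys)" "K (last ys) y" using l xy K by (auto simp: linked_def simple_def)
  qed
  moreover have "Suc (Suc (n - 2)) = n" using n by simp
  ultimately show ?thesis using that[of "x # ys @ [y]"] ne ys T xy len l
    by (auto simp: successively_Cons successively_append_iff linked_def)
qed

lemma glue:
  assumes "distinct xs" "successively K xs" "distinct ys" "successively K ys" "set xs \<inter> set ys = {}"
    "xs \<noteq> []" "ys \<noteq> []" "K (last xs) (hd ys)" "K (last ys) (hd xs)" "3 \<le> length xs + length ys"
    "set xs \<subseteq> X" "set ys \<subseteq> X"
  shows "cyc K X (length xs + length ys)"
  by (rule cycI[of "xs @ ys"]) (use assms in \<open>auto simp: successively_append_iff\<close>)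

text \<open>The odd length splits as \<open>k + (k + 1)\<close>, so one of the two cores may be
  smaller by one.\<close>

lemma no_two_links:
  assumes K: "simple K" and l: "linked K k P A" "linked K (k + 1) Q B" "P \<inter> Q = {}" "3 \<le> k"
    and e: "x \<in> P" "x' \<in> P" "x \<noteq> x'" "y \<in> Q" "y' \<in> Q" "y \<noteq> y'" "K x y" "K x' y'"
  shows "cyc K (P \<union> Q) (2 * k + 1)"
proof -
  obtain xs where xs: "distinct xs" "successively K xs" "length xs = k" "set xs \<subseteq> P" "hd xs = x'" "last xs = x" "xs \<noteq> []"
    by (rule linked_path[OF K l(1) e(2,1) e(3)[symmetric] l(4) le_refl])
  obtain ys where ys: "distinct ys" "successively K ys" "length ys = k + 1" "set ys \<subseteq> Q" "hd ys = y" "last ys = y'" "ys \<noteq> []"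
    by (rule linked_path[OF K l(2) e(4,5,6), of "k + 1"]) (use l in auto)
  have "cyc K (P \<union> Q) (length xs + length ys)"
    by (rule glue) (use xs ys e l K in \<open>auto simp: simple_def\<close>)
  then show ?thesis using xs ys by (simp add: mult_2)
qed

text \<open>Without two disjoint edges between the sides, all edges form a star. If an end
  \<open>a\<close> of an edge is not its centre, the other end \<open>b\<close> is; if there are no
  edges, any vertex of \<open>A\<close> serves.\<close>

lemma star_center:
  assumes "A \<noteq> {}" and no0: "\<forall>a\<in>A. \<forall>b\<in>B. \<forall>a'\<in>A. \<forall>b'\<in>B. a \<noteq> a' \<longrightarrow> b \<noteq> b' \<longrightarrow> K a b \<longrightarrow> \<not> K a' b'"
  obtains s where "s \<in> A \<union> B" "\<forall>a\<in>A - {s}. \<forall>b\<in>B - {s}. \<not> K a b"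
proof (cases "\<exists>a\<in>A. \<exists>b\<in>B. K a b")
  case False
  then show ?thesis using that assms(1) by blast
next
  case True
  note no = no0[rule_format]
  obtain a b where ab: "a \<in> A" "b \<in> B" "K a b" using True by blast
  show ?thesis
  proof (cases "\<forall>a'\<in>A - {a}. \<forall>b'\<in>B - {a}. \<not> K a' b'")
    case True then show ?thesis using that ab by blast
  next
    case False
    then obtain a' b' where a': "a' \<in> A" "a' \<noteq> a" "b' \<in> B" "K a' b'" by blast
    then have "b' = b" using no[OF ab(1,2) a'(1,3)] ab by blast
    have "\<forall>c\<in>A - {b}. \<forall>d\<in>B - {b}. \<not> K c d"
    proof (intro ballI notI)
      fix c d assume cd: "c \<in> A - {b}" "d \<in> B - {b}" "K c d"
      then have "c = a" using no[OF ab(1,2), of c d] ab by blast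
      then show False using no[OF a'(1) ab(2), of c d] a' \<open>b' = b\<close> cd by blast
    qed
    then show ?thesis using that ab by blast
  qed
qed

text \<open>Without the star centre \<open>s\<close>, the rest \<open>A0\<close> of one clique is
  completely joined to the other clique in \<open>opp K\<close>. A vertex with
  \<open>opp K\<close>-neighbours in both would close an alternating path on \<open>2k\<close>
  vertices, so each vertex attaches by \<open>K\<close> to \<open>A0\<close> or to \<open>B\<close>.
  The core \<open>A0\<close> may have only \<open>k\<close> members, but \<open>P\<close> still
  contains \<open>s\<close>.\<close>

lemma two_links:
  assumes E: "simple E" and X: "finite X" "3 * k + 1 \<le> card X" "6 \<le> k"
    and no: "\<not> cyc E X (2 * k + 1)" "\<not> cyc (opp E) X (2 * k + 1)"
  obtains K P Q A B where "K = E \<or> K = opp E" "X = P \<union> Q" "P \<inter> Q = {}" "linked K k P A" "linked K (k + 1) Q B" "k + 1 \<le> card P"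
proof -
  obtain K A1 B1 where KAB: "K = E \<or> K = opp E" "A1 \<subseteq> X" "B1 \<subseteq> X" "A1 \<inter> B1 = {}" "k + 1 \<le> card A1" "k + 1 \<le> card B1"
    "clique K A1" "clique K B1" using two_cliques[OF E X no] by blast
  have K: "simple K" using KAB(1) E simple_opp by blast
  have noK: "\<not> cyc K X (2 * k + 1)" "\<not> cyc (opp K) X (2 * k + 1)" using KAB(1) no opp_opp[OF E] by auto
  have fin: "finite A1" "finite B1" using finite_subset[OF KAB(2) X(1)] finite_subset[OF KAB(3) X(1)] by simp_all
  have st: False if "a \<in> A1" "b \<in> B1" "a' \<in> A1" "b' \<in> B1" "a \<noteq> a'" "b \<noteq> b'" "K a b" "K a' b'" for a b a' b'
  proof -
    have "cyc K (A1 \<union> B1) (2 * k + 1)"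
      by (rule no_two_links[OF K linked_clique[OF fin(1) KAB(7)] linked_clique[OF fin(2) KAB(8)] KAB(4) _ that(1,3,5,2,4,6,7,8)])
        (use KAB X in auto)
    then show False using noK(1) cyc_mono KAB(2,3) by blast
  qed
  have "A1 \<noteq> {}" using KAB(5) by auto
  obtain s where s: "s \<in> A1 \<union> B1" "\<forall>a\<in>A1 - {s}. \<forall>b\<in>B1 - {s}. \<not> K a b"
    by (rule star_center[OF \<open>A1 \<noteq> {}\<close>, of B1 K]) (use st in blast)+
  \<comment> \<open>Up to exchanging the two cliques the centre lies in \<open>A\<close>.\<close>
  have "\<exists>A B. A \<subseteq> X \<and> B \<subseteq> X \<and> A \<inter> B = {} \<and> k + 1 \<le> card A \<and> k + 1 \<le> card B \<and> clique K A \<and> clique K B \<and>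
      s \<in> A \<and> (\<forall>a\<in>A - {s}. \<forall>b\<in>B. \<not> K a b)"
  proof (cases "s \<in> A1")
    case True
    have "\<forall>a\<in>A1 - {s}. \<forall>b\<in>B1. \<not> K a b" using s(2) True KAB(4) by auto
    then show ?thesis using True KAB(2-8) by (intro exI[of _ A1] exI[of _ B1]) simp
  next
    case False
    then have sB: "s \<in> B1" using s(1) by simp
    have "\<forall>a\<in>B1 - {s}. \<forall>b\<in>A1. \<not> K a b"
    proof (intro ballI notI)
      fix a b assume ab: "a \<in> B1 - {s}" "b \<in> A1" "K a b"
      then have "K b a" "b \<in> A1 - {s}" using K False by (auto simp: simple_def)
      then show False using s(2) ab(1) by simp
    qed
    then show ?thesis using sB KAB(2-8) by (intro exI[of _ B1] exI[of _ A1]) (simp add: Int_commute)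
  qed
  then obtain A B where AB: "A \<subseteq> X" "B \<subseteq> X" "A \<inter> B = {}" "k + 1 \<le> card A" "k + 1 \<le> card B" "clique K A" "clique K B"
    "s \<in> A" "\<forall>a\<in>A - {s}. \<forall>b\<in>B. \<not> K a b" by blast
  define A0 where "A0 = A - {s}"
  have finAB: "finite A0" "finite B" using finite_subset[OF AB(1) X(1)] finite_subset[OF AB(2) X(1)]
    by (simp_all add: A0_def)
  have cA0: "k \<le> card A0" using AB(4,8) finAB(1) unfolding A0_def by (simp add: card_Diff_singleton)
  have cm: "joined (opp K) A0 B" using AB(3,9) by (auto simp: joined_def A0_def opp_def)
  have attach: "(\<forall>a\<in>A0. K x a) \<or> (\<forall>b\<in>B. K x b)" if x: "x \<in> X" "x \<notin> A0" "x \<notin> B" for x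
  proof (rule ccontr)
    assume "\<not> ?thesis"
    then obtain a b where ab: "a \<in> A0" "b \<in> B" "opp K x a" "opp K x b" using x by (auto simp: opp_def)
    obtain xs where xs: "distinct xs" "successively (opp K) xs" "length xs = 2 * k" "set xs \<subseteq> A0 \<union> B"
      "hd xs = a" "last xs = b" "xs \<noteq> []"
      by (rule bip_path[OF simple_opp[OF K] cm finAB ab(1,2), of k]) (use cA0 AB(5) X in auto)
    have "cyc (opp K) X (2 * k + 1)"
      by (rule cycI[of "x # xs"])
        (use xs ab x AB(1,2) X simple_sym[OF simple_opp[OF K]] in \<open>auto simp: successively_Cons A0_def\<close>)
    then show False using noK by blast
  qed
  define P where "P = {x \<in> X - B. \<forall>a\<in>A0. x \<noteq> a \<longrightarrow> K x a}"
  define Q where "Q = X - P"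
  have AP: "A \<subseteq> P" using AB(1,3,6) unfolding P_def A0_def clique_def by blast
  have "linked K k P A0" using AP cA0 X(1) by (auto simp: linked_def P_def A0_def)
  moreover have "linked K (k + 1) Q B" unfolding linked_def
  proof (intro conjI ballI impI)
    show "finite Q" using X by (simp add: Q_def)
    show "B \<subseteq> Q" using AB(2) by (auto simp: Q_def P_def)
    fix x b assume x: "x \<in> Q" "b \<in> B" "x \<noteq> b"
    show "K x b"
    proof (cases "x \<in> B")
      case True then show ?thesis using x AB(7) by (auto simp: clique_def)
    next
      case False
      then have "x \<in> X" "x \<notin> P" "x \<notin> A0" using x(1) AP by (auto simp: Q_def A0_def)
      moreover obtain a where "a \<in> A0" "\<not> K x a" using \<open>x \<in> X\<close> \<open>x \<notin> P\<close> False by (auto simp: P_def)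
      ultimately show ?thesis using attach[of x] False x(2) by blast
    qed
  qed (rule AB(5))
  moreover have "k + 1 \<le> card P" using card_mono[OF _ AP] AB(4) X(1) by (force simp: P_def)
  ultimately show ?thesis using that[OF KAB(1), of P Q A0 B] by (auto simp: Q_def P_def)
qed

text \<open>An \<open>opp K\<close>-edge inside a part that keeps \<open>k + 1\<close> vertices
  would give an odd \<open>opp K\<close>-cycle together with \<open>k\<close> vertices of the other
  part. A part that keeps fewer had exactly \<open>k + 1\<close>, so its core misses at most one
  vertex and the whole part is a clique. The last two conclusions serve where another vertex than
  \<open>s\<close> gets removed.\<close>

lemma split_links:
  assumes K: "simple K" and PQ: "P \<inter> Q = {}" "linked K k P A" "linked K (k + 1) Q B" "k + 1 \<le> card P" "3 \<le> k"
    and no: "\<not> cyc K (P \<union> Q) (2 * k + 1)" "\<not> cyc (opp K) (P \<union> Q) (2 * k + 1)"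
  obtains s where "s \<in> P \<union> Q" "joined (opp K) (P - {s}) (Q - {s})" "clique K (P - {s})" "clique K (Q - {s})"
    "card P = k + 1 \<longrightarrow> clique K P" "card Q = k + 1 \<longrightarrow> clique K Q"
proof -
  have fin: "finite P" "finite Q" using PQ by (auto simp: linked_def)
  have BQ: "B \<subseteq> Q" "k + 1 \<le> card B" using PQ(3) by (auto simp: linked_def)
  have cQ: "k + 1 \<le> card Q" using card_mono[OF fin(2) BQ(1)] BQ(2) by linarith
  have P0: "P \<noteq> {}" using PQ(4) by auto
  have st: False if "a \<in> P" "b \<in> Q" "a' \<in> P" "b' \<in> Q" "a \<noteq> a'" "b \<noteq> b'" "K a b" "K a' b'" for a b a' b'
    using no_two_links[OF K PQ(2,3,1,5) that(1,3,5,2,4,6,7,8)] no(1) by blast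
  obtain s where s: "s \<in> P \<union> Q" "\<forall>a\<in>P - {s}. \<forall>b\<in>Q - {s}. \<not> K a b"
    by (rule star_center[OF P0, of Q K]) (use st in blast)+
  have cm: "joined (opp K) (P - {s}) (Q - {s})" using s(2) PQ(1) by (auto simp: joined_def opp_def)
  then have cm': "joined (opp K) (Q - {s}) (P - {s})" using joined_sym[OF simple_opp[OF K]] by blast
  have small: "clique K R" if "linked K k R D" "card R = k + 1" for R D
    unfolding clique_def
  proof (intro ballI impI)
    fix x y assume xy: "x \<in> R" "y \<in> R" "x \<noteq> y"
    have "x \<in> D \<or> y \<in> D"
    proof (rule ccontr)
      assume "\<not> ?thesis"
      then have "insert x (insert y D) \<subseteq> R" "x \<notin> D" "y \<notin> D" "finite D" using that xy finite_subset by (auto simp: linked_def)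
      then have "card (insert x (insert y D)) \<le> card R" using that by (intro card_mono) (auto simp: linked_def)
      then show False using \<open>x \<notin> D\<close> \<open>y \<notin> D\<close> \<open>finite D\<close> xy that by (simp add: linked_def)
    qed
    then show "K x y" using that xy K by (auto simp: linked_def simple_def)
  qed
  have smP: "card P = k + 1 \<longrightarrow> clique K P" using small[OF PQ(2)] by simp
  have smQ: "card Q = k + 1 \<longrightarrow> clique K Q" using small[OF linked_less[OF PQ(3), of k]] by simp
  have cs: "card (P - {s}) \<ge> card P - 1" "card (Q - {s}) \<ge> card Q - 1"
    by (simp_all add: card_Diff_singleton_if fin)
  have big: "clique K R" if R: "joined (opp K) R' R" "finite R" "finite R'" "k \<le> card R'" "k + 1 \<le> card R" "R \<union> R' \<subseteq> P \<union> Q" for R R'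
    unfolding clique_def
  proof (intro ballI impI, rule ccontr)
    fix x y assume xy: "x \<in> R" "y \<in> R" "x \<noteq> y" "\<not> K x y"
    then have "cyc (opp K) (R' \<union> R) (2 * k + 1)"
      by (intro bip_odd_cycle[OF simple_opp[OF K] R(1,3,2) xy(1,2)]) (use R PQ(5) in \<open>auto simp: opp_def\<close>)
    then show False using no(2) cyc_mono R(6) by (metis Un_commute)
  qed
  have "clique K (P - {s})"
  proof (cases "k + 1 \<le> card (P - {s})")
    case True
    then show ?thesis using cm' fin cs cQ by (intro big[of "Q - {s}"]) auto
  next
    case False
    then have "card P = k + 1" using cs PQ(4) by linarith
    then show ?thesis using smP by (auto simp: clique_def)
  qed
  moreover have "clique K (Q - {s})"
  proof (cases "k + 1 \<le> card (Q - {s})")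
    case True
    then show ?thesis using cm fin cs PQ(4) by (intro big[of "P - {s}"]) auto
  next
    case False
    then have "card Q = k + 1" using cs cQ by linarith
    then show ?thesis using smQ by (auto simp: clique_def)
  qed
  ultimately show ?thesis using that s(1) cm smP smQ by blast
qed

section \<open>Lengthening a red odd cycle by two under a degree condition\<close>

lemma pick_outside:
  assumes "finite T" "card T < card L"
  obtains u where "u \<in> L" "u \<notin> T"
  using assms by (metis card_mono not_less subsetI)

text \<open>The outside path replaces the \<open>length ps - 2\<close> inner vertices of an arc, so
  the gain is two for every length of the path.\<close>

lemma cyc_detour:
  assumes f: "cycmap E n f" and fV: "range f \<subseteq> V"
    and ps: "distinct ps" "successively E ps" "set ps \<subseteq> V - range f" "2 \<le> length ps" "length ps \<le> n"
    and e: "E (f a) (hd ps)" "E (last ps) (f (a + int (length ps) - 1))" "simple E"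
  shows "cyc E V (n + 2)"
proof -
  let ?q = "map f [a + int (length ps) - 1..a + int n]"
  have le: "a + int (length ps) - 1 \<le> a + int n" using ps(5) by simp
  have p2: "2 \<le> int (length ps)" using ps(4) by simp
  have "length ?q = n + 2 - length ps" using ps(4,5) by simp
  then have len: "length ps + length ?q = n + 2" using ps(5) by simp
  have "cyc E V (length ps + length ?q)"
  proof (rule glue)
    show "distinct ps" "successively E ps" by (rule ps)+
    show "ps \<noteq> []" using ps(4) by auto
    show "?q \<noteq> []" by (rule arc_ne[OF le])
    show "distinct ?q" by (rule arc_distinct[OF f]) (use ps(5) p2 in simp)
    show "successively E ?q" by (rule cycmap_arc[OF f])
    show "set ps \<inter> set ?q = {}" using ps(3) by auto
    show "E (last ps) (hd ?q)" using e(2) arc_hd[OF le, of f] by simp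
    show "E (last ?q) (hd ps)" using e(1) arc_last[OF le, of f] cycmap_per[OF f, of a] by simp
    show "set ps \<subseteq> V" "set ?q \<subseteq> V" using ps(3) fV by auto
    show "3 \<le> length ps + length ?q" using len f by (simp add: cycmap_def)
  qed
  then show ?thesis using len by simp
qed

text \<open>If no longer cycle exists, all outside vertices but one have at most
  \<open>j + 1\<close> neighbours on the cycle, so outside neighbours \<open>u1\<close> to
  \<open>u5\<close> of five consecutive cycle vertices have at least \<open>d - j - 1\<close>
  neighbours in \<open>W\<close>. Forbidden detours make such neighbourhoods disjoint, and three of
  them are too large for \<open>W\<close>; this count dictates
  \<open>card V + k + 3 <= 3 * d\<close>.\<close>

lemma growth_step:
  assumes E: "simple E" and V: "finite V" and cy: "cyc E V (2 * j + 1)" and j: "2 \<le> j" "j + 1 \<le> k"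
    and deg: "\<And>x. x \<in> V \<Longrightarrow> d \<le> card {y \<in> V. E x y}" and d: "2 * k + 2 \<le> d" "card V + k + 3 \<le> 3 * d"
  shows "cyc E V (2 * j + 3)"
proof (rule ccontr)
  assume no: "\<not> ?thesis"
  define n where "n = 2 * j + 1"
  have nn: "n + 2 = 2 * j + 3" by (simp add: n_def)
  obtain f where f: "cycmap E n f" "range f \<subseteq> V" "card (range f) = n" "range f = f ` {0..<int n}"
    using cyc_cycmap[OF cy] unfolding n_def by blast
  let ?C = "range f"
  define W where "W = V - ?C"
  have finC: "finite ?C" by (rule finite_subset[OF f(2) V])
  have finW: "finite W" using V by (simp add: W_def)
  have cW: "card W = card V - n" "n \<le> card V" unfolding W_def
    using card_Diff_subset[OF finC f(2)] f(3) card_mono[OF V f(2)] by simp_all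
  define D where "D u = {w \<in> W. E u w}" for u
  define c where "c u = card {y \<in> ?C. E u y}" for u
  have finD: "finite (D u)" for u using finW by (simp add: D_def)
  have DW: "D u \<subseteq> W" for u by (auto simp: D_def)
  have Dc: "d \<le> card (D u) + c u" if "u \<in> V" for u
  proof -
    have "{y \<in> V. E u y} = D u \<union> {y \<in> ?C. E u y}" using f(2) by (auto simp: D_def W_def)
    then have "card {y \<in> V. E u y} \<le> card (D u) + c u" unfolding c_def by (metis card_Un_le)
    then show ?thesis using deg[OF that] by linarith
  qed
  have n5: "5 \<le> n" using j by (simp add: n_def)
  have detour: False if "distinct ps" "successively E ps" "set ps \<subseteq> W" "2 \<le> length ps" "length ps \<le> 4"
    "E (f a) (hd ps)" "E (last ps) (f (a + int (length ps) - 1))" for ps a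
    using cyc_detour[OF f(1,2) that(1,2) _ that(4) _ that(6,7) E] that(3,5) no n5 unfolding W_def nn by simp
  define I where "I w = {i \<in> {0..<int n}. E w (f i) \<and> E w (f (i + 1))}" for w
  \<comment> \<open>Two outside vertices that fit into different gaps lengthen the cycle by
    two.\<close>
  have insert: False if w: "w \<in> W" "w' \<in> W" "w \<noteq> w'" and i: "i \<in> I w" "i' \<in> I w'" "i < i'" for w w' i i'
  proof -
    let ?a = "map f [i + 1..i']" and ?b = "map f [i' + 1..i + int n]"
    have le: "i + 1 \<le> i'" "i' + 1 \<le> i + int n" using i by (auto simp: I_def)
    have ends: "hd ?a = f (i + 1)" "last ?a = f i'" "hd ?b = f (i' + 1)" "last ?b = f i" "?a \<noteq> []" "?b \<noteq> []"
      using arc_hd[OF le(1), of f] arc_last[OF le(1), of f] arc_hd[OF le(2), of f] arc_last[OF le(2), of f]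
        arc_ne[OF le(1), of f] arc_ne[OF le(2), of f] cycmap_per[OF f(1), of i] by simp_all
    have ad: "E w (f (i + 1))" "E (f i') w'" "E w' (f (i' + 1))" "E (f i) w"
      using i E by (auto simp: I_def simple_def)
    have "cyc E V (length (w # ?a) + length (w' # ?b))"
    proof (rule glue)
      have da: "distinct ?a" by (rule arc_distinct[OF f(1)]) (use le in simp)
      have db: "distinct ?b" by (rule arc_distinct[OF f(1)]) (use le in simp)
      have dd: "set ?a \<inter> set ?b = {}" unfolding set_map set_upto
        by (rule arc_disj[OF f(1)]) (use le in simp_all)
      have sub: "set ?a \<subseteq> ?C" "set ?b \<subseteq> ?C" by auto
      show "distinct (w # ?a)" "distinct (w' # ?b)" using da db sub w by (auto simp: W_def)
      show "set (w # ?a) \<inter> set (w' # ?b) = {}" using dd sub w unfolding W_def by auto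
      show "successively E (w # ?a)" "successively E (w' # ?b)"
        using cycmap_arc[OF f(1), of "i + 1" i'] cycmap_arc[OF f(1), of "i' + 1" "i + int n"] ends ad
        by (simp_all add: successively_Cons)
      show "E (last (w # ?a)) (hd (w' # ?b))" "E (last (w' # ?b)) (hd (w # ?a))" using ends ad by simp_all
      show "set (w # ?a) \<subseteq> V" "set (w' # ?b) \<subseteq> V" using w f(2) by (auto simp: W_def)
      show "3 \<le> length (w # ?a) + length (w' # ?b)" using le by simp
    qed simp_all
    moreover have "length (w # ?a) + length (w' # ?b) = n + 2" using le by simp
    ultimately have "cyc E V (n + 2)" by (simp only:)
    then show False using no unfolding nn by blast
  qed
  have card_I: "2 * c w \<le> card (I w) + n" for w
  proof -
    let ?S = "{i \<in> {0..<int n}. E w (f i)}" and ?T = "{i \<in> {0..<int n}. E w (f (i + 1))}"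
    have inj: "inj_on f {0..<int n}" "inj_on (\<lambda>i. f (i + 1)) {0..<int n}"
      by (rule linorder_inj_onI; use cycmap_neq[OF f(1)] in auto)+
    have im: "(\<lambda>i. f (i + 1)) ` {0..<int n} = ?C"
    proof (rule card_subset_eq[OF finC])
      show "card ((\<lambda>i. f (i + 1)) ` {0..<int n}) = card ?C" using card_image[OF inj(2)] f(3) by simp
    qed auto
    have "f ` ?S = {y \<in> ?C. E w y}" using f(4) by auto
    moreover have "card (f ` ?S) = card ?S" by (rule card_image) (rule inj_on_subset[OF inj(1)], auto)
    ultimately have cS: "card ?S = c w" unfolding c_def by simp
    have "(\<lambda>i. f (i + 1)) ` ?T = {y \<in> ?C. E w y}"
    proof (intro equalityI subsetI)
      fix y assume y: "y \<in> {y \<in> ?C. E w y}"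
      then have "y \<in> (\<lambda>i. f (i + 1)) ` {0..<int n}" using im by blast
      then show "y \<in> (\<lambda>i. f (i + 1)) ` ?T" using y by auto
    qed auto
    moreover have "card ((\<lambda>i. f (i + 1)) ` ?T) = card ?T" by (rule card_image) (rule inj_on_subset[OF inj(2)], auto)
    ultimately have cT: "card ?T = c w" unfolding c_def by simp
    have finST: "finite ?S" "finite ?T" by (rule finite_subset[of _ "{0..<int n}"]; auto)+
    have "card ?S + card ?T = card (?S \<union> ?T) + card (?S \<inter> ?T)" by (rule card_Un_Int[OF finST])
    moreover have "card (?S \<union> ?T) \<le> card {0..<int n}" by (rule card_mono) auto
    moreover have "?S \<inter> ?T = I w" by (auto simp: I_def)
    ultimately show ?thesis using cS cT by simp
  qed
  \<comment> \<open>As \<open>n = 2 * j + 1\<close>, a vertex with more than \<open>j + 1\<close>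
    neighbours on the cycle fits into at least two gaps; two such vertices could use different
    ones.\<close>
  have "\<exists>w0. \<forall>w\<in>W. w \<noteq> w0 \<longrightarrow> c w \<le> j + 1"
  proof (rule ccontr)
    assume neg: "\<not> ?thesis"
    then obtain w where w: "w \<in> W" "\<not> c w \<le> j + 1" by blast
    obtain w' where w': "w' \<in> W" "w' \<noteq> w" "\<not> c w' \<le> j + 1" using neg by blast
    have I2: "2 \<le> card (I w)" "2 \<le> card (I w')" using card_I[of w] card_I[of w'] w(2) w'(3) n_def by linarith+
    then obtain i where i: "i \<in> I w" by (metis card.empty ex_in_conv not_numeral_le_zero)
    obtain i' where i': "i' \<in> I w'" "i' \<notin> {i}" by (rule pick_outside[of "{i}" "I w'"]) (use I2 in auto)
    show False using insert[OF w(1) w'(1) w'(2)[symmetric] i i'(1)] insert[OF w'(1) w(1) w'(2) i'(1) i] i'(2)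
      by (cases "i < i'") auto
  qed
  then obtain w0 where w0: "\<And>w. w \<in> W \<Longrightarrow> w \<noteq> w0 \<Longrightarrow> c w \<le> j + 1" by blast
  define L where "L i = D (f i)" for i
  \<comment> \<open>At most \<open>2j <= 2k - 2\<close> neighbours on the cycle stand against
    \<open>d >= 2k + 2\<close>. Four candidates suffice, as each choice below avoids at most three
    vertices.\<close>
  have cL: "4 \<le> card (L i)" for i
  proof -
    have "{y \<in> ?C. E (f i) y} \<subseteq> ?C - {f i}" using simple_irr[OF E] by auto
    then have "c (f i) \<le> card (?C - {f i})" unfolding c_def using finC by (intro card_mono) auto
    also have "\<dots> = 2 * j" using f(3) finC by (simp add: n_def)
    finally show ?thesis using Dc[of "f i"] f(2) d(1) j unfolding L_def by fastforce
  qed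
  have Ldef: "u \<in> W \<and> E (f i) u \<and> E u (f i)" if "u \<in> L i" for u i
    using that E by (auto simp: L_def D_def simple_def)
  \<comment> \<open>Only the inequalities used by the detours are enforced; \<open>u1 = u5\<close>
    is allowed.\<close>
  obtain u1 where u1: "u1 \<in> L 1" "u1 \<notin> {w0}" by (rule pick_outside[of "{w0}" "L 1"]) (use cL[of 1] in auto)
  obtain u3 where u3: "u3 \<in> L 3" "u3 \<notin> {w0, u1}"
    by (rule pick_outside[of "{w0, u1}" "L 3"]) (use cL[of 3] in \<open>auto simp: card_insert_if\<close>)
  obtain u5 where u5: "u5 \<in> L 5" "u5 \<notin> {w0, u3}"
    by (rule pick_outside[of "{w0, u3}" "L 5"]) (use cL[of 5] in \<open>auto simp: card_insert_if\<close>)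
  obtain u2 where u2: "u2 \<in> L 2" "u2 \<notin> {w0, u5}"
    by (rule pick_outside[of "{w0, u5}" "L 2"]) (use cL[of 2] in \<open>auto simp: card_insert_if\<close>)
  obtain u4 where u4: "u4 \<in> L 4" "u4 \<notin> {w0, u1, u2}"
    by (rule pick_outside[of "{w0, u1, u2}" "L 4"]) (use cL[of 4] in \<open>auto simp: card_insert_if\<close>)
  note U = Ldef[OF u1(1)] Ldef[OF u2(1)] Ldef[OF u3(1)] Ldef[OF u4(1)] Ldef[OF u5(1)]
  have d2: False if "E u v" "u \<in> L i" "v \<in> L (i + 1)" for u v i
    by (rule detour[of "[u, v]" i]) (use that Ldef[OF that(2)] Ldef[OF that(3)] simple_neq[OF E that(1)] in \<open>auto simp: ac_simps\<close>)
  have d3: "D u \<inter> D v = {}" if "u \<noteq> v" "u \<in> L i" "v \<in> L (i + 2)" for u v i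
  proof (rule ccontr)
    assume "\<not> ?thesis"
    then obtain w where w: "w \<in> W" "E u w" "E v w" by (auto simp: D_def)
    have "u \<noteq> w" "v \<noteq> w" "E w v" using w simple_irr[OF E] E by (auto simp: simple_def)
    then show False
      by (intro detour[of "[u, w, v]" i]) (use that w Ldef[OF that(2)] Ldef[OF that(3)] in \<open>auto simp: ac_simps\<close>)
  qed
  have d4: False if "E u a" "E a b" "E b v" "distinct [u, a, b, v]" "a \<in> W" "b \<in> W" "u \<in> L i" "v \<in> L (i + 3)" for u a b v i
    by (rule detour[of "[u, a, b, v]" i]) (use that Ldef[OF that(7)] Ldef[OF that(8)] in \<open>auto simp: ac_simps\<close>)
  have cu: "c u1 \<le> j + 1" "c u2 \<le> j + 1" "c u3 \<le> j + 1" "c u4 \<le> j + 1" "c u5 \<le> j + 1"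
    using U w0 u1 u2 u3 u4 u5 by auto
  have WV: "\<And>w. w \<in> W \<Longrightarrow> w \<in> V" by (simp add: W_def)
  have D13: "D u1 \<inter> D u3 = {}" by (rule d3[of _ _ 1]) (use u1 u3 in auto)
  have D35: "D u3 \<inter> D u5 = {}" by (rule d3[of _ _ 3]) (use u3 u5 in auto)
  have D24: "D u2 \<inter> D u4 = {}" by (rule d3[of _ _ 2]) (use u2 u4 in auto)
  \<comment> \<open>\<open>D u3\<close> is disjoint from the other two, so comparing
    \<open>3 * (d - j - 1)\<close> with \<open>card W\<close> leaves an overlap of at least
    \<open>k - j + 1 >= 2\<close>, enough to avoid \<open>w0\<close>.\<close>
  have "2 \<le> card (D u1 \<inter> D u5)"
  proof -
    have "card (D u1) + card (D u5) = card (D u1 \<union> D u5) + card (D u1 \<inter> D u5)" by (rule card_Un_Int[OF finD finD])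
    moreover have "card ((D u1 \<union> D u5) \<union> D u3) = card (D u1 \<union> D u5) + card (D u3)"
      by (rule card_Un_disjoint) (use finD D13 D35 in auto)
    moreover have "card ((D u1 \<union> D u5) \<union> D u3) \<le> card W" by (rule card_mono[OF finW]) (use DW in auto)
    ultimately show ?thesis
      using Dc[OF WV, of u1] Dc[OF WV, of u3] Dc[OF WV, of u5] cu U d j cW n_def by linarith
  qed
  then obtain a where a: "a \<in> D u1 \<inter> D u5" "a \<notin> {w0}" using pick_outside[of "{w0}" "D u1 \<inter> D u5"] by auto
  have aW: "a \<in> W" "E u1 a" "E u5 a" "E a u1" "E a u5" using a E by (auto simp: D_def simple_def)
  have ca: "c a \<le> j + 1" using w0[OF aW(1)] a by simp
  have au: "a \<noteq> u1" "a \<noteq> u5" using aW simple_irr[OF E] by auto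
  have au2: "a \<noteq> u2" using d2[OF _ u1(1), of u2] u2(1) aW(2) by auto
  have au4: "a \<noteq> u4" using d2[OF _ u4(1), of u5] u5(1) aW(5) by auto
  \<comment> \<open>A neighbour \<open>b\<close> of \<open>a\<close> yields the outside paths
    \<open>u1, a, b, u4\<close> and \<open>u2, b, a, u5\<close>, each spanning three edges of the
    cycle. Removing \<open>u1\<close> and \<open>u5\<close> keeps their vertices distinct.\<close>
  define A where "A = D a - {u1, u5}"
  have cA: "card (D a) \<le> card A + 2"
  proof -
    have "card (D a) - card {u1, u5} \<le> card A" unfolding A_def by (rule diff_card_le_card_Diff) simp
    moreover have "card {u1, u5} \<le> 2" by (simp add: card_insert_if)
    ultimately show ?thesis by linarith
  qed
  have A4: "A \<inter> D u4 = {}"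
  proof (rule ccontr)
    assume "\<not> ?thesis"
    then obtain b where b: "b \<in> W" "E a b" "E u4 b" "b \<noteq> u1" by (auto simp: A_def D_def)
    have "b \<noteq> u4" "b \<noteq> a" "E b u4" using b simple_irr[OF E] E by (auto simp: simple_def)
    then show False
      by (intro d4[of u1 a b u4 1]) (use b aW au au4 u1 u4 in auto)
  qed
  have A2: "A \<inter> D u2 = {}"
  proof (rule ccontr)
    assume "\<not> ?thesis"
    then obtain b where b: "b \<in> W" "E a b" "E u2 b" "b \<noteq> u5" by (auto simp: A_def D_def)
    have "b \<noteq> u2" "b \<noteq> a" "E b a" using b simple_irr[OF E] E by (auto simp: simple_def)
    then show False
      by (intro d4[of u2 b a u5 2]) (use b aW au au2 u2 u5 in auto)
  qed
  \<comment> \<open>The vertex \<open>u3\<close>, which lies in none of the three disjoint sets, is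
    the one that tips the final count.\<close>
  have "u3 \<notin> D u2" using d2[of u2 u3 2] u2 u3 by (auto simp: D_def)
  moreover have "u3 \<notin> D u4" using d2[of u3 u4 3] u3 u4 E by (auto simp: D_def simple_def)
  moreover have "u3 \<notin> A"
  proof
    assume "u3 \<in> A"
    then have "a \<in> D u3" using aW(1) E by (auto simp: A_def D_def simple_def)
    then show False using a D13 by auto
  qed
  ultimately have "D u2 \<union> D u4 \<union> A \<subseteq> W - {u3}" using DW by (auto simp: A_def)
  then have "card (D u2 \<union> D u4 \<union> A) \<le> card (W - {u3})" by (rule card_mono[rotated]) (use finW in simp)
  also have "\<dots> = card W - 1" using U finW by simp
  finally have le: "card (D u2 \<union> D u4 \<union> A) \<le> card W - 1" .
  have "card (D u2 \<union> D u4 \<union> A) = card (D u2 \<union> D u4) + card A"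
    by (rule card_Un_disjoint) (use finD A2 A4 A_def in auto)
  moreover have "card (D u2 \<union> D u4) = card (D u2) + card (D u4)" by (rule card_Un_disjoint[OF finD finD D24])
  moreover have "card W \<noteq> 0" using U finW by auto
  ultimately show False using le cA Dc[OF WV, of u2] Dc[OF WV, of u4] Dc[OF WV[OF aW(1)]] cu ca U d j cW n_def
    by linarith
qed

text \<open>A triangle is too short for detours along five consecutive vertices. Here outside
  neighbours of the three corners have pairwise disjoint outside neighbourhoods, and
  \<open>3 * (d - 3) > card V - 3\<close>.\<close>

lemma growth_base:
  assumes E: "simple E" and V: "finite V" and cy: "cyc E V 3"
    and deg: "\<And>x. x \<in> V \<Longrightarrow> d \<le> card {y \<in> V. E x y}" and d: "6 \<le> d" "card V + 7 \<le> 3 * d"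
  shows "cyc E V 5"
proof (rule ccontr)
  assume no: "\<not> ?thesis"
  obtain x y z where xyz: "x \<in> V" "y \<in> V" "z \<in> V" "distinct [x, y, z]" "E x y" "E y z" "E z x"
    using cy unfolding cyc_def by (auto simp: numeral_eq_Suc length_Suc_conv)
  define W where "W = V - {x, y, z}"
  have finW: "finite W" using V by (simp add: W_def)
  have cW: "card W = card V - 3" "3 \<le> card V"
    using xyz V card_mono[of V "{x, y, z}"] by (simp_all add: W_def card_Diff_subset)
  define D where "D u = {w \<in> W. E u w}" for u
  have Dc: "d \<le> card (D u) + 3" if "u \<in> V" for u
  proof -
    have "{y \<in> V. E u y} \<subseteq> D u \<union> {x, y, z}" by (auto simp: D_def W_def)
    then have "card {y \<in> V. E u y} \<le> card (D u \<union> {x, y, z})" by (rule card_mono[rotated]) (use finW D_def in auto)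
    also have "\<dots> \<le> card (D u) + card {x, y, z}" by (rule card_Un_le)
    finally show ?thesis using deg[OF that] xyz by simp
  qed
  have DW: "\<And>u w. w \<in> D u \<Longrightarrow> w \<in> W \<and> E u w \<and> E w u" using E by (auto simp: D_def simple_def)
  have rule: "D u \<inter> D v = {}" if "u \<in> D p" "v \<in> D q" "u \<noteq> v" "E q p" "p \<in> {x, y, z}" "q \<in> {x, y, z}" for u v p q
  proof (rule ccontr)
    assume "\<not> ?thesis"
    then obtain w where w: "w \<in> D u" "w \<in> D v" by blast
    have "cyc E V 5"
    proof (rule cycI[of "[p, u, w, v, q]"])
      show "distinct [p, u, w, v, q]"
        using DW[OF w(1)] DW[OF w(2)] DW[OF that(1)] DW[OF that(2)] that(3-6) simple_irr[OF E] by (auto simp: W_def)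
      show "set [p, u, w, v, q] \<subseteq> V"
        using DW[OF w(1)] DW[OF that(1)] DW[OF that(2)] that xyz by (auto simp: W_def)
      show "successively E [p, u, w, v, q]" "E (last [p, u, w, v, q]) (hd [p, u, w, v, q])"
        using DW[OF w(1)] DW[OF w(2)] DW[OF that(1)] DW[OF that(2)] that by auto
    qed simp_all
    then show False using no by blast
  qed
  have c3: "3 \<le> card (D x)" "3 \<le> card (D y)" "3 \<le> card (D z)"
    using Dc xyz d by (metis add_le_cancel_right le_trans numeral_Bit0 numeral_plus_numeral semiring_norm(2) semiring_norm(5) numeral_One add_numeral_left)+
  obtain u where u: "u \<in> D x" using c3 by (metis card.empty ex_in_conv not_numeral_le_zero)
  obtain v where v: "v \<in> D y" "v \<notin> {u}" by (rule pick_outside[of "{u}" "D y"]) (use c3 in auto)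
  obtain w where w: "w \<in> D z" "w \<notin> {u, v}"
    by (rule pick_outside[of "{u, v}" "D z"]) (use c3 in \<open>auto simp: card_insert_if\<close>)
  have sub: "u \<in> V" "v \<in> V" "w \<in> V" using DW[OF u] DW[OF v(1)] DW[OF w(1)] by (auto simp: W_def)
  have "E y x" using xyz E by (auto simp: simple_def)
  then have 1: "D u \<inter> D v = {}" using rule[OF u v(1)] v by auto
  have 2: "D u \<inter> D w = {}" using rule[OF u w(1)] w xyz by auto
  have "E z y" using xyz E by (auto simp: simple_def)
  then have 3: "D v \<inter> D w = {}" using rule[OF v(1) w(1)] w by auto
  have finD: "finite (D u)" for u using finW by (simp add: D_def)
  have "card (D u \<union> D v \<union> D w) = card (D u) + card (D v) + card (D w)"
    using 1 2 3 finD by (subst card_Un_disjoint; (subst card_Un_disjoint)?) auto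
  moreover have "card (D u \<union> D v \<union> D w) \<le> card W" by (rule card_mono[OF finW]) (auto simp: D_def)
  ultimately show False using Dc[OF sub(1)] Dc[OF sub(2)] Dc[OF sub(3)] cW d by linarith
qed

lemma growth:
  assumes E: "simple E" and V: "finite V" and cy: "cyc E V 3" and k: "4 \<le> k"
    and deg: "\<And>x. x \<in> V \<Longrightarrow> d \<le> card {y \<in> V. E x y}" and d: "2 * k + 2 \<le> d" "card V + k + 3 \<le> 3 * d"
  shows "cyc E V (2 * k + 1)"
proof -
  have "cyc E V (2 * j + 1)" if "2 \<le> j" "j \<le> k" for j
    using that
  proof (induction j rule: nat_induct_at_least)
    case base
    have "cyc E V 5" by (rule growth_base[OF E V cy deg]) (use d k in auto)
    then show ?case by simp
  next
    case (Suc j)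
    have "cyc E V (2 * j + 3)"
      by (rule growth_step[OF E V _ _ _ deg d]) (use Suc in auto)
    then show ?case by (simp add: numeral_eq_Suc)
  qed
  then show ?thesis using k by simp
qed

section \<open>Blue wheels, and the exclusion of blue cliques\<close>

text \<open>A wheel is a hub together with a cycle in its neighbourhood; in this form no graph
  copies occur before the final transfer.\<close>

definition wheel_free :: "('a \<Rightarrow> 'a \<Rightarrow> bool) \<Rightarrow> 'a set \<Rightarrow> nat \<Rightarrow> bool" where
  "wheel_free E V n \<longleftrightarrow> (\<forall>v\<in>V. \<not> cyc (opp E) {y \<in> V. opp E v y} n)"

lemma wheel_freeD: "wheel_free E V n \<Longrightarrow> v \<in> V \<Longrightarrow> Z \<subseteq> V \<Longrightarrow> (\<And>z. z \<in> Z \<Longrightarrow> opp E v z) \<Longrightarrow> \<not> cyc (opp E) Z n"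
  unfolding wheel_free_def using cyc_mono[of "opp E" Z n "{y \<in> V. opp E v y}"] by blast

lemma clique_cyc:
  assumes "clique K A" "finite A" "3 \<le> n" "n \<le> card A"
  shows "cyc K A n"
proof -
  obtain a where a: "a \<in> A" using assms by fastforce
  obtain xs where xs: "distinct xs" "length xs = n" "set xs \<subseteq> A" "hd xs = a" "xs \<noteq> []"
    by (rule list_hd[OF assms(2) a, of n]) (use assms in auto)
  have "last xs \<noteq> hd xs"
  proof
    assume eq: "last xs = hd xs"
    obtain y ys where l: "xs = y # ys" using xs(5) by (cases xs) auto
    then have "ys \<noteq> []" using xs(2) assms(3) by auto
    then show False using eq xs(1) l by auto
  qed
  then have "K (last xs) (hd xs)" using assms(1) xs(3,5) unfolding clique_def by (meson hd_in_set last_in_set subsetD)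
  then show ?thesis using cycI[OF xs(2) assms(3) xs(3,1) clique_succ[OF assms(1) xs(3,1)]] by blast
qed

text \<open>The threshold \<open>3 * k\<close> is the one for which
  \<open>d = card V - 1 - 3 * k\<close> meets both demands of \<open>growth\<close>; the second
  amounts to \<open>5 * k + 3 <= card V\<close>. The initial triangle exists because a red
  neighbourhood of \<open>2k + 2\<close> vertices without a red edge would contain a blue
  wheel.\<close>

lemma low_vertex:
  assumes E: "simple E" and V: "finite V" "5 * k + 3 \<le> card V" "6 \<le> k"
    and no: "\<not> cyc E V (2 * k + 1)" and wh: "wheel_free E V (2 * k + 1)"
  shows "\<exists>v\<in>V. 3 * k + 1 \<le> card {y \<in> V. opp E v y}"
proof (rule ccontr)
  assume "\<not> ?thesis"
  then have sm: "card {y \<in> V. opp E v y} \<le> 3 * k" if "v \<in> V" for v using that by (simp add: not_le less_Suc_eq_le)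
  define d where "d = card V - 1 - 3 * k"
  have deg: "d \<le> card {y \<in> V. E x y}" if "x \<in> V" for x
    using deg_opp[OF V(1) that E] sm[OF that] by (simp add: d_def)
  have dk: "2 * k + 2 \<le> d" "card V + k + 3 \<le> 3 * d" using V(2) by (simp_all add: d_def)
  have "V \<noteq> {}" using V by auto
  then obtain x where x: "x \<in> V" by blast
  define N where "N = {y \<in> V. E x y}"
  have cN: "2 * k + 2 \<le> card N" using deg[OF x] dk by (simp add: N_def)
  have finN: "finite N" using V by (simp add: N_def)
  have "cyc E V 3"
  proof (cases "\<exists>a\<in>N. \<exists>b\<in>N. E a b")
    case True
    then obtain a b where ab: "a \<in> N" "b \<in> N" "E a b" by blast
    then show ?thesis using x E
      by (intro cycI[of "[x, a, b]"]) (auto simp: N_def simple_def)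
  next
    case False
    have cl: "clique (opp E) N" using False by (auto simp: clique_def opp_def)
    obtain u where u: "u \<in> N" using cN by fastforce
    have "clique (opp E) (N - {u})" using cl by (auto simp: clique_def)
    then have "cyc (opp E) (N - {u}) (2 * k + 1)"
      by (rule clique_cyc) (use finN cN u V in auto)
    moreover have "\<not> cyc (opp E) (N - {u}) (2 * k + 1)"
      by (rule wheel_freeD[OF wh, of u]) (use u cl in \<open>auto simp: N_def clique_def\<close>)
    ultimately show ?thesis by blast
  qed
  then have "cyc E V (2 * k + 1)" by (rule growth[OF E V(1) _ _ deg dk]) (use V in auto)
  then show False using no by blast
qed

text \<open>Any \<open>q\<close> in \<open>Q\<close> is a hub over the rest of \<open>Q\<close> and
  \<open>F\<close>. No edge inside \<open>F\<close> is known to be blue, so a rim of length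
  \<open>2k + 1\<close> takes at most \<open>k\<close> vertices of \<open>F\<close>, separated by
  vertices of the clique.\<close>

lemma blue_clique_bound:
  assumes E: "simple E" and V: "finite V" and wh: "wheel_free E V (2 * k + 1)" and Q: "Q \<subseteq> V" "clique (opp E) Q"
    and F: "F \<subseteq> V" "F \<inter> Q = {}" "joined (opp E) Q F" and k: "1 \<le> k" "k + 2 \<le> card Q"
  shows "card Q + card F \<le> 2 * k + 1"
proof (rule ccontr)
  assume big: "\<not> ?thesis"
  let ?B = "opp E"
  have B: "simple ?B" by (rule simple_opp[OF E])
  have fin: "finite Q" "finite F" by (rule finite_subset[OF Q(1) V], rule finite_subset[OF F(1) V])
  obtain q where q: "q \<in> Q" using k by fastforce
  define Q' where "Q' = Q - {q}"
  have cQ': "card Q' = card Q - 1" "finite Q'" using q fin by (simp_all add: Q'_def)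
  define m where "m = min k (card F)"
  obtain T where T: "T \<subseteq> F" "card T = m" "finite T"
    by (rule obtain_subset_with_card_n[of m F]) (use m_def in auto)
  have "2 * k + 1 - m \<le> card Q'" using big k(2) cQ' by (simp add: m_def)
  then obtain S where S: "S \<subseteq> Q'" "card S = 2 * k + 1 - m" "finite S"
    by (rule obtain_subset_with_card_n) auto
  obtain ts where ts: "set ts = T" "distinct ts" using finite_distinct_list[OF T(3)] by blast
  obtain ss where ss: "set ss = S" "distinct ss" using finite_distinct_list[OF S(3)] by blast
  have len: "length ts = m" "length ss = 2 * k + 1 - m" "m \<le> k"
    using distinct_card[OF ts(2)] distinct_card[OF ss(2)] ts(1) ss(1) T(2) S(2) by (simp_all add: m_def)
  let ?s1 = "take m ss" and ?s2 = "drop m ss"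
  have l12: "length ?s1 = m" "length ?s2 = 2 * k + 1 - 2 * m" using len by auto
  have s2ne: "?s2 \<noteq> []" using l12(2) len(3) by auto
  have sd: "distinct ?s1" "distinct ?s2" "set ?s1 \<inter> set ?s2 = {}" "set ?s1 \<subseteq> S" "set ?s2 \<subseteq> S"
    using ss by (auto simp: set_take_disj_set_drop_if_distinct dest: in_set_takeD in_set_dropD)
  have clS: "clique ?B S" using Q(2) S(1) by (auto simp: clique_def Q'_def)
  have TS: "?B t s" "?B s t" "t \<noteq> s" if "t \<in> T" "s \<in> S" for t s
  proof -
    have ts: "t \<in> F" "s \<in> Q" using that T S by (auto simp: Q'_def)
    then show "?B s t" using F(3) by (auto simp: joined_def)
    then show "?B t s" using B by (auto simp: simple_def)
    show "t \<noteq> s" using ts F(2) by auto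
  qed
  have interleave: "length (interleave ts ?s1) = 2 * length ts \<and> set (interleave ts ?s1) = set ts \<union> set ?s1 \<and>
    distinct (interleave ts ?s1) \<and> successively ?B (interleave ts ?s1) \<and>
    (ts \<noteq> [] \<longrightarrow> hd (interleave ts ?s1) = hd ts \<and> last (interleave ts ?s1) = last ?s1)"
    by (rule interleave_props) (use l12 len B TS ts sd in auto)
  have suc2: "successively ?B ?s2" by (rule clique_succ[OF clS sd(5,2)])
  have "cyc ?B (Q' \<union> F) (2 * k + 1)"
  proof (cases "ts = []")
    case True
    then have "m = 0" using len by simp
    then show ?thesis
      by (intro cyc_mono[OF clique_cyc[OF clS S(3)]]) (use S k in auto)
  next
    case False
    have m1: "1 \<le> m" using False len by (cases ts) auto
    have s1ne: "?s1 \<noteq> []" using l12(1) m1 by (metis list.size(3) not_one_le_zero)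
    have ends: "hd ts \<in> T" "last ?s1 \<in> S" "hd ?s2 \<in> S" "last ?s2 \<in> S" "last ?s1 \<noteq> hd ?s2"
    proof -
      show "hd ts \<in> T" using False ts by auto
      show "last ?s1 \<in> S" "hd ?s2 \<in> S" "last ?s2 \<in> S"
        using last_in_set[OF s1ne] hd_in_set[OF s2ne] last_in_set[OF s2ne] sd(4,5) by blast+
      show "last ?s1 \<noteq> hd ?s2" using last_in_set[OF s1ne] hd_in_set[OF s2ne] sd(3) by (metis disjoint_iff)
    qed
    have "cyc ?B (Q' \<union> F) (length (interleave ts ?s1) + length ?s2)"
    proof (rule glue)
      show "distinct (interleave ts ?s1)" "successively ?B (interleave ts ?s1)" "distinct ?s2" "successively ?B ?s2"
        using interleave sd suc2 by auto
      show "set (interleave ts ?s1) \<inter> set ?s2 = {}" using interleave sd TS(3) ts by fastforce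
      show "interleave ts ?s1 \<noteq> []" using interleave m1 len by (metis list.size(3) mult_is_0 not_one_le_zero zero_neq_numeral)
      show "?s2 \<noteq> []" by (rule s2ne)
      show "?B (last (interleave ts ?s1)) (hd ?s2)" using interleave False ends clS by (auto simp: clique_def)
      show "?B (last ?s2) (hd (interleave ts ?s1))" using interleave False ends TS by auto
      show "3 \<le> length (interleave ts ?s1) + length ?s2" using interleave len l12 k m1 by simp
      show "set (interleave ts ?s1) \<subseteq> Q' \<union> F" "set ?s2 \<subseteq> Q' \<union> F" using interleave ts T S sd by auto
    qed
    moreover have "length (interleave ts ?s1) + length ?s2 = 2 * k + 1" using interleave len l12 by simp
    ultimately show ?thesis by (simp only:)
  qed
  moreover have "\<not> cyc ?B (Q' \<union> F) (2 * k + 1)"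
  proof (rule wheel_freeD[OF wh, of q])
    show "q \<in> V" "Q' \<union> F \<subseteq> V" using q Q F by (auto simp: Q'_def)
    fix z assume "z \<in> Q' \<union> F"
    then show "?B q z" using q Q(2) F(3) by (auto simp: Q'_def clique_def joined_def)
  qed
  ultimately show False by blast
qed

text \<open>If only \<open>k\<close> clique vertices remain beside the hub, the rim needs
  \<open>k + 1\<close> vertices of \<open>F\<close> and one blue edge among them. Such an edge
  exists, since \<open>2k + 1\<close> vertices of \<open>F\<close> cannot form a red clique.\<close>

lemma blue_clique_bound2:
  assumes E: "simple E" and V: "finite V" and wh: "wheel_free E V (2 * k + 1)" and Q: "Q \<subseteq> V" "clique (opp E) Q"
    and F: "F \<subseteq> V" "joined (opp E) Q F" and k: "1 \<le> k" "k + 1 \<le> card Q"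
    and no: "\<not> cyc E V (2 * k + 1)"
  shows "card F \<le> 2 * k"
proof (rule ccontr)
  assume big: "\<not> ?thesis"
  let ?B = "opp E"
  have B: "simple ?B" by (rule simple_opp[OF E])
  have fin: "finite Q" "finite F" by (rule finite_subset[OF Q(1) V], rule finite_subset[OF F(1) V])
  obtain q where q: "q \<in> Q" using k by fastforce
  have "\<not> clique E F"
  proof
    assume "clique E F"
    then have "cyc E F (2 * k + 1)" by (rule clique_cyc) (use fin big k in auto)
    then show False using no cyc_mono[OF _ F(1)] by blast
  qed
  then obtain f f' where f: "f \<in> F" "f' \<in> F" "f \<noteq> f'" "\<not> E f f'" by (auto simp: clique_def)
  have cm: "joined ?B (Q - {q}) F" using F(2) by (auto simp: joined_def)
  have "cyc ?B ((Q - {q}) \<union> F) (2 * k + 1)"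
    by (rule bip_odd_cycle[OF B cm _ fin(2) f(1,2)]) (use f fin k q big in \<open>auto simp: opp_def\<close>)
  moreover have "\<not> cyc ?B ((Q - {q}) \<union> F) (2 * k + 1)"
  proof (rule wheel_freeD[OF wh, of q])
    show "q \<in> V" "Q - {q} \<union> F \<subseteq> V" using q Q F by auto
    fix z assume "z \<in> Q - {q} \<union> F"
    then show "?B q z" using q Q(2) F(2) by (auto simp: clique_def joined_def)
  qed
  ultimately show False by blast
qed

text \<open>A vertex outside \<open>A \<union> B\<close> with a red neighbour on each side closes a red cycle, so every other
  vertex is blue to all of \<open>A\<close> or to all of \<open>B\<close>; blue wheels bound both groups.\<close>

lemma no_blue_cliques:
  assumes E: "simple E" and V: "finite V" "5 * k + 3 \<le> card V" "6 \<le> k"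
    and no: "\<not> cyc E V (2 * k + 1)" and wh: "wheel_free E V (2 * k + 1)"
    and A: "A \<subseteq> V" "clique (opp E) A" "k + 1 \<le> card A" and B: "B \<subseteq> V" "clique (opp E) B" "k + 1 \<le> card B"
    and AB: "joined E A B" "2 * k + 3 \<le> card A + card B"
  shows False
proof -
  have dis: "A \<inter> B = {}" by (rule joined_disj[OF E AB(1)])
  have fin: "finite A" "finite B" by (rule finite_subset[OF A(1) V(1)], rule finite_subset[OF B(1) V(1)])
  define FA where "FA = {w \<in> V - A - B. \<forall>a\<in>A. opp E a w}"
  define FB where "FB = {w \<in> V - A - B. \<forall>b\<in>B. opp E b w}"
  have "V \<subseteq> (A \<union> FA) \<union> (B \<union> FB)"
  proof (rule subsetI, rule ccontr)
    fix w assume w: "w \<in> V" "w \<notin> (A \<union> FA) \<union> (B \<union> FB)"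
    obtain a where a: "a \<in> A" "\<not> opp E a w" using w unfolding FA_def by blast
    obtain b where b: "b \<in> B" "\<not> opp E b w" using w unfolding FB_def by blast
    have e: "E w a" "E b w" using a b w E by (auto simp: opp_def simple_def)
    obtain xs where xs: "distinct xs" "successively E xs" "length xs = 2 * k" "set xs \<subseteq> A \<union> B"
      "hd xs = a" "last xs = b" "xs \<noteq> []"
      by (rule bip_path[OF E AB(1) fin a(1) b(1), of k]) (use A B V in auto)
    have "cyc E V (2 * k + 1)"
      by (rule cycI[of "w # xs"]) (use xs e w A B V in \<open>auto simp: successively_Cons\<close>)
    then show False using no by blast
  qed
  moreover have "finite ((A \<union> FA) \<union> (B \<union> FB))" using fin V by (simp add: FA_def FB_def)
  ultimately have "card V \<le> card ((A \<union> FA) \<union> (B \<union> FB))" by (rule card_mono[rotated])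
  also have "\<dots> \<le> card (A \<union> FA) + card (B \<union> FB)" by (rule card_Un_le)
  also have "\<dots> \<le> (card A + card FA) + (card B + card FB)" by (intro add_mono card_Un_le)
  finally have tot: "card V \<le> (card A + card FA) + (card B + card FB)" .
  have FA: "FA \<subseteq> V" "FA \<inter> A = {}" "joined (opp E) A FA" by (auto simp: FA_def joined_def)
  have FB: "FB \<subseteq> V" "FB \<inter> B = {}" "joined (opp E) B FB" by (auto simp: FB_def joined_def)
  have k1: "1 \<le> k" using V by simp
  have a1: "card A + card FA \<le> 2 * k + 1" if "k + 2 \<le> card A"
    by (rule blue_clique_bound[OF E V(1) wh A(1,2) FA k1 that])
  have b1: "card B + card FB \<le> 2 * k + 1" if "k + 2 \<le> card B"
    by (rule blue_clique_bound[OF E V(1) wh B(1,2) FB k1 that])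
  have a2: "card FA \<le> 2 * k" by (rule blue_clique_bound2[OF E V(1) wh A(1,2) FA(1,3) k1 A(3) no])
  have b2: "card FB \<le> 2 * k" by (rule blue_clique_bound2[OF E V(1) wh B(1,2) FB(1,3) k1 B(3) no])
  \<comment> \<open>The worst case is one clique of order exactly \<open>k + 1\<close>, covering
    \<open>(k + 1) + 2k\<close> vertices; the other then has at least \<open>k + 2\<close> members
    by the bound on the sum and covers at most \<open>2k + 1\<close>. The total is
    \<open>5k + 2\<close>.\<close>
  show False using a1 b1 a2 b2 tot A(3) B(3) AB(2) V(2,3) by linarith
qed

text \<open>Deleting \<open>s\<close> would leave \<open>P\<close> too small, so the conflict is
  removed from \<open>Q\<close> instead. Two blue neighbours of \<open>s\<close> in \<open>Q\<close>
  are joined inside \<open>Q\<close> by a blue path on \<open>2k\<close> vertices, which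
  \<open>s\<close> would close; hence discarding one vertex of \<open>Q\<close> is enough.\<close>

lemma unbalanced_blue:
  assumes E: "simple E" and V: "finite V" "5 * k + 3 \<le> card V" "6 \<le> k"
    and no: "\<not> cyc E V (2 * k + 1)" and wh: "wheel_free E V (2 * k + 1)"
    and P: "P \<subseteq> V" "clique (opp E) P" "card P = k + 1" "s \<in> P" and Q: "Q \<subseteq> V" "clique (opp E) Q" "2 * k \<le> card Q"
    and PQ: "joined E (P - {s}) Q" "P \<inter> Q = {}" and noB: "\<not> cyc (opp E) (P \<union> Q) (2 * k + 1)"
  shows False
proof -
  let ?B = "opp E"
  have B: "simple ?B" by (rule simple_opp[OF E])
  have finQ: "finite Q" by (rule finite_subset[OF Q(1) V(1)])
  define N where "N = {x \<in> Q. ?B s x}"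
  have one: "x = y" if xy: "x \<in> N" "y \<in> N" for x y
  proof (rule ccontr)
    assume ne: "x \<noteq> y"
    have q: "x \<in> Q" "y \<in> Q" using xy by (auto simp: N_def)
    obtain xs where xs: "distinct xs" "successively ?B xs" "length xs = 2 * k" "set xs \<subseteq> Q" "hd xs = x" "last xs = y" "xs \<noteq> []"
      by (rule linked_path[OF B linked_clique[OF finQ Q(2,3)] q ne, of "2 * k"]) (use V in auto)
    have sQ: "s \<notin> Q" using P PQ by auto
    have "?B s x" "?B y s" using xy B by (auto simp: N_def simple_def)
    then have "cyc ?B (P \<union> Q) (2 * k + 1)"
      by (intro cycI[of "s # xs"]) (use xs sQ P V in \<open>auto simp: successively_Cons\<close>)
    then show False using noB by blast
  qed
  have "finite N" using finQ by (simp add: N_def)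
  then have cN: "card N \<le> 1" using one card_le_Suc0_iff_eq[of N] by simp
  have "N \<subseteq> Q" by (auto simp: N_def)
  then have cQN: "card (Q - N) = card Q - card N" using \<open>finite N\<close> by (rule card_Diff_subset[rotated])
  have clQN: "clique ?B (Q - N)" using Q(2) by (auto simp: clique_def)
  have "joined E P (Q - N)" unfolding joined_def
  proof (intro ballI)
    fix a b assume ab: "a \<in> P" "b \<in> Q - N"
    show "E a b"
    proof (cases "a = s")
      case True
      then have "\<not> ?B s b" "s \<noteq> b" using ab P PQ by (auto simp: N_def)
      then show ?thesis using True by (simp add: opp_def)
    next
      case False then show ?thesis using ab PQ(1) by (auto simp: joined_def)
    qed
  qed
  then show False
    by (intro no_blue_cliques[OF E V no wh P(1,2) _ _ clQN]) (use P Q cQN cN V in auto)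
qed

text \<open>For blue sides, either both keep \<open>k + 1\<close> vertices when the star centre is
  deleted, or the centre lies in a side of order \<open>k + 1\<close> and the other side has at
  least \<open>2k\<close> vertices. Each case contradicts a count in all of
  \<open>V\<close>.\<close>

lemma red_links:
  assumes E: "simple E" and V: "finite V" "5 * k + 3 \<le> card V" "6 \<le> k"
    and no: "\<not> cyc E V (2 * k + 1)" and wh: "wheel_free E V (2 * k + 1)"
    and X: "X \<subseteq> V" "3 * k + 1 \<le> card X" "\<not> cyc (opp E) X (2 * k + 1)"
  obtains P Q A B where "X = P \<union> Q" "P \<inter> Q = {}" "linked E k P A" "linked E (k + 1) Q B" "k + 1 \<le> card P"
proof -
  let ?B = "opp E"
  have finX: "finite X" by (rule finite_subset[OF X(1) V(1)])
  have noE: "\<not> cyc E X (2 * k + 1)" using no cyc_mono[OF _ X(1)] by blast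
  obtain K P Q A B where L: "K = E \<or> K = opp E" "X = P \<union> Q" "P \<inter> Q = {}" "linked K k P A" "linked K (k + 1) Q B" "k + 1 \<le> card P"
    by (rule two_links[OF E finX X(2) V(3) noE X(3)])
  show ?thesis
  proof (cases "K = E")
    case True then show ?thesis using that L by blast
  next
    case False
    then have KB: "K = ?B" using L(1) by simp
    have sB: "simple ?B" by (rule simple_opp[OF E])
    obtain s where s: "s \<in> P \<union> Q" "joined (opp ?B) (P - {s}) (Q - {s})" "clique ?B (P - {s})" "clique ?B (Q - {s})"
      "card P = k + 1 \<longrightarrow> clique ?B P" "card Q = k + 1 \<longrightarrow> clique ?B Q"
      by (rule split_links[OF sB L(3) L(4,5)[unfolded KB] L(6)]) (use V noE X(3) L(2) opp_opp[OF E] in auto)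
    have fin: "finite P" "finite Q" using finX L(2) by auto
    have cm: "joined E (P - {s}) (Q - {s})" using s(2) opp_opp[OF E] by simp
    have sub: "P \<subseteq> V" "Q \<subseteq> V" using X(1) L(2) by auto
    have le: "card R \<le> 2 * k" if "clique ?B R" "R \<subseteq> X" for R
    proof (rule ccontr)
      assume "\<not> ?thesis"
      then have "cyc ?B R (2 * k + 1)" by (intro clique_cyc[OF that(1) finite_subset[OF that(2) finX]]) (use V in auto)
      then show False using X(3) cyc_mono[OF _ that(2)] by blast
    qed
    have c2: "card (P - {s}) \<le> 2 * k" "card (Q - {s}) \<le> 2 * k" using le[OF s(3)] le[OF s(4)] L(2) by auto
    have cX: "card X = card P + card Q" using L(2,3) fin by (simp add: card_Un_disjoint)
    have cQ: "k + 1 \<le> card Q" using L(5) card_mono[OF fin(2), of B] by (auto simp: linked_def)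
    have cds: "card (P - {s}) = (if s \<in> P then card P - 1 else card P)" "card (Q - {s}) = (if s \<in> Q then card Q - 1 else card Q)"
      by (simp_all add: card_Diff_singleton_if)
    have s1: "s \<in> P \<longleftrightarrow> s \<notin> Q" using s(1) L(3) by auto
    have False
    proof (cases "k + 1 \<le> card (P - {s}) \<and> k + 1 \<le> card (Q - {s})")
      case True
      show False
        by (rule no_blue_cliques[OF E V no wh _ s(3) _ _ s(4) _ cm])
          (use True sub cds cX X(2) s1 V in \<open>auto split: if_splits\<close>)
    next
      case False
      then consider "card (P - {s}) \<le> k" | "card (Q - {s}) \<le> k" by linarith
      then show False
      proof cases
        case 1
        then have sP: "s \<in> P" "card P = k + 1" using L(6) cds by (auto split: if_splits)
        then have Qs: "Q - {s} = Q" using s1 by auto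
        show False
          by (rule unbalanced_blue[OF E V no wh sub(1) _ sP(2,1) sub(2)])
            (use s Qs cm sP cX X L(2,3) in auto)
      next
        case 2
        then have sQ: "s \<in> Q" "card Q = k + 1" using cQ cds by (auto split: if_splits)
        then have Ps: "P - {s} = P" using s1 by auto
        have cm': "joined E (Q - {s}) P" using cm Ps joined_sym[OF E] by simp
        show False
          by (rule unbalanced_blue[OF E V no wh sub(2) _ sQ(2,1) sub(1) _ _ cm'])
            (use s Ps sQ cX X L(2,3) in \<open>auto simp: Un_commute\<close>)
      qed
    qed
    then show ?thesis ..
  qed
qed

section \<open>A cut vertex between the two red sides\<close>

text \<open>A cycle from \<open>P\<close> through \<open>us\<close> to \<open>Q\<close> and back through \<open>v\<close> has adjustable length inside \<open>P\<close>
  and \<open>Q\<close>; if \<open>us\<close> is too long for that, \<open>v\<close> cuts it short.\<close>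

lemma cycle_via:
  assumes E: "simple E" and l: "linked E k P A" "linked E k Q B" and k: "6 \<le> k"
    and dis: "P \<inter> Q = {}" "v \<notin> P \<union> Q \<union> R" "R \<inter> (P \<union> Q) = {}" and v: "\<And>r. r \<in> R \<Longrightarrow> E v r"
    and a: "a \<in> P" "a' \<in> P" "a \<noteq> a'" and b: "b \<in> Q" "b' \<in> Q" "b \<noteq> b'"
    and us: "distinct us" "set us \<subseteq> R" "successively E (a # us @ [b])"
    and y: "y \<in> R - set us" "E a' y" and z: "z \<in> R - set us" "E b' z"
  shows "cyc E (P \<union> Q \<union> {v} \<union> R) (2 * k + 1)"
proof -
  have sy: "E p q \<Longrightarrow> E q p" for p q using E by (auto simp: simple_def)
  \<comment> \<open>\<open>ws\<close> leads back from \<open>b'\<close> to \<open>a'\<close>: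
    through \<open>y\<close> alone if \<open>y = z\<close>, and otherwise through \<open>v\<close>,
    which is adjacent to all of \<open>R\<close>. It costs at most three vertices.\<close>
  obtain ws where ws: "distinct ws" "set ws \<subseteq> insert v R" "set ws \<inter> set us = {}" "1 \<le> length ws" "length ws \<le> 3"
    "successively E (b' # ws @ [a'])"
  proof (cases "y = z")
    case True
    show ?thesis by (rule that[of "[y]"]) (use True y z sy in auto)
  next
    case False
    show ?thesis
      by (rule that[of "[z, v, y]"]) (use False y z us(2) dis(2) v[of z] v[of y] sy in auto)
  qed
  have wsne: "ws \<noteq> []" using ws by auto
  have wE: "successively E ws" "E b' (hd ws)" "E (last ws) a'"
    using ws(6) wsne by (auto simp: successively_Cons successively_append_iff)
  define m where "m = length us + length ws"
  show ?thesis
  proof (cases "m + 6 \<le> 2 * k + 1")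
    case True
    \<comment> \<open>The path in \<open>P\<close> is as long as possible while leaving three
      vertices for \<open>Q\<close>; \<open>m >= 1\<close> keeps the share of \<open>Q\<close> at
      most \<open>k\<close>.\<close>
    define n1 where "n1 = min k (2 * k - 2 - m)"
    define n2 where "n2 = 2 * k + 1 - m - n1"
    have m1: "1 \<le> m" using ws by (simp add: m_def)
    have n: "3 \<le> n1" "n1 \<le> k" "3 \<le> n2" "n2 \<le> k" "n1 + n2 + m = 2 * k + 1"
      using True k m1 by (auto simp: n1_def n2_def)
    obtain ps where ps: "distinct ps" "successively E ps" "length ps = n1" "set ps \<subseteq> P" "hd ps = a'" "last ps = a" "ps \<noteq> []"
      by (rule linked_path[OF E l(1) a(2,1) a(3)[symmetric] n(1,2)])
    obtain qs where qs: "distinct qs" "successively E qs" "length qs = n2" "set qs \<subseteq> Q" "hd qs = b" "last qs = b'" "qs \<noteq> []"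
      by (rule linked_path[OF E l(2) b n(3,4)])
    have s1: "successively E (us @ qs)"
      using us(3) qs by (auto simp: successively_Cons successively_append_iff split: if_splits)
    have s2: "E a (hd (us @ qs))"
      using us(3) qs by (cases us) auto
    have P1: "successively E (ps @ us @ qs @ ws)"
      using s1 s2 ps qs wE wsne by (auto simp: successively_append_iff hd_append)
    show ?thesis
    proof (rule cycI[of "ps @ us @ qs @ ws"])
      show "length (ps @ us @ qs @ ws) = 2 * k + 1" using n ps qs by (simp add: m_def)
      show "3 \<le> 2 * k + 1" using k by simp
      show "set (ps @ us @ qs @ ws) \<subseteq> P \<union> Q \<union> {v} \<union> R" using ps qs us ws by auto
      have "set ps \<inter> set us = {}" "set ps \<inter> set qs = {}" "set ps \<inter> set ws = {}" "set us \<inter> set qs = {}" "set qs \<inter> set ws = {}"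
        using ps(4) qs(4) us(2) ws(2) dis by blast+
      then show "distinct (ps @ us @ qs @ ws)" using ps(1) qs(1) us(1) ws(1,3) by auto
      show "successively E (ps @ us @ qs @ ws)" by (rule P1)
      show "E (last (ps @ us @ qs @ ws)) (hd (ps @ us @ qs @ ws))" using wE wsne ps by simp
    qed
  next
    case False
    \<comment> \<open>Now \<open>us\<close> has at least \<open>2k - 7 >= k - 1\<close> vertices,
      because \<open>k >= 6\<close>. The cycle does not visit \<open>Q\<close>: it takes
      \<open>k\<close> vertices of \<open>P\<close>, then \<open>k - 1\<close> of \<open>us\<close>,
      then \<open>v\<close> and \<open>y\<close>.\<close>
    define ts where "ts = take (k - 1) us"
    have lt: "length ts = k - 1" using False ws(5) k by (simp add: m_def ts_def)
    have tne: "ts \<noteq> []" using lt k by auto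
    have tsub: "set ts \<subseteq> set us" by (auto simp: ts_def dest: in_set_takeD)
    have une: "us \<noteq> []" using tne by (auto simp: ts_def)
    have ut: "us = ts @ drop (k - 1) us" by (simp add: ts_def)
    have "successively E us" "E a (hd us)" using us(3) une by (auto simp: successively_Cons successively_append_iff)
    moreover have "hd us = hd ts" using tne by (simp add: ts_def)
    ultimately have tE: "successively E ts" "E a (hd ts)"
      using ut by (metis successively_append_iff, simp)
    have lR: "last ts \<in> R" using tne tsub us(2) last_in_set[OF tne] by blast
    obtain ps where ps: "distinct ps" "successively E ps" "length ps = k" "set ps \<subseteq> P" "hd ps = a'" "last ps = a" "ps \<noteq> []"
      by (rule linked_path[OF E l(1) a(2,1) a(3)[symmetric], of k]) (use k in auto)
    show ?thesis
    proof (rule cycI[of "ps @ ts @ [v, y]"])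
      show "length (ps @ ts @ [v, y]) = 2 * k + 1" using lt ps k by simp
      show "3 \<le> 2 * k + 1" using k by simp
      show "set (ps @ ts @ [v, y]) \<subseteq> P \<union> Q \<union> {v} \<union> R" using ps tsub us y by auto
      have "distinct ts" using us(1) by (simp add: ts_def)
      moreover have "set ps \<inter> set ts = {}" "v \<notin> set ps" "y \<notin> set ps" "v \<notin> set ts" "y \<notin> set ts" "v \<noteq> y"
        using ps(4) us(2) tsub dis y by blast+
      ultimately show "distinct (ps @ ts @ [v, y])" using ps(1) by auto
      show "successively E (ps @ ts @ [v, y])"
        using ps tE tne v[of y] y sy[OF v[OF lR]] by (auto simp: successively_append_iff)
      show "E (last (ps @ ts @ [v, y])) (hd (ps @ ts @ [v, y]))" using ps sy[OF y(2)] by simp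
    qed
  qed
qed

text \<open>Deleting \<open>h\<close> reveals an exit that avoids \<open>h\<close>. If it starts in
  \<open>a2\<close>, deleting \<open>a2\<close> reveals another one, and some pair among them has
  different starting points and exactly one target \<open>h\<close>.\<close>

lemma two_exits:
  assumes a2: "a2 \<in> P" "a2 \<in> V" "E a2 h" and h: "h \<in> V" "h \<notin> P"
    and ex: "\<And>s. s \<in> V \<Longrightarrow> \<exists>a\<in>P - {s}. \<exists>w\<in>V - P - {s}. E a w"
  obtains a a' y where "a \<in> P" "a' \<in> P" "a \<noteq> a'" "E a h" "E a' y" "y \<in> V - P" "y \<noteq> h"
proof -
  obtain a w where aw: "a \<in> P" "w \<in> V - P" "w \<noteq> h" "E a w" using ex[OF h(1)] by blast
  show ?thesis
  proof (cases "a = a2")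
    case False then show ?thesis using that[of a2 a w] aw a2 by blast
  next
    case True
    obtain a' w' where aw': "a' \<in> P" "a' \<noteq> a2" "w' \<in> V - P" "E a' w'" using ex[OF a2(2)] by blast
    show ?thesis
    proof (cases "w' = h")
      case True then show ?thesis using that[of a' a2 w] aw aw' a2 \<open>a = a2\<close> by blast
    next
      case False then show ?thesis using that[of a2 a' w'] aw' a2 by blast
    qed
  qed
qed

text \<open>The link is a single edge at \<open>c\<close>. Since every edge between the sides passes
  through \<open>c\<close>, the exits from the other vertices lead into \<open>R\<close>, where
  \<open>cycle_via\<close> expects them.\<close>

lemma direct_edge:
  assumes E: "simple E" and l: "linked E k P A" "linked E k Q B" and k: "6 \<le> k"
    and V: "V = P \<union> Q \<union> {v} \<union> R"
    and dis: "P \<inter> Q = {}" "v \<notin> P \<union> Q \<union> R" "R \<inter> (P \<union> Q) = {}" and v: "\<And>r. r \<in> R \<Longrightarrow> E v r"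
    and nv: "\<And>x. x \<in> P \<union> Q \<Longrightarrow> \<not> E v x"
    and exP: "\<And>s. s \<in> V \<Longrightarrow> \<exists>a\<in>P - {s}. \<exists>w\<in>V - P - {s}. E a w"
    and exQ: "\<And>s. s \<in> V \<Longrightarrow> \<exists>a\<in>Q - {s}. \<exists>w\<in>V - Q - {s}. E a w"
    and c: "c \<in> P" "\<And>a b. a \<in> P - {c} \<Longrightarrow> b \<in> Q \<Longrightarrow> \<not> E a b" "d \<in> Q" "E c d"
  shows "cyc E V (2 * k + 1)"
proof -
  have sy: "E p q \<Longrightarrow> E q p" for p q using E by (auto simp: simple_def)
  have cV: "c \<in> V" "c \<notin> Q" using c V dis by auto
  obtain a y where ay: "a \<in> P" "a \<noteq> c" "y \<in> V - P" "E a y" using exP[OF cV(1)] by blast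
  have "y \<in> R" using c(2)[of a y] nv[of a] ay V sy by auto
  obtain b b' z where b: "b \<in> Q" "b' \<in> Q" "b \<noteq> b'" "E b c" "E b' z" "z \<in> V - Q" "z \<noteq> c"
    by (rule two_exits[of d Q V E c]) (use c V cV exQ sy in auto)
  have "z \<in> R" using c(2)[of z b'] nv[of b'] b V sy by auto
  have "cyc E (P \<union> Q \<union> {v} \<union> R) (2 * k + 1)"
    by (rule cycle_via[OF E l k dis v c(1) ay(1) ay(2)[symmetric] b(1,2,3), of "[]" y z])
      (use \<open>y \<in> R\<close> \<open>z \<in> R\<close> ay b sy in auto)
  then show ?thesis using V by simp
qed

text \<open>All conclusions follow by shortening a shortest walk. The last three keep the inner
  vertices apart from the exits by which the return route will leave \<open>P\<close> and
  \<open>Q\<close>.\<close>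

lemma shortest_path:
  assumes E: "simple E" and PQ: "P \<inter> Q = {}" "P \<union> Q \<subseteq> W"
    and ex: "xs0 \<noteq> []" "successively E xs0" "set xs0 \<subseteq> W" "hd xs0 \<in> P" "last xs0 \<in> Q"
  obtains a ys b where "successively E (a # ys @ [b])" "distinct ys" "set ys \<subseteq> W - P - Q" "a \<in> P" "b \<in> Q"
    "\<forall>p\<in>P. \<forall>y\<in>set ys. E p y \<longrightarrow> y = hd ys"
    "\<forall>q\<in>Q. \<forall>y\<in>set ys. E q y \<longrightarrow> y = last ys"
    "\<forall>p\<in>P. \<forall>q\<in>Q. E p q \<longrightarrow> ys = []"
proof -
  let ?w = "\<lambda>xs. xs \<noteq> [] \<and> successively E xs \<and> set xs \<subseteq> W \<and> hd xs \<in> P \<and> last xs \<in> Q"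
  have "?w xs0" using ex by blast
  from ex_has_least_nat[of ?w xs0 length, OF this]
  obtain xs where xs: "?w xs" and mn0: "\<forall>zs. ?w zs \<longrightarrow> length xs \<le> length zs" by blast
  have mn: "length xs \<le> length zs"
    if "zs \<noteq> []" "successively E zs" "set zs \<subseteq> W" "hd zs \<in> P" "last zs \<in> Q" for zs
    using mn0 that by simp
  obtain a zs where az: "xs = a # zs" using xs by (cases xs) auto
  have "zs \<noteq> []" using az xs PQ by auto
  then obtain ys b where yb: "zs = ys @ [b]" by (cases zs rule: rev_cases) auto
  have x: "xs = a # ys @ [b]" using az yb by simp
  have ab: "a \<in> P" "b \<in> Q" "set ys \<subseteq> W" "a \<in> W" "b \<in> W" "successively E (a # ys @ [b])" using xs x by auto
  have len: "length xs = length ys + 2" using x by simp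
  have sy: "E p q \<Longrightarrow> E q p" for p q using E by (auto simp: simple_def)
  have d: "distinct ys"
  proof (rule ccontr)
    assume "\<not> distinct ys"
    then obtain p q r y where y: "ys = p @ [y] @ q @ [y] @ r" using not_distinct_decomp by blast
    have "length xs \<le> length (a # (p @ [y] @ r) @ [b])"
    proof (rule mn)
      show "successively E (a # (p @ [y] @ r) @ [b])"
        using ab(6) unfolding y by (auto simp: successively_append_iff successively_Cons hd_append split: if_splits)
    qed (use ab y in auto)
    then show False using len y by simp
  qed
  have notP: "y \<notin> P \<and> y \<notin> Q \<and> (\<forall>p\<in>P. E p y \<longrightarrow> us = []) \<and> (\<forall>q\<in>Q. E q y \<longrightarrow> ws = [])"
    if y: "ys = us @ y # ws" for y us ws
  proof (intro conjI ballI impI)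
    have s1: "successively E (y # ws @ [b])"
      using ab(6) unfolding y by (auto simp: successively_append_iff successively_Cons)
    have s2: "successively E (a # us @ [y])"
      using ab(6) unfolding y by (auto simp: successively_append_iff successively_Cons hd_append split: if_splits)
    have sub: "y \<in> W" "set us \<subseteq> W" "set ws \<subseteq> W" using ab(3) y by auto
    show "y \<notin> P"
    proof
      assume "y \<in> P"
      then have "length xs \<le> length (y # ws @ [b])" using s1 sub ab by (intro mn) auto
      then show False using len y by simp
    qed
    show "y \<notin> Q"
    proof
      assume "y \<in> Q"
      then have "length xs \<le> length (a # us @ [y])" using s2 sub ab by (intro mn) auto
      then show False using len y by simp
    qed
    show "us = []" if "p \<in> P" "E p y" for p
    proof -
      have "length xs \<le> length (p # y # ws @ [b])" using s1 sub ab that PQ by (intro mn) auto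
      then show ?thesis using len y by simp
    qed
    show "ws = []" if "q \<in> Q" "E q y" for q
    proof -
      have "successively E ((a # us @ [y]) @ [q])"
        using s2 sy[OF that(2)] by (simp add: successively_append_iff del: append_Cons)
      then have "length xs \<le> length ((a # us @ [y]) @ [q])" using sub ab that PQ by (intro mn) auto
      then show ?thesis using len y by simp
    qed
  qed
  show ?thesis
  proof (rule that[OF ab(6) d _ ab(1,2)])
    show "set ys \<subseteq> W - P - Q"
    proof
      fix y assume y: "y \<in> set ys"
      obtain us ws where "ys = us @ y # ws" using split_list[OF y] by blast
      then show "y \<in> W - P - Q" using notP y ab(3) by blast
    qed
    show "\<forall>p\<in>P. \<forall>y\<in>set ys. E p y \<longrightarrow> y = hd ys" using notP by (metis append_Nil list.sel(1) split_list)
    show "\<forall>q\<in>Q. \<forall>y\<in>set ys. E q y \<longrightarrow> y = last ys" using notP by (metis last_snoc split_list)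
    show "\<forall>p\<in>P. \<forall>q\<in>Q. E p q \<longrightarrow> ys = []"
    proof (intro ballI impI)
      fix p q assume "p \<in> P" "q \<in> Q" "E p q"
      then have "length xs \<le> length [p, q]" using PQ by (intro mn) auto
      then show "ys = []" using len by simp
    qed
  qed
qed

text \<open>Otherwise deleting \<open>v\<close> leaves a path from \<open>P\<close> to
  \<open>Q\<close>, and deleting other vertices provides exits into \<open>R\<close>. Menger's
  theorem is avoided: one shortest path and two exits suffice, since \<open>v\<close> joins any two
  vertices of \<open>R\<close> on the way back.\<close>

lemma cut:
  assumes E: "simple E" and l: "linked E k P A" "linked E (k + 1) Q B" and k: "6 \<le> k"
    and V: "V = P \<union> Q \<union> {v} \<union> R"
    and dis: "P \<inter> Q = {}" "v \<notin> P \<union> Q \<union> R" "R \<inter> (P \<union> Q) = {}" and v: "\<And>r. r \<in> R \<Longrightarrow> E v r"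
    and nv: "\<And>x. x \<in> P \<union> Q \<Longrightarrow> \<not> E v x" and no: "\<not> cyc E V (2 * k + 1)"
  shows "\<exists>s S. s \<in> V \<and> S \<subseteq> V - {s} \<and> P - {s} \<subseteq> S \<and> S \<inter> Q = {} \<and> (\<forall>x\<in>S. \<forall>y\<in>V - {s} - S. \<not> E x y)"
proof (rule ccontr)
  assume "\<not> ?thesis"
  then have nocut0: "\<forall>s S. \<not> (s \<in> V \<and> S \<subseteq> V - {s} \<and> P - {s} \<subseteq> S \<and> S \<inter> Q = {} \<and> (\<forall>x\<in>S. \<forall>y\<in>V - {s} - S. \<not> E x y))"
    by simp
  have nocut: "\<exists>x\<in>S. \<exists>y\<in>V - {s} - S. E x y" if "s \<in> V" "S \<subseteq> V - {s}" "P - {s} \<subseteq> S" "S \<inter> Q = {}" for s S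
    using nocut0[rule_format, of s S] that by blast
  have sy: "E p q \<Longrightarrow> E q p" for p q using E by (auto simp: simple_def)
  have lQ: "linked E k Q B" by (rule linked_less[OF l(2)]) simp
  have exP: "\<exists>a\<in>P - {s}. \<exists>w\<in>V - P - {s}. E a w" if s: "s \<in> V" for s
  proof -
    have "P - {s} \<subseteq> V - {s}" "(P - {s}) \<inter> Q = {}" using V dis by auto
    from nocut[OF s this(1) subset_refl this(2)] show ?thesis by blast
  qed
  have exQ: "\<exists>a\<in>Q - {s}. \<exists>w\<in>V - Q - {s}. E a w" if s: "s \<in> V" for s
  proof -
    obtain x y where xy: "x \<in> V - {s} - Q" "y \<in> V - {s} - (V - {s} - Q)" "E x y"
    proof -
      have "V - {s} - Q \<subseteq> V - {s}" "P - {s} \<subseteq> V - {s} - Q" "(V - {s} - Q) \<inter> Q = {}" using V dis by auto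
      from nocut[OF s this] show ?thesis using that by blast
    qed
    then show ?thesis using sy[OF xy(3)] by blast
  qed
  define W where "W = V - {v}"
  let ?w = "\<lambda>xs. xs \<noteq> [] \<and> successively E xs \<and> set xs \<subseteq> W \<and> hd xs \<in> P"
  \<comment> \<open>These are the vertices reachable from \<open>P\<close> without \<open>v\<close>;
    if they missed \<open>Q\<close>, then \<open>v\<close> with this set would be a cut of the
    excluded kind.\<close>
  define S where "S = {last xs | xs. ?w xs}"
  have SI: "last xs \<in> S" if "?w xs" for xs unfolding S_def using that by (intro CollectI exI[of _ xs]) simp
  have PQW: "P \<union> Q \<subseteq> W" using V dis by (auto simp: W_def)
  have SW: "S \<subseteq> W" by (auto simp: S_def)
  have PS: "P \<subseteq> S"
  proof
    fix p assume "p \<in> P"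
    then show "p \<in> S" using SI[of "[p]"] PQW by auto
  qed
  have "S \<inter> Q \<noteq> {}"
  proof
    assume "S \<inter> Q = {}"
    then have "\<exists>x\<in>S. \<exists>y\<in>V - {v} - S. E x y"
      by (rule nocut[rotated 3]) (use SW PS V W_def in auto)
    then obtain x y where xy: "x \<in> S" "y \<in> W - S" "E x y" unfolding W_def by blast
    obtain xs where xs: "?w xs" "x = last xs" using xy(1) by (auto simp: S_def)
    have "y \<in> S" using SI[of "xs @ [y]"] xs xy by (auto simp: successively_append_iff)
    then show False using xy by blast
  qed
  then obtain xs where xs: "?w xs" "last xs \<in> Q" by (auto simp: S_def)
  obtain a ys b where ys: "successively E (a # ys @ [b])" "distinct ys" "set ys \<subseteq> W - P - Q" "a \<in> P" "b \<in> Q"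
    "\<forall>p\<in>P. \<forall>y\<in>set ys. E p y \<longrightarrow> y = hd ys"
    "\<forall>q\<in>Q. \<forall>y\<in>set ys. E q y \<longrightarrow> y = last ys"
    "\<forall>p\<in>P. \<forall>q\<in>Q. E p q \<longrightarrow> ys = []"
    by (rule shortest_path[OF E dis(1) PQW, of xs]) (use xs in auto)
  have ysR: "set ys \<subseteq> R" using ys(3) V by (auto simp: W_def)
  have outP: "w \<in> Q \<union> R" if "a \<in> P" "E a w" "w \<in> V - P" for a w
    using that nv[of a] sy[of a w] V by auto
  have outQ: "w \<in> P \<union> R" if "a \<in> Q" "E a w" "w \<in> V - Q" for a w
    using that nv[of a] sy[of a w] V by auto
  show False
  proof (cases "ys = []")
    case False
    define h where "h = hd ys"
    define t where "t = last ys"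
    have ht: "h \<in> set ys" "t \<in> set ys" using False by (simp_all add: h_def t_def)
    have hV: "h \<in> V" "h \<notin> P" "t \<in> V" "t \<notin> Q" using ht ys(3) by (auto simp: W_def)
    have e: "E a h" "E t b" "successively E ys" using ys(1) False by (auto simp: h_def t_def successively_Cons successively_append_iff)
    obtain a1 a3 y where a: "a1 \<in> P" "a3 \<in> P" "a1 \<noteq> a3" "E a1 h" "E a3 y" "y \<in> V - P" "y \<noteq> h"
      by (rule two_exits[of a P V E h]) (use ys(4) V e hV exP in auto)
    obtain b1 b3 z where b: "b1 \<in> Q" "b3 \<in> Q" "b1 \<noteq> b3" "E b1 t" "E b3 z" "z \<in> V - Q" "z \<noteq> t"
      by (rule two_exits[of b Q V E t]) (use ys(5) V sy[OF e(2)] hV exQ in auto)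
    have y: "y \<in> R - set ys" using outP[OF a(2,5,6)] ys(6,8) a False h_def by auto
    have z: "z \<in> R - set ys" using outQ[OF b(2,5,6)] ys(7,8) b False t_def sy[OF b(5)] by auto
    have "successively E (a1 # ys @ [b1])"
      using e(3) a(4) sy[OF b(4)] False by (auto simp: successively_Cons successively_append_iff h_def t_def)
    then have "cyc E (P \<union> Q \<union> {v} \<union> R) (2 * k + 1)"
      by (intro cycle_via[OF E l(1) lQ k dis v a(1,2,3) b(1,2,3) ys(2) ysR _ y a(5) z b(5)])
    then show False using no V by simp
  next
    case True
    have ab: "E a b" using ys(1) True by simp
    have no0: "\<forall>a\<in>P. \<forall>b\<in>Q. \<forall>a'\<in>P. \<forall>b'\<in>Q. a \<noteq> a' \<longrightarrow> b \<noteq> b' \<longrightarrow> E a b \<longrightarrow> \<not> E a' b'"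
    proof (intro ballI impI notI)
      fix x y x' y' assume xy: "x \<in> P" "y \<in> Q" "x' \<in> P" "y' \<in> Q" "x \<noteq> x'" "y \<noteq> y'" "E x y" "E x' y'"
      have "cyc E (P \<union> Q) (2 * k + 1)" by (rule no_two_links[OF E l dis(1) _ xy(1,3,5,2,4,6,7,8)]) (use k in simp)
      then show False using no cyc_mono[of E "P \<union> Q" _ V] V by blast
    qed
    have Pne: "P \<noteq> {}" using ys by blast
    obtain c where c: "c \<in> P \<union> Q" "\<forall>a\<in>P - {c}. \<forall>b\<in>Q - {c}. \<not> E a b"
      by (rule star_center[OF Pne no0])
    have "cyc E V (2 * k + 1)"
    proof (cases "c \<in> P")
      case True
      then have "c \<notin> Q" using dis by blast
      then have ac: "a = c" using c(2) ab ys(4,5) by blast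
      show ?thesis
        by (rule direct_edge[OF E l(1) lQ k V dis v nv exP exQ True _ ys(5)])
          (use c(2) \<open>c \<notin> Q\<close> ab ac in auto)
    next
      case False
      then have cQ: "c \<in> Q" using c by blast
      then have bc: "b = c" using c(2) ab ys(4,5) False by blast
      have nc: "\<not> E x y" if "x \<in> Q - {c}" "y \<in> P" for x y using c(2) False that sy[of x y] by blast
      show ?thesis
        by (rule direct_edge[OF E lQ l(1) k _ _ _ _ v _ exQ exP cQ nc ys(4)])
          (use ab bc V dis nv sy in auto)
    qed
    then show False using no by blast
  qed
qed

section \<open>Assembling the partition\<close>

text \<open>Suppose \<open>T\<close> contains a blue edge. If \<open>x\<close> in \<open>S\<close>
  had \<open>k\<close> blue neighbours in \<open>S\<close>, these and \<open>k + 1\<close> vertices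
  of \<open>T\<close> would form an odd blue rim around \<open>x\<close>. So any
  \<open>2k + 1\<close> vertices of \<open>S\<close> have red degrees at least \<open>k + 1\<close>
  among themselves, and Dirac's theorem gives a red cycle of the forbidden length.\<close>

lemma small_side_clique:
  assumes E: "simple E" and V: "finite V" and k: "1 \<le> k" and no: "\<not> cyc E V (2 * k + 1)" and wh: "wheel_free E V (2 * k + 1)"
    and ST: "S \<subseteq> V" "T \<subseteq> V" "joined (opp E) S T" "k + 1 \<le> card T" "2 * k + 1 \<le> card S"
  shows "clique E T"
proof (rule ccontr)
  assume "\<not> ?thesis"
  then obtain t t' where t: "t \<in> T" "t' \<in> T" "opp E t t'" by (auto simp: clique_def opp_def)
  have fin: "finite S" "finite T" by (rule finite_subset[OF ST(1) V], rule finite_subset[OF ST(2) V])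
  have bl: "card {y \<in> S. opp E x y} \<le> k - 1" if x: "x \<in> S" for x
  proof (rule ccontr)
    assume big: "\<not> ?thesis"
    let ?N = "{y \<in> S. opp E x y}"
    have "cyc (opp E) (?N \<union> T) (2 * k + 1)"
    proof (rule bip_odd_cycle[OF simple_opp[OF E] _ _ fin(2) t])
      show "joined (opp E) ?N T" by (rule joined_mono[OF ST(3)]) auto
    qed (use fin k big ST in auto)
    moreover have "\<not> cyc (opp E) (?N \<union> T) (2 * k + 1)"
      by (rule wheel_freeD[OF wh, of x]) (use x ST in \<open>auto simp: joined_def\<close>)
    ultimately show False by blast
  qed
  obtain S' where S': "S' \<subseteq> S" "card S' = 2 * k + 1" "finite S'"
    by (rule obtain_subset_with_card_n[OF ST(5)]) auto
  have "cyc E S' (card S')"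
  proof (rule dirac[OF E S'(3)])
    show "3 \<le> card S'" using S' k by simp
    fix x assume x: "x \<in> S'"
    have "card {y \<in> S'. opp E x y} \<le> card {y \<in> S. opp E x y}"
      by (rule card_mono) (use fin S' in auto)
    then have "card {y \<in> S'. opp E x y} \<le> k - 1" using bl[of x] x S'(1) by fastforce
    then show "card S' \<le> 2 * card {y \<in> S'. E x y}" using deg_opp[OF S'(3) x E] S'(2) k by linarith
  qed
  then have "cyc E V (2 * k + 1)" using S' ST(1) cyc_mono[of E S' _ V] by simp
  then show False using no by blast
qed

definition red_partition :: "('a \<Rightarrow> 'a \<Rightarrow> bool) \<Rightarrow> 'a set \<Rightarrow> nat \<Rightarrow> bool" where
  "red_partition E V k \<longleftrightarrow> (\<exists>U0 U1 U2 U3. V = U0 \<union> U1 \<union> U2 \<union> U3 \<and> U0 \<inter> (U1 \<union> U2 \<union> U3) = {} \<and>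
     card U0 \<le> 2 \<and> card U1 \<le> 2 * k \<and> card U2 \<le> 2 * k \<and> card U3 \<le> 2 * k \<and>
     clique E U1 \<and> clique E U2 \<and> clique E U3 \<and>
     joined (opp E) U1 U2 \<and> joined (opp E) U1 U3 \<and> joined (opp E) U2 U3)"

lemma two_sides:
  assumes E: "simple E" and V: "finite V" "5 * k + 3 \<le> card V" "6 \<le> k"
    and no: "\<not> cyc E V (2 * k + 1)" and wh: "wheel_free E V (2 * k + 1)"
    and ST: "V = insert s (S \<union> T)" "s \<notin> S \<union> T" "joined (opp E) S T" "card T \<le> card S"
    and T: "k + 1 \<le> card T \<or> clique E T" "T \<noteq> {}"
  shows "red_partition E V k"
proof -
  have fin: "finite S" "finite T" using V(1) ST(1) by auto
  have dST: "S \<inter> T = {}" by (rule joined_disj[OF simple_opp[OF E] ST(3)])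
  have sub: "S \<subseteq> V" "T \<subseteq> V" using ST(1) by auto
  have cV: "card V = Suc (card S + card T)" using ST(1,2) fin dST by (simp add: card_Un_disjoint)
  have clT: "clique E T"
    using T(1) small_side_clique[OF E V(1) _ no wh sub ST(3)] cV ST(4) V(2,3) by linarith
  have le: "card R \<le> 2 * k" if "clique E R" "R \<subseteq> V" for R
  proof (rule ccontr)
    assume "\<not> ?thesis"
    then have "cyc E R (2 * k + 1)" by (intro clique_cyc[OF that(1) finite_subset[OF that(2) V(1)]]) (use V in auto)
    then show False using no cyc_mono[OF _ that(2)] by blast
  qed
  have cT: "card T \<le> 2 * k" by (rule le[OF clT sub(2)])
  obtain t where t: "t \<in> T" using T(2) by blast
  have opp_sym: "opp E x y \<Longrightarrow> opp E y x" for x y using E by (auto simp: opp_def simple_def)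
  \<comment> \<open>Any vertex of \<open>T\<close> is a hub over \<open>S\<close>, which is where
    \<open>T\<close> being nonempty enters.\<close>
  have noB: "\<not> cyc (opp E) S (2 * k + 1)"
    by (rule wheel_freeD[OF wh, of t]) (use t sub ST(3) opp_sym in \<open>auto simp: joined_def\<close>)
  have noE: "\<not> cyc E S (2 * k + 1)" using no cyc_mono[OF _ sub(1)] by blast
  have cS: "3 * k + 1 \<le> card S" using cV cT V(2) by linarith
  obtain P Q A B where L: "S = P \<union> Q" "P \<inter> Q = {}" "linked E k P A" "linked E (k + 1) Q B" "k + 1 \<le> card P"
    by (rule red_links[OF E V no wh sub(1) cS noB])
  have k3: "3 \<le> k" using V(3) by simp
  obtain s' where s': "s' \<in> P \<union> Q" "joined (opp E) (P - {s'}) (Q - {s'})" "clique E (P - {s'})" "clique E (Q - {s'})"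
    by (rule split_links[OF E L(2-5) k3 noE[unfolded L(1)] noB[unfolded L(1)]])
  show ?thesis unfolding red_partition_def
  proof (intro exI conjI)
    show "V = {s, s'} \<union> T \<union> (P - {s'}) \<union> (Q - {s'})" using ST(1) L(1) s'(1) by auto
    show "{s, s'} \<inter> (T \<union> (P - {s'}) \<union> (Q - {s'})) = {}" using ST(2) L(1) s'(1) dST by auto
    show "card {s, s'} \<le> 2" by (simp add: card_insert_if)
    show "card T \<le> 2 * k" by (rule cT)
    show "card (P - {s'}) \<le> 2 * k" by (rule le[OF s'(3)]) (use L(1) sub in auto)
    show "card (Q - {s'}) \<le> 2 * k" by (rule le[OF s'(4)]) (use L(1) sub in auto)
    show "clique E T" by (rule clT)
    show "clique E (P - {s'})" "clique E (Q - {s'})" by fact+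
    show "joined (opp E) (P - {s'}) (Q - {s'})" by fact
    show "joined (opp E) T (P - {s'})" "joined (opp E) T (Q - {s'})"
      using ST(3) L(1) opp_sym by (auto simp: joined_def)
  qed
qed

lemma red_partition_exists:
  assumes E: "simple E" and V: "finite V" "5 * k + 3 \<le> card V" "6 \<le> k"
    and no: "\<not> cyc E V (2 * k + 1)" and wh: "wheel_free E V (2 * k + 1)"
  shows "red_partition E V k"
proof -
  obtain v where v: "v \<in> V" "3 * k + 1 \<le> card {y \<in> V. opp E v y}" using low_vertex[OF E V no wh] by blast
  define X where "X = {y \<in> V. opp E v y}"
  define R where "R = {y \<in> V. E v y}"
  have X: "X \<subseteq> V" "3 * k + 1 \<le> card X" using v by (auto simp: X_def)
  have noB: "\<not> cyc (opp E) X (2 * k + 1)" by (rule wheel_freeD[OF wh v(1) X(1)]) (auto simp: X_def)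
  have noE: "\<not> cyc E X (2 * k + 1)" using no cyc_mono[OF _ X(1)] by blast
  obtain P Q A B where L: "X = P \<union> Q" "P \<inter> Q = {}" "linked E k P A" "linked E (k + 1) Q B" "k + 1 \<le> card P"
    by (rule red_links[OF E V no wh X noB])
  have k3: "3 \<le> k" using V(3) by simp
  have cl: "card P = k + 1 \<longrightarrow> clique E P" "card Q = k + 1 \<longrightarrow> clique E Q"
    using split_links[OF E L(2-5) k3 noE[unfolded L(1)] noB[unfolded L(1)]] by metis+
  have ir: "\<not> E v v" using E by (simp add: simple_def)
  have VX: "V = X \<union> {v} \<union> R" "v \<notin> X \<union> R" "R \<inter> X = {}"
    using v(1) ir by (auto simp: X_def R_def opp_def)
  have nv: "\<not> E v x" if "x \<in> P \<union> Q" for x using that unfolding L(1)[symmetric] by (simp add: X_def opp_def)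
  have vR: "E v r" if "r \<in> R" for r using that by (simp add: R_def)
  obtain s S where s: "s \<in> V" "S \<subseteq> V - {s}" "P - {s} \<subseteq> S" "S \<inter> Q = {}" "\<forall>x\<in>S. \<forall>y\<in>V - {s} - S. \<not> E x y"
    using cut[OF E L(3,4) V(3) VX(1)[unfolded L(1)] L(2) VX(2,3)[unfolded L(1)] vR nv no] by blast
  define T where "T = V - {s} - S"
  have ST: "V = insert s (S \<union> T)" "s \<notin> S \<union> T" "joined (opp E) S T"
    using s by (auto simp: T_def joined_def opp_def)
  have QT: "Q - {s} \<subseteq> T" using s(4) X(1) L(1) by (auto simp: T_def)
  have fin: "finite S" "finite T" "finite P" "finite Q" using V(1) ST(1) L(3,4) by (auto simp: linked_def)
  have cQ: "k + 1 \<le> card Q" using L(4) card_mono[OF fin(4), of B] by (auto simp: linked_def)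
  \<comment> \<open>Deleting \<open>s\<close> may cost a part of order \<open>k + 1\<close> one
    vertex. If its side has no further vertices to make up for this, the side is that remainder, a
    clique because the part was one.\<close>
  have side: "k + 1 \<le> card Z \<or> clique E Z" "Z \<noteq> {}"
    if Z: "Y - {s} \<subseteq> Z" "finite Z" "k + 1 \<le> card Y" "card Y = k + 1 \<longrightarrow> clique E Y" for Y Z
  proof -
    have c: "card Y - 1 \<le> card (Y - {s})" "card (Y - {s}) \<le> card Z"
      using card_mono[OF Z(2,1)] by (simp_all add: card_Diff_singleton_if)
    then show "Z \<noteq> {}" using Z(3) k3 by auto
    show "k + 1 \<le> card Z \<or> clique E Z"
    proof (cases "k + 1 \<le> card Z")
      case False
      then have "card (Y - {s}) = card Z" "card Y = k + 1" using c Z(3) by linarith+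
      then have "Y - {s} = Z" "clique E Y" using card_subset_eq[OF Z(2,1)] Z(4) by auto
      then show ?thesis by (auto simp: clique_def)
    qed simp
  qed
  show ?thesis
  proof (cases "card T \<le> card S")
    case True
    show ?thesis by (rule two_sides[OF E V no wh ST True side[OF QT fin(2) cQ cl(2)]])
  next
    case False
    have TS: "V = insert s (T \<union> S)" "s \<notin> T \<union> S" "joined (opp E) T S" "card S \<le> card T"
      using ST joined_sym[OF simple_opp[OF E]] False by auto
    show ?thesis by (rule two_sides[OF E V no wh TS side[OF s(3) fin(1) L(5) cl(1)]])
  qed
qed

section \<open>Transfer to graphs, copies and colourings\<close>

lemma cyc_nth:
  assumes "cyc E X n"
  obtains f :: "nat \<Rightarrow> 'a" where "inj_on f {..<n}" "f ` {..<n} \<subseteq> X" "\<forall>i<n. E (f i) (f (Suc i mod n))"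
proof -
  obtain xs where xs: "length xs = n" "3 \<le> n" "set xs \<subseteq> X" "distinct xs" "successively E xs" "E (last xs) (hd xs)"
    using assms unfolding cyc_def by blast
  show ?thesis
  proof (rule that[of "(!) xs"])
    show "inj_on ((!) xs) {..<n}" using xs by (auto simp: inj_on_def nth_eq_iff_index_eq)
    show "(!) xs ` {..<n} \<subseteq> X" using xs by auto
    show "\<forall>i<n. E (xs ! i) (xs ! (Suc i mod n))"
    proof (intro allI impI)
      fix i assume i: "i < n"
      show "E (xs ! i) (xs ! (Suc i mod n))"
      proof (cases "Suc i = n")
        case True
        have "xs \<noteq> []" using xs by auto
        then show ?thesis using True xs by (simp add: last_conv_nth hd_conv_nth flip: True)
      next
        case False then show ?thesis using i xs by (simp add: successively_conv_nth)
      qed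
    qed
  qed
qed

text \<open>An isomorphism must also reflect edges, so the copy carries exactly the images of the
  edges of \<open>F\<close> and not all edges on the image vertices.\<close>

lemma has_mono_copyI:
  assumes F: "simple_graph F" and f: "inj_on f (verts F)" "f ` verts F \<subseteq> V"
    and c: "\<And>e. e \<in> edges F \<Longrightarrow> col (f ` e) = c"
  shows "has_mono_copy (complete_graph V) col c F"
proof -
  have e: "e \<subseteq> verts F" "card e = 2" if "e \<in> edges F" for e using F that by (auto simp: simple_graph_def)
  have ce: "card (f ` e) = 2" if "e \<in> edges F" for e
    using card_image[OF inj_on_subset[OF f(1) e(1)[OF that]]] e(2)[OF that] by simp
  define H where "H = Graph (f ` verts F) ((`) f ` edges F)"
  have "subgraph H (complete_graph V)"
    using e(1) ce f(2) by (fastforce simp: H_def subgraph_def simple_graph_def complete_graph_def)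
  moreover have "{u, v} \<in> edges F \<longleftrightarrow> f ` {u, v} \<in> (`) f ` edges F" if uv: "u \<in> verts F" "v \<in> verts F" for u v
  proof
    assume "f ` {u, v} \<in> (`) f ` edges F"
    then obtain e' where e': "e' \<in> edges F" "f ` {u, v} = f ` e'" by blast
    then have "{u, v} = e'" using inj_on_image_eq_iff[OF f(1) _ e(1)[OF e'(1)], of "{u, v}"] uv by blast
    then show "{u, v} \<in> edges F" using e'(1) by simp
  qed blast
  then have "isomorphic F H"
    unfolding isomorphic_def by (intro exI[of _ f]) (use f(1) in \<open>simp add: H_def bij_betw_def\<close>)
  moreover have "\<forall>e\<in>edges H. col e = c" using c by (auto simp: H_def)
  ultimately show ?thesis unfolding has_mono_copy_def by blast
qed

lemma simple_cycle_graph: "3 \<le> n \<Longrightarrow> simple_graph (cycle_graph n)"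
proof -
  assume n: "3 \<le> n"
  have "i \<noteq> Suc i mod n" if "i < n" for i using that n by (cases "Suc i = n") auto
  then show ?thesis using n by (auto simp: simple_graph_def cycle_graph_def)
qed

lemma wheel_graph_simps:
  "verts (wheel_graph n) = Inl ` {..<n} \<union> {Inr ()}"
  "edges (wheel_graph n) = {{Inl i, Inl (Suc i mod n)} | i. i < n} \<union> {{Inl i, Inr ()} | i. i < n}"
proof -
  have no: "card e \<noteq> 2" for e :: "unit set" using card_mono[of "UNIV :: unit set" e] by simp
  show "verts (wheel_graph n) = Inl ` {..<n} \<union> {Inr ()}"
    by (auto simp: wheel_graph_def graph_join_def cycle_graph_def complete_graph_def)
  show "edges (wheel_graph n) = {{Inl i, Inl (Suc i mod n)} | i. i < n} \<union> {{Inl i, Inr ()} | i. i < n}"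
    using no by (auto simp: wheel_graph_def graph_join_def cycle_graph_def complete_graph_def setcompr_eq_image image_image)
qed

lemma simple_wheel_graph: "3 \<le> n \<Longrightarrow> simple_graph (wheel_graph n)"
proof -
  assume n: "3 \<le> n"
  have "i \<noteq> Suc i mod n" if "i < n" for i using that n by (cases "Suc i = n") auto
  then show ?thesis using n unfolding simple_graph_def wheel_graph_simps by auto
qed

lemma cyc_mono_copy:
  assumes "cyc E V n" "\<And>x y. E x y \<Longrightarrow> col {x, y} = c"
  shows "has_mono_copy (complete_graph V) col c (cycle_graph n)"
proof -
  have n: "3 \<le> n" using assms(1) by (auto simp: cyc_def)
  obtain f where f: "inj_on f {..<n}" "f ` {..<n} \<subseteq> V" "\<forall>i<n. E (f i) (f (Suc i mod n))"
    by (rule cyc_nth[OF assms(1)])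
  show ?thesis
    by (rule has_mono_copyI[OF simple_cycle_graph[OF n], of f])
      (use f assms(2) in \<open>auto simp: cycle_graph_def\<close>)
qed

lemma cyc_wheel_copy:
  assumes "cyc K {y \<in> V. K v y} n" "v \<in> V" "\<And>x y. K x y \<Longrightarrow> col {x, y} = c" "simple K"
  shows "has_mono_copy (complete_graph V) col c (wheel_graph n)"
proof -
  have n: "3 \<le> n" using assms(1) by (auto simp: cyc_def)
  obtain f where f: "inj_on f {..<n}" "f ` {..<n} \<subseteq> {y \<in> V. K v y}" "\<forall>i<n. K (f i) (f (Suc i mod n))"
    by (rule cyc_nth[OF assms(1)])
  have fv: "f i \<in> V" "K v (f i)" "f i \<noteq> v" if "i < n" for i using f(2) that assms(4) by (auto simp: simple_def)
  let ?g = "case_sum f (\<lambda>_. v)"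
  show ?thesis
  proof (rule has_mono_copyI[OF simple_wheel_graph[OF n], of ?g])
    show "inj_on ?g (verts (wheel_graph n))"
      using f(1) fv(3) unfolding wheel_graph_simps inj_on_def by fastforce
    show "?g ` verts (wheel_graph n) \<subseteq> V" using fv(1) assms(2) by (auto simp: wheel_graph_simps)
    fix e assume "e \<in> edges (wheel_graph n)"
    then consider i where "i < n" "e = {Inl i, Inl (Suc i mod n)}" | i where "i < n" "e = {Inl i, Inr ()}"
      unfolding wheel_graph_simps by blast
    then show "col (?g ` e) = c"
    proof cases
      case 1 then show ?thesis using assms(3)[OF f(3)[rule_format]] by simp
    next
      case 2 then show ?thesis using assms(3)[OF fv(2)] by (simp add: insert_commute)
    qed
  qed
qed

theorem theorem1:
  fixes k N :: nat and G :: "'a graph" and V :: "'a set" and col :: "'a set \<Rightarrow> colour"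
  assumes "k \<ge> 6" and "N \<ge> 5 * k + 3"
    and "finite V" and "card V = N" and "G = complete_graph V"
    and "\<not> has_mono_copy G col Red (cycle_graph (2 * k + 1))"
    and "\<not> has_mono_copy G col Blue (wheel_graph (2 * k + 1))"
  shows "\<exists>U :: nat \<Rightarrow> 'a set.
      disjoint_family_on U {0..3} \<and> (\<Union>i\<in>{0..3}. U i) = verts G \<and>
      card (U 0) \<le> 2 \<and> (\<forall>i\<in>{1..3}. card (U i) \<le> 2 * k) \<and>
      (\<forall>u v. {u, v} \<in> edges (delete_verts G (U 0)) \<longrightarrow>
         (\<forall>i\<in>{1..3}. u \<in> U i \<and> v \<in> U i \<longrightarrow> col {u, v} = Red) \<and>
         (\<forall>i\<in>{1..3}. \<forall>j\<in>{1..3}. i \<noteq> j \<and> u \<in> U i \<and> v \<in> U j \<longrightarrow> col {u, v} = Blue))"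
proof -
  define E where "E u v \<longleftrightarrow> u \<noteq> v \<and> col {u, v} = Red" for u v
  have E: "simple E" by (auto simp: simple_def E_def insert_commute)
  have B: "col {u, v} = Blue" if "opp E u v" for u v using that by (cases "col {u, v}") (auto simp: opp_def E_def)
  have no: "\<not> cyc E V (2 * k + 1)"
    using assms(5,6) cyc_mono_copy[of E V "2 * k + 1" col Red] by (auto simp: E_def)
  have wh: "wheel_free E V (2 * k + 1)" unfolding wheel_free_def
  proof (intro ballI notI)
    fix v assume "v \<in> V" "cyc (opp E) {y \<in> V. opp E v y} (2 * k + 1)"
    then have "has_mono_copy (complete_graph V) col Blue (wheel_graph (2 * k + 1))"
      by (intro cyc_wheel_copy[of "opp E" V v]) (use B simple_opp[OF E] in auto)
    then show False using assms(5,7) by simp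
  qed
  have "red_partition E V k" by (rule red_partition_exists[OF E _ _ _ no wh]) (use assms in auto)
  then obtain U0 U1 U2 U3 where U: "V = U0 \<union> U1 \<union> U2 \<union> U3" "U0 \<inter> (U1 \<union> U2 \<union> U3) = {}"
    and c: "card U0 \<le> 2" "card U1 \<le> 2 * k" "card U2 \<le> 2 * k" "card U3 \<le> 2 * k"
    and r: "clique E U1" "clique E U2" "clique E U3"
    and b: "joined (opp E) U1 U2" "joined (opp E) U1 U3" "joined (opp E) U2 U3"
    unfolding red_partition_def by blast
  have d: "U1 \<inter> U2 = {}" "U1 \<inter> U3 = {}" "U2 \<inter> U3 = {}"
    using joined_disj[OF simple_opp[OF E]] b by blast+
  define U where "U i = (if i = 0 then U0 else if i = 1 then U1 else if i = 2 then U2 else U3)" for i :: nat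
  have s: "{0..3} = {0, 1, 2, 3 :: nat}" "{1..3} = {1, 2, 3 :: nat}" by auto
  have Us: "U 0 = U0" "U 1 = U1" "U (Suc 0) = U1" "U 2 = U2" "U 3 = U3" by (simp_all add: U_def)
  have R: "col {u, v} = Red" if "u \<noteq> v" "u \<in> U i" "v \<in> U i" "i \<in> {1..3}" for u v i
    using that r unfolding s by (auto simp: Us clique_def E_def)
  have Bl: "col {u, v} = Blue" if "i \<noteq> j" "u \<in> U i" "v \<in> U j" "i \<in> {1..3}" "j \<in> {1..3}" for u v i j
  proof -
    have "opp E u v \<or> opp E v u" using that b unfolding s by (auto simp: Us joined_def)
    then show ?thesis using B by (metis insert_commute)
  qed
  have ne: "u \<noteq> v" if "{u, v} \<in> edges (delete_verts G (U 0))" for u v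
    using that assms(5) by (auto simp: delete_verts_def complete_graph_def)
  show ?thesis
  proof (intro exI[of _ U] conjI allI impI)
    show "disjoint_family_on U {0..3}" unfolding disjoint_family_on_def s using U(2) d by (auto simp: Us)
    show "(\<Union>i\<in>{0..3}. U i) = verts G" unfolding s using U(1) assms(5) by (auto simp: Us complete_graph_def)
    show "card (U 0) \<le> 2" "\<forall>i\<in>{1..3}. card (U i) \<le> 2 * k" unfolding s using c by (auto simp: Us)
  qed (use R Bl ne in blast)+
qed

end
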